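(* Let $K$ be a field of characteristic zero. Let $L$ be the supersubgroup of $GL(2|2)$ such that for every supercommutative $K$-superalgebra $C$ the group $L(C)$ consists of all matrices $$\begin{pmatrix} A & B \\ B & A \end{pmatrix},\qquad A=\begin{pmatrix}\alpha_1&\alpha_2\\ 0&\alpha_1\end{pmatrix},\quad B=\begin{pmatrix}t&(1+\alpha_1^{-1}\alpha_2)t\\ 0&t\end{pmatrix},$$ with $\alpha_1\in C_0^{\times}$, $\alpha_2\in C_0$, $t\in C_1$. Let $\mathfrak L=\mathsf{Lie}(L)$, let $\mathfrak L'=[\mathfrak L,\mathfrak L]$, and let $L'$ be the commutator supersubgroup of $L$. Then $\mathfrak L'$ is a proper supersubalgebra of $\mathsf{Lie}(L')$; in particular $\mathsf{Lie}(L')\ne\mathsf{Lie}(L)'$.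
   Context: Supergroups are group-valued functors on supercommutative $K$-superalgebras represented by supercommutative Hopf superalgebras; supersubgroups are closed. $GL(2|2)(C)$ is the group of even $C$-linear automorphisms of $K^{2|2}\otimes C$, written as block matrices whose diagonal blocks have entries in $C_0$ and off-diagonal blocks entries in $C_1$. $\mathsf{Lie}(G)=(\mathfrak m/\mathfrak m^2)^*$, $\mathfrak m=\ker\epsilon_G$, with bracket the supercommutator of convolution. The commutator supersubgroup (commutant) $G'$ of an algebraic supergroup $G$ is the smallest closed supersubgroup such that $G'(C)$ contains all products of commutators $[x_1,y_1]\cdots[x_n,y_n]$ with $x_i,y_i\in G(C)$, for every supercommutative superalgebra $C$. *)

theory Defs
  imports "HOL-Algebra.Generated_Groups" "HOL-Algebra.Module" "HOL-Library.Z2"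
begin

section \<open>Superalgebras\<close>

text \<open>The ground field is a type of class \<^class>\<open>field\<close>. The grading is by the two-element type
  \<^typ>\<open>bit\<close>, so that \<open>i + j\<close> is addition of parities.\<close>

record ('k, 'a) superalgebra = "('k, 'a) module" +
  part :: "bit \<Rightarrow> 'a set"

definition ground :: "('k::field, 'k) superalgebra" where
  "ground = \<lparr>carrier = UNIV, mult = (*), one = 1, zero = 0, add = (+), smult = (*),
             part = (\<lambda>i. if i = 0 then UNIV else {0})\<rparr>"

definition ksign :: "bit \<Rightarrow> bit \<Rightarrow> 'k::field" where
  "ksign i j = (if i = 1 \<and> j = 1 then - 1 else 1)"

locale superalgebra = ring A for A :: "('k::field, 'a, 'm) superalgebra_scheme" (structure) +
  assumes module: "module (ground :: ('k, 'k) superalgebra) A"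
    and smult_mult_left: "\<lbrakk>x \<in> carrier A; y \<in> carrier A\<rbrakk> \<Longrightarrow> (r \<odot> x) \<otimes> y = r \<odot> (x \<otimes> y)"
    and smult_mult_right: "\<lbrakk>x \<in> carrier A; y \<in> carrier A\<rbrakk> \<Longrightarrow> x \<otimes> (r \<odot> y) = r \<odot> (x \<otimes> y)"
    and part_submodule: "submodule (part A i) (ground :: ('k, 'k) superalgebra) A"
    and part_sum: "x \<in> carrier A \<Longrightarrow> \<exists>y\<in>part A 0. \<exists>z\<in>part A 1. x = y \<oplus> z"
    and part_inter: "part A 0 \<inter> part A 1 = {\<zero>}"
    and one_part: "\<one> \<in> part A 0"
    and mult_part: "\<lbrakk>x \<in> part A i; y \<in> part A j\<rbrakk> \<Longrightarrow> x \<otimes> y \<in> part A (i + j)"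

locale supercommutative_superalgebra = superalgebra +
  assumes supercomm: "\<lbrakk>x \<in> part A i; y \<in> part A j\<rbrakk> \<Longrightarrow> x \<otimes> y = ksign i j \<odot> (y \<otimes> x)"

definition component :: "('k, 'a, 'm) superalgebra_scheme \<Rightarrow> bit \<Rightarrow> 'a \<Rightarrow> 'a" where
  "component A i x = (THE y. y \<in> part A i \<and> (\<exists>z\<in>part A (i + 1). x = y \<oplus>\<^bsub>A\<^esub> z))"

definition linear_map ::
  "('k, 'a, 'm) superalgebra_scheme \<Rightarrow> ('k, 'b, 'n) superalgebra_scheme \<Rightarrow> ('a \<Rightarrow> 'b) \<Rightarrow> bool" where
  "linear_map A B f \<longleftrightarrow> f \<in> carrier A \<rightarrow> carrier B \<and>
     (\<forall>x\<in>carrier A. \<forall>y\<in>carrier A. f (x \<oplus>\<^bsub>A\<^esub> y) = f x \<oplus>\<^bsub>B\<^esub> f y) \<and>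
     (\<forall>r. \<forall>x\<in>carrier A. f (r \<odot>\<^bsub>A\<^esub> x) = r \<odot>\<^bsub>B\<^esub> f x)"

definition even_linear_map ::
  "('k, 'a, 'm) superalgebra_scheme \<Rightarrow> ('k, 'b, 'n) superalgebra_scheme \<Rightarrow> ('a \<Rightarrow> 'b) \<Rightarrow> bool" where
  "even_linear_map A B f \<longleftrightarrow> linear_map A B f \<and> (\<forall>i. f ` part A i \<subseteq> part B i)"

definition superalgebra_hom ::
  "('k, 'a, 'm) superalgebra_scheme \<Rightarrow> ('k, 'b, 'n) superalgebra_scheme \<Rightarrow> ('a \<Rightarrow> 'b) \<Rightarrow> bool" where
  "superalgebra_hom A B f \<longleftrightarrow> even_linear_map A B f \<and> f \<one>\<^bsub>A\<^esub> = \<one>\<^bsub>B\<^esub> \<and>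
     (\<forall>x\<in>carrier A. \<forall>y\<in>carrier A. f (x \<otimes>\<^bsub>A\<^esub> y) = f x \<otimes>\<^bsub>B\<^esub> f y)"

section \<open>Tensor products\<close>

text \<open>Over a field, \<open>A \<otimes> B\<close> embeds into the dual of the space of bilinear forms on \<open>A \<times> B\<close>, the pure
  tensor \<open>a \<otimes> b\<close> being the evaluation \<open>\<beta> \<mapsto> \<beta> a b\<close>; the tensor product is taken to be the span of
  these evaluations. For a tensor \<open>u\<close>, the number \<open>u \<beta>\<close> is thus the value at \<open>u\<close> of the linear form
  on \<open>A \<otimes> B\<close> induced by \<open>\<beta>\<close>. All tensors are \<open>0\<close> on arguments that are not bilinear.\<close>

type_synonym ('k, 'a, 'b) tensor = "('a \<Rightarrow> 'b \<Rightarrow> 'k) \<Rightarrow> 'k"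

definition bilinear_form ::
  "('k::field, 'a, 'm) superalgebra_scheme \<Rightarrow> ('k, 'b, 'n) superalgebra_scheme
    \<Rightarrow> ('a \<Rightarrow> 'b \<Rightarrow> 'k) \<Rightarrow> bool" where
  "bilinear_form A B \<beta> \<longleftrightarrow>
     (\<forall>b\<in>carrier B. linear_map A ground (\<lambda>a. \<beta> a b)) \<and>
     (\<forall>a\<in>carrier A. linear_map B ground (\<lambda>b. \<beta> a b))"

definition pure_tensor ::
  "('k::field, 'a, 'm) superalgebra_scheme \<Rightarrow> ('k, 'b, 'n) superalgebra_scheme
    \<Rightarrow> 'a \<Rightarrow> 'b \<Rightarrow> ('k, 'a, 'b) tensor" where
  "pure_tensor A B a b = (\<lambda>\<beta>. if bilinear_form A B \<beta> then \<beta> a b else 0)"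

definition tensor_span ::
  "('k::field, 'a, 'm) superalgebra_scheme \<Rightarrow> ('k, 'b, 'n) superalgebra_scheme
    \<Rightarrow> ('a \<times> 'b) set \<Rightarrow> ('k, 'a, 'b) tensor set" where
  "tensor_span A B S = {u. \<exists>(n::nat) a b. (\<forall>i<n. (a i, b i) \<in> S) \<and>
     u = (\<lambda>\<beta>. \<Sum>i<n. pure_tensor A B (a i) (b i) \<beta>)}"

text \<open>The multiplication is \<open>(a \<otimes> b) (a' \<otimes> b') = (-1)^(|b| |a'|) a a' \<otimes> b b'\<close>.\<close>

definition tensor ::
  "('k::field, 'a, 'm) superalgebra_scheme \<Rightarrow> ('k, 'b, 'n) superalgebra_scheme
    \<Rightarrow> ('k, ('k, 'a, 'b) tensor) superalgebra" where
  "tensor A B =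
    \<lparr>carrier = tensor_span A B (carrier A \<times> carrier B),
     mult = (\<lambda>u v \<beta>. if bilinear_form A B \<beta>
       then u (\<lambda>a b. v (\<lambda>a' b'. \<Sum>i\<in>{0, 1}. \<Sum>j\<in>{0, 1}.
              ksign i j * \<beta> (a \<otimes>\<^bsub>A\<^esub> component A j a') (component B i b \<otimes>\<^bsub>B\<^esub> b')))
       else 0),
     one = pure_tensor A B \<one>\<^bsub>A\<^esub> \<one>\<^bsub>B\<^esub>,
     zero = (\<lambda>\<beta>. 0),
     add = (\<lambda>u v \<beta>. u \<beta> + v \<beta>),
     smult = (\<lambda>r u \<beta>. r * u \<beta>),
     part = (\<lambda>k. tensor_span A B (\<Union>i. part A i \<times> part B (i + k)))\<rparr>"

definition tensor_map ::
  "('k::field, 'c, 'm) superalgebra_scheme \<Rightarrow> ('k, 'd, 'n) superalgebra_scheme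
    \<Rightarrow> ('a \<Rightarrow> 'c) \<Rightarrow> ('b \<Rightarrow> 'd) \<Rightarrow> ('k, 'a, 'b) tensor \<Rightarrow> ('k, 'c, 'd) tensor" where
  "tensor_map C D f g u = (\<lambda>\<beta>. if bilinear_form C D \<beta> then u (\<lambda>a b. \<beta> (f a) (g b)) else 0)"

text \<open>The canonical map \<open>(A \<otimes> B) \<otimes> C \<rightarrow> A \<otimes> (B \<otimes> C)\<close>.\<close>

definition tensor_assoc ::
  "('k::field, 'a, 'm) superalgebra_scheme \<Rightarrow> ('k, 'b, 'n) superalgebra_scheme
    \<Rightarrow> ('k, 'c, 'o) superalgebra_scheme
    \<Rightarrow> ('k, ('k, 'a, 'b) tensor, 'c) tensor \<Rightarrow> ('k, 'a, ('k, 'b, 'c) tensor) tensor" where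
  "tensor_assoc A B C u = (\<lambda>\<beta>. if bilinear_form A (tensor B C) \<beta>
     then u (\<lambda>w c. w (\<lambda>a b. \<beta> a (pure_tensor B C b c))) else 0)"

text \<open>The linear map \<open>A \<otimes> B \<rightarrow> C\<close> induced by a bilinear map \<open>h\<close>.\<close>

definition tensor_lift ::
  "('k::field, 'a, 'm) superalgebra_scheme \<Rightarrow> ('k, 'b, 'n) superalgebra_scheme
    \<Rightarrow> ('k, 'c, 'o) superalgebra_scheme \<Rightarrow> ('a \<Rightarrow> 'b \<Rightarrow> 'c) \<Rightarrow> ('k, 'a, 'b) tensor \<Rightarrow> 'c" where
  "tensor_lift A B C h u = (THE c. \<exists>(n::nat) a b. (\<forall>i<n. a i \<in> carrier A \<and> b i \<in> carrier B) \<and>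
     u = (\<lambda>\<beta>. \<Sum>i<n. pure_tensor A B (a i) (b i) \<beta>) \<and>
     c = (\<Oplus>\<^bsub>C\<^esub>i\<in>{..<n}. h (a i) (b i)))"

section \<open>Hopf superalgebras and supergroups\<close>

record ('k, 'a) hopf_superalgebra = "('k, 'a) superalgebra" +
  comult :: "'a \<Rightarrow> ('k, 'a, 'a) tensor"
  counit :: "'a \<Rightarrow> 'k"
  antipode :: "'a \<Rightarrow> 'a"

definition convolution ::
  "('k::field, 'a, 'm) hopf_superalgebra_scheme \<Rightarrow> ('k, 'c, 'n) superalgebra_scheme
    \<Rightarrow> ('a \<Rightarrow> 'c) \<Rightarrow> ('a \<Rightarrow> 'c) \<Rightarrow> 'a \<Rightarrow> 'c" where
  "convolution H C f g x = tensor_lift H H C (\<lambda>a b. f a \<otimes>\<^bsub>C\<^esub> g b) (comult H x)"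

locale hopf_superalgebra = superalgebra H
  for H :: "('k::field, 'a, 'm) hopf_superalgebra_scheme" (structure) +
  assumes comult_hom: "superalgebra_hom H (tensor H H) (comult H)"
    and counit_hom: "superalgebra_hom H (ground :: ('k, 'k) superalgebra) (counit H)"
    and antipode_linear: "even_linear_map H H (antipode H)"
    and coassoc: "x \<in> carrier H \<Longrightarrow>
      tensor_assoc H H H (tensor_map (tensor H H) H (comult H) (\<lambda>y. y) (comult H x)) =
      tensor_map H (tensor H H) (\<lambda>y. y) (comult H) (comult H x)"
    and counit_left: "x \<in> carrier H \<Longrightarrow>
      tensor_lift H H H (\<lambda>a b. counit H a \<odot> b) (comult H x) = x"
    and counit_right: "x \<in> carrier H \<Longrightarrow>
      tensor_lift H H H (\<lambda>a b. counit H b \<odot> a) (comult H x) = x"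
    and antipode_left: "x \<in> carrier H \<Longrightarrow>
      convolution H H (antipode H) (\<lambda>y. y) x = counit H x \<odot> \<one>"
    and antipode_right: "x \<in> carrier H \<Longrightarrow>
      convolution H H (\<lambda>y. y) (antipode H) x = counit H x \<odot> \<one>"

text \<open>A supergroup is given by its coordinate Hopf superalgebra; its group of \<open>C\<close>-points is
  \<open>Hom(H, C)\<close> with the convolution product.\<close>

locale supergroup = hopf_superalgebra H + supercommutative_superalgebra H
  for H :: "('k::field, 'a, 'm) hopf_superalgebra_scheme" (structure)

definition points ::
  "('k::field, 'a, 'm) hopf_superalgebra_scheme \<Rightarrow> ('k, 'c, 'n) superalgebra_scheme
    \<Rightarrow> ('a \<Rightarrow> 'c) monoid" where
  "points H C =
    \<lparr>carrier = {f \<in> extensional (carrier H). superalgebra_hom H C f},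
     mult = (\<lambda>f g. restrict (convolution H C f g) (carrier H)),
     one = (\<lambda>x\<in>carrier H. counit H x \<odot>\<^bsub>C\<^esub> \<one>\<^bsub>C\<^esub>)\<rparr>"

definition hopf_superalgebra_hom ::
  "('k::field, 'a, 'm) hopf_superalgebra_scheme \<Rightarrow> ('k, 'b, 'n) hopf_superalgebra_scheme
    \<Rightarrow> ('a \<Rightarrow> 'b) \<Rightarrow> bool" where
  "hopf_superalgebra_hom H H' p \<longleftrightarrow> superalgebra_hom H H' p \<and>
     (\<forall>x\<in>carrier H. comult H' (p x) = tensor_map H' H' p p (comult H x) \<and>
        counit H' (p x) = counit H x \<and> antipode H' (p x) = p (antipode H x))"

text \<open>A closed supersubgroup of the supergroup with coordinate algebra \<open>G\<close> is a supergroup with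
  coordinate algebra \<open>H\<close> and a surjection \<open>p\<close> from \<open>G\<close> onto \<open>H\<close>, that is \<open>G\<close> modulo the Hopf superideal
  \<open>ker p\<close>. Precomposition with \<open>p\<close> embeds its points into those of \<open>G\<close>.\<close>

definition closed_supersubgroup ::
  "('k::field, 'a, 'm) hopf_superalgebra_scheme \<Rightarrow> ('k, 'b, 'n) hopf_superalgebra_scheme
    \<Rightarrow> ('a \<Rightarrow> 'b) \<Rightarrow> bool" where
  "closed_supersubgroup G H p \<longleftrightarrow> supergroup G \<and> supergroup H \<and>
     hopf_superalgebra_hom G H p \<and> p ` carrier G = carrier H"

definition subpoints ::
  "('k::field, 'a, 'm) hopf_superalgebra_scheme \<Rightarrow> ('k, 'b, 'n) hopf_superalgebra_scheme
    \<Rightarrow> ('a \<Rightarrow> 'b) \<Rightarrow> ('k, 'c, 'o) superalgebra_scheme \<Rightarrow> ('a \<Rightarrow> 'c) set" where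
  "subpoints G H p C = (\<lambda>f. compose (carrier G) f p) ` carrier (points H C)"

text \<open>The inverse of a commutator is a commutator, so \<open>derived X (carrier X)\<close> is the set of all
  products of commutators of a group \<open>X\<close>. Superalgebras range over those with carrier in the type
  \<open>'c\<close>; this amounts to all superalgebras once \<open>'c\<close> is large enough for the finitely generated
  ones.\<close>

definition contains_commutators ::
  "('k::field, 'c) hopf_superalgebra \<Rightarrow> ('k, 'c) hopf_superalgebra \<Rightarrow> ('c \<Rightarrow> 'c) \<Rightarrow> bool" where
  "contains_commutators G H p \<longleftrightarrow>
     (\<forall>C :: ('k, 'c) superalgebra. supercommutative_superalgebra C \<longrightarrow>
        derived (points G C) (carrier (points G C)) \<subseteq> subpoints G H p C)"

definition commutator_supersubgroup ::
  "('k::field, 'c) hopf_superalgebra \<Rightarrow> ('k, 'c) hopf_superalgebra \<Rightarrow> ('c \<Rightarrow> 'c) \<Rightarrow> bool" where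
  "commutator_supersubgroup G G' q \<longleftrightarrow>
     closed_supersubgroup G G' q \<and> contains_commutators G G' q \<and>
     (\<forall>(H :: ('k, 'c) hopf_superalgebra) p.
        closed_supersubgroup G H p \<and> contains_commutators G H p \<longrightarrow>
        (\<forall>C :: ('k, 'c) superalgebra. supercommutative_superalgebra C \<longrightarrow>
           subpoints G G' q C \<subseteq> subpoints G H p C))"

section \<open>The Lie superalgebra of a supergroup\<close>

text \<open>Linear forms on \<open>H\<close> are extended by \<open>0\<close> outside \<open>carrier H\<close>. Since \<open>H\<close> is the direct sum of the
  scalars and \<open>m = ker \<epsilon>\<close>, elements of \<open>(m / m\<^sup>2)\<^sup>*\<close> are the linear forms on \<open>H\<close> vanishing at \<open>1\<close> and
  on \<open>m\<^sup>2\<close>; convolution is formed with these.\<close>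

definition dual :: "('k::field, 'a, 'm) superalgebra_scheme \<Rightarrow> ('a \<Rightarrow> 'k) set" where
  "dual A = {f. linear_map A ground f \<and> (\<forall>x. x \<notin> carrier A \<longrightarrow> f x = 0)}"

definition aug_ideal :: "('k::field, 'a, 'm) hopf_superalgebra_scheme \<Rightarrow> 'a set" where
  "aug_ideal H = {x \<in> carrier H. counit H x = 0}"

definition Lie :: "('k::field, 'a, 'm) hopf_superalgebra_scheme \<Rightarrow> ('a \<Rightarrow> 'k) set" where
  "Lie H = {f \<in> dual H. f \<one>\<^bsub>H\<^esub> = 0 \<and> (\<forall>x\<in>aug_ideal H. \<forall>y\<in>aug_ideal H. f (x \<otimes>\<^bsub>H\<^esub> y) = 0)}"

definition dual_component ::
  "('k::field, 'a, 'm) superalgebra_scheme \<Rightarrow> bit \<Rightarrow> ('a \<Rightarrow> 'k) \<Rightarrow> 'a \<Rightarrow> 'k" where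
  "dual_component A i f = (\<lambda>x. if x \<in> carrier A then f (component A i x) else 0)"

text \<open>\<open>(f * g)(x) = \<Sum> (-1)^(|g| |x\<^sub>1|) f(x\<^sub>1) g(x\<^sub>2)\<close>, where \<open>|g| = |x\<^sub>2|\<close> in every nonzero term.\<close>

definition dual_convolution ::
  "('k::field, 'a, 'm) hopf_superalgebra_scheme \<Rightarrow> ('a \<Rightarrow> 'k) \<Rightarrow> ('a \<Rightarrow> 'k) \<Rightarrow> 'a \<Rightarrow> 'k" where
  "dual_convolution H f g = (\<lambda>x. if x \<in> carrier H
     then comult H x (\<lambda>a b. \<Sum>i\<in>{0, 1}. \<Sum>j\<in>{0, 1}.
            ksign i j * f (component H i a) * g (component H j b))
     else 0)"

definition Lie_bracket ::
  "('k::field, 'a, 'm) hopf_superalgebra_scheme \<Rightarrow> ('a \<Rightarrow> 'k) \<Rightarrow> ('a \<Rightarrow> 'k) \<Rightarrow> 'a \<Rightarrow> 'k" where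
  "Lie_bracket H f g = (\<lambda>x. \<Sum>i\<in>{0, 1}. \<Sum>j\<in>{0, 1}.
     dual_convolution H (dual_component H i f) (dual_component H j g) x -
     ksign i j * dual_convolution H (dual_component H j g) (dual_component H i f) x)"

definition Lie_supersubalgebra ::
  "('k::field, 'a, 'm) hopf_superalgebra_scheme \<Rightarrow> ('a \<Rightarrow> 'k) set \<Rightarrow> bool" where
  "Lie_supersubalgebra H V \<longleftrightarrow> V \<subseteq> Lie H \<and> (\<lambda>x. 0) \<in> V \<and>
     (\<forall>f\<in>V. \<forall>g\<in>V. (\<lambda>x. f x + g x) \<in> V) \<and>
     (\<forall>r. \<forall>f\<in>V. (\<lambda>x. r * f x) \<in> V) \<and>
     (\<forall>i. \<forall>f\<in>V. dual_component H i f \<in> V) \<and>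
     (\<forall>f\<in>V. \<forall>g\<in>V. Lie_bracket H f g \<in> V)"

text \<open>The derived superalgebra: the linear span of all brackets.\<close>

definition Lie_derived :: "('k::field, 'a, 'm) hopf_superalgebra_scheme \<Rightarrow> ('a \<Rightarrow> 'k) set" where
  "Lie_derived H = {h. \<exists>(n::nat) r f g. (\<forall>i<n. f i \<in> Lie H \<and> g i \<in> Lie H) \<and>
     h = (\<lambda>x. \<Sum>i<n. r i * Lie_bracket H (f i) (g i) x)}"

text \<open>The Lie superalgebra of a closed supersubgroup as a subset of \<open>Lie G\<close>, through the differential
  \<open>f \<mapsto> f \<circ> p\<close> of the inclusion.\<close>

definition Lie_sub ::
  "('k::field, 'a, 'm) hopf_superalgebra_scheme \<Rightarrow> ('k, 'b, 'n) hopf_superalgebra_scheme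
    \<Rightarrow> ('a \<Rightarrow> 'b) \<Rightarrow> ('a \<Rightarrow> 'k) set" where
  "Lie_sub G H p = (\<lambda>f x. if x \<in> carrier G then f (p x) else 0) ` Lie H"

section \<open>The general linear supergroup and the supergroup L\<close>

definition index_parity :: "nat \<Rightarrow> nat \<Rightarrow> bit" where
  "index_parity m i = (if i < m then 0 else 1)"

definition supermatrix_monoid ::
  "nat \<Rightarrow> nat \<Rightarrow> ('k, 'c, 'm) superalgebra_scheme \<Rightarrow> (nat \<times> nat \<Rightarrow> 'c) monoid" where
  "supermatrix_monoid m n C =
    \<lparr>carrier = (\<Pi>\<^sub>E (i, j)\<in>{..<m + n} \<times> {..<m + n}. part C (index_parity m i + index_parity m j)),
     mult = (\<lambda>X Y. restrict (\<lambda>(i, j). \<Oplus>\<^bsub>C\<^esub>l\<in>{..<m + n}. X (i, l) \<otimes>\<^bsub>C\<^esub> Y (l, j))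
       ({..<m + n} \<times> {..<m + n})),
     one = restrict (\<lambda>(i, j). if i = j then \<one>\<^bsub>C\<^esub> else \<zero>\<^bsub>C\<^esub>) ({..<m + n} \<times> {..<m + n})\<rparr>"

definition GL ::
  "nat \<Rightarrow> nat \<Rightarrow> ('k, 'c, 'm) superalgebra_scheme \<Rightarrow> (nat \<times> nat \<Rightarrow> 'c) monoid" where
  "GL m n C = units_of (supermatrix_monoid m n C)"

definition coordinate_matrix ::
  "nat \<Rightarrow> (nat \<times> nat \<Rightarrow> 'a) \<Rightarrow> ('a \<Rightarrow> 'c) \<Rightarrow> nat \<times> nat \<Rightarrow> 'c" where
  "coordinate_matrix N \<xi> f = (\<lambda>ij\<in>{..<N} \<times> {..<N}. f (\<xi> ij))"

text \<open>\<open>H\<close> represents the group functor \<open>GL m n\<close>, with universal matrix \<open>\<xi>\<close>.\<close>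

definition represents_GL ::
  "nat \<Rightarrow> nat \<Rightarrow> ('k::field, 'c) hopf_superalgebra \<Rightarrow> (nat \<times> nat \<Rightarrow> 'c) \<Rightarrow> bool" where
  "represents_GL m n H \<xi> \<longleftrightarrow> supergroup H \<and>
     (\<forall>i<m + n. \<forall>j<m + n. \<xi> (i, j) \<in> carrier H) \<and>
     (\<forall>C :: ('k, 'c) superalgebra. supercommutative_superalgebra C \<longrightarrow>
        coordinate_matrix (m + n) \<xi> \<in> iso (points H C) (GL m n C))"

definition L_matrix ::
  "('k, 'c, 'm) superalgebra_scheme \<Rightarrow> 'c \<Rightarrow> 'c \<Rightarrow> 'c \<Rightarrow> nat \<times> nat \<Rightarrow> 'c" where
  "L_matrix C \<alpha>\<^sub>1 \<alpha>\<^sub>2 t =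
    (let o' = \<zero>\<^bsub>C\<^esub>; t' = (\<one>\<^bsub>C\<^esub> \<oplus>\<^bsub>C\<^esub> inv\<^bsub>C\<^esub> \<alpha>\<^sub>1 \<otimes>\<^bsub>C\<^esub> \<alpha>\<^sub>2) \<otimes>\<^bsub>C\<^esub> t
     in restrict (\<lambda>(i, j).
       [[\<alpha>\<^sub>1, \<alpha>\<^sub>2, t,  t'],
        [o', \<alpha>\<^sub>1, o', t ],
        [t,  t',  \<alpha>\<^sub>1, \<alpha>\<^sub>2],
        [o', t,   o', \<alpha>\<^sub>1]] ! i ! j) ({..<4} \<times> {..<4}))"

definition L_matrices :: "('k, 'c, 'm) superalgebra_scheme \<Rightarrow> (nat \<times> nat \<Rightarrow> 'c) set" where
  "L_matrices C = {L_matrix C \<alpha>\<^sub>1 \<alpha>\<^sub>2 t | \<alpha>\<^sub>1 \<alpha>\<^sub>2 t.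
     \<alpha>\<^sub>1 \<in> part C 0 \<inter> Units C \<and> \<alpha>\<^sub>2 \<in> part C 0 \<and> t \<in> part C 1}"

end

theory Submission
  imports Defs "HOL-Computational_Algebra.Polynomial_FPS"
begin

text \<open>In the coordinates \<open>(\<alpha>\<^sub>1, a = \<alpha>\<^sub>1\<^sup>-\<^sup>1 \<alpha>\<^sub>2, s = \<alpha>\<^sub>1\<^sup>-\<^sup>1 t)\<close> the product of \<open>L\<close> is
  \<open>(\<alpha>, a, s) (\<beta>, b, r) = (\<alpha> \<beta> (1 + s r), a + b + 2 s r, s + r)\<close>. Commutators are the points
  \<open>(1 + u, 2 u, 0)\<close> with \<open>u = 2 s r\<close>, and brackets are multiples of their direction \<open>D\<close>, so \<open>Lie(L)'\<close>
  is spanned by \<open>D\<close>. In characteristic zero a closed supersubgroup containing these points contains the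
  one-parameter subgroup \<open>(e\<^sup>u, 2 u, 0)\<close> generated by \<open>D\<close>. As \<open>e\<^sup>u\<close> is transcendental over the
  polynomials in \<open>u\<close>, that subgroup is Zariski dense in the even part, so \<open>Lie(L')\<close> contains all even
  tangent vectors.\<close>

section \<open>Exponential polynomials\<close>

text \<open>As a matrix, \<open>D\<close> is twice the identity plus 4 times a nilpotent; the
  nilpotent part comes from the summand 1 in the entry
  \<open>(1 + \<alpha>\<^sub>1\<^sup>-\<^sup>1 \<alpha>\<^sub>2) t\<close>. In characteristic zero a
  closed subgroup of G_m x G_a tangent to such a sum is tangent to both parts; the nilpotent part is
  the vector missing from the derived superalgebra. The obstacle is that the Hopf superalgebras of
  \<open>L\<close> and \<open>L'\<close> are given only abstractly. What is known is the points of
  \<open>L\<close>, so everything is computed on points over test algebras: exponential polynomials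
  with two square-zero generators. Integration and density become statements about linear forms
  killing the kernel of the map from \<open>L\<close> to \<open>L'\<close>. The Taylor coefficients
  of the one-parameter subgroup are, up to scalars, convolution powers of \<open>D\<close>, so they
  kill the kernel. Hence so does any linear form that depends only on the value of that point.
  Differentiation with the exponentials frozen, at u = 0, is such a form: transcendence of the
  exponential is what makes it a function of the value.\<close>

text \<open>In a pair \<open>(g, h)\<close>, \<open>h\<close> is the derivative of the exponential polynomial \<open>g\<close> in which the
  exponentials \<open>e\<^sup>c\<^sup>u\<close> count as constants. Linear independence of the \<open>e\<^sup>c\<^sup>u u\<^sup>j\<close> makes it well defined.\<close>

inductive_set exp_polys :: "('k::field_char_0 fps \<times> 'k fps) set" where
  zero: "(0, 0) \<in> exp_polys"
| add: "(g, h) \<in> exp_polys \<Longrightarrow>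
    (g + fps_exp c * fps_of_poly p, h + fps_exp c * fps_of_poly (pderiv p)) \<in> exp_polys"

lemma exp_polys_monomial: "(fps_exp c * fps_of_poly p, fps_exp c * fps_of_poly (pderiv p)) \<in> exp_polys"
  using exp_polys.add[OF exp_polys.zero] by simp

lemma exp_polys_add:
  assumes "(g, h) \<in> exp_polys" "(g', h') \<in> exp_polys"
  shows "(g + g', h + h') \<in> exp_polys"
  using assms(2)
proof induction
  case zero
  then show ?case using assms(1) by simp
next
  case (add g' h' c p)
  then show ?case using exp_polys.add[of "g + g'" "h + h'" c p] by (simp add: add.assoc)
qed

lemma exp_polys_const: "(fps_const r, 0) \<in> exp_polys"
  using exp_polys_monomial[of 0 "[:r:]"] by (simp add: fps_of_poly_const pderiv_pCons)

lemma exp_polys_mult_monomial: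
  assumes "(g, h) \<in> exp_polys"
  shows "(fps_exp c * fps_of_poly p * g,
    fps_exp c * fps_of_poly p * h + fps_exp c * fps_of_poly (pderiv p) * g) \<in> exp_polys"
  using assms
proof induction
  case zero
  then show ?case using exp_polys.zero by simp
next
  case (add g h c' p')
  have *: "fps_exp (c + c') * fps_of_poly (p * p') = fps_exp c * fps_of_poly p * (fps_exp c' * fps_of_poly p')"
    by (simp add: fps_exp_add_mult fps_of_poly_mult algebra_simps)
  have **: "fps_exp (c + c') * fps_of_poly (pderiv (p * p')) =
    fps_exp c * fps_of_poly p * (fps_exp c' * fps_of_poly (pderiv p')) +
    fps_exp c * fps_of_poly (pderiv p) * (fps_exp c' * fps_of_poly p')"
    by (simp add: fps_exp_add_mult fps_of_poly_mult pderiv_mult fps_of_poly_add algebra_simps)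
  show ?case
    using exp_polys.add[OF add.IH, of "c + c'" "p * p'"]
    unfolding * ** by (simp add: algebra_simps)
qed

lemma exp_polys_mult:
  assumes "(g, h) \<in> exp_polys" "(g', h') \<in> exp_polys"
  shows "(g * g', g * h' + h * g') \<in> exp_polys"
  using assms(1)
proof induction
  case zero
  then show ?case using exp_polys.zero by simp
next
  case (add g h c p)
  from exp_polys_add[OF add.IH exp_polys_mult_monomial[OF assms(2), of c p]]
  show ?case by (simp add: algebra_simps)
qed

text \<open>On the polynomial factor of \<open>fps_exp c\<close> the ordinary derivative acts as
  \<open>smult c p + pderiv p\<close>, which commutes with \<open>pderiv\<close>. Closure under
  \<open>fps_deriv\<close> is needed later to Taylor expand a point to first order.\<close>

lemma exp_polys_deriv:
  assumes "(g, h) \<in> exp_polys"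
  shows "(fps_deriv g, fps_deriv h) \<in> exp_polys"
  using assms
proof induction
  case zero
  then show ?case using exp_polys.zero by simp
next
  case (add g h c p)
  have *: "fps_deriv (fps_exp c * fps_of_poly p) = fps_exp c * fps_of_poly (smult c p + pderiv p)" for p
    by (simp add: fps_of_poly_add fps_of_poly_smult fps_of_poly_pderiv algebra_simps)
  show ?case
    using exp_polys.add[OF add.IH, of c "smult c p + pderiv p"]
    by (simp add: * pderiv_add pderiv_smult del: fps_deriv_mult)
qed

text \<open>The inductive definition may use one exponent several times; collecting terms gives
  every exponent a single polynomial, the form to which \<open>exp_polys_independent\<close>
  applies.\<close>

lemma exp_polys_expand:
  assumes "(g, h) \<in> exp_polys"
  shows "\<exists>S p. finite S \<and> g = (\<Sum>c\<in>S. fps_exp c * fps_of_poly (p c)) \<and>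
    h = (\<Sum>c\<in>S. fps_exp c * fps_of_poly (pderiv (p c)))"
  using assms
proof induction
  case zero
  show ?case by (intro exI[of _ "{}"]) simp
next
  case (add g h c q)
  then obtain S p where S: "finite S" "g = (\<Sum>c\<in>S. fps_exp c * fps_of_poly (p c))"
    "h = (\<Sum>c\<in>S. fps_exp c * fps_of_poly (pderiv (p c)))" by blast
  show ?case
  proof (cases "c \<in> S")
    case True
    let ?p = "p(c := p c + q)"
    \<comment> \<open>\<open>F\<close> is kept general so that one update argument serves both
      \<open>g\<close> and \<open>h\<close>.\<close>
    have upd: "(\<Sum>x\<in>S. F x (?p x)) = (\<Sum>x\<in>S. F x (p x)) + F c q"
      if F: "F c (p c + q) = F c (p c) + F c q" for F :: "'a \<Rightarrow> 'a poly \<Rightarrow> 'a fps"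
    proof -
      have "(\<Sum>x\<in>S - {c}. F x (?p x)) = (\<Sum>x\<in>S - {c}. F x (p x))"
        by (rule sum.cong) auto
      then have "(\<Sum>x\<in>S. F x (?p x)) = F c (p c + q) + (\<Sum>x\<in>S - {c}. F x (p x))"
        using sum.remove[OF S(1) True, of "\<lambda>x. F x (?p x)"] by simp
      also have "\<dots> = (F c (p c) + (\<Sum>x\<in>S - {c}. F x (p x))) + F c q"
        by (simp only: F) (simp only: ac_simps)
      finally show ?thesis
        using sum.remove[OF S(1) True, of "\<lambda>x. F x (p x)"] by simp
    qed
    have "(\<Sum>c\<in>S. fps_exp c * fps_of_poly (?p c)) = g + fps_exp c * fps_of_poly q"
      unfolding S(2) by (rule upd[of "\<lambda>x p. fps_exp x * fps_of_poly p"]) (simp only: fps_of_poly_add distrib_left)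
    moreover have "(\<Sum>c\<in>S. fps_exp c * fps_of_poly (pderiv (?p c))) = h + fps_exp c * fps_of_poly (pderiv q)"
    proof -
      have "fps_exp c * fps_of_poly (pderiv (p c + q)) =
          fps_exp c * fps_of_poly (pderiv (p c)) + fps_exp c * fps_of_poly (pderiv q)"
        by (subst pderiv_add, subst fps_of_poly_add, rule distrib_left)
      from upd[of "\<lambda>x p. fps_exp x * fps_of_poly (pderiv p)", OF this] show ?thesis
        unfolding S(3) .
    qed
    ultimately show ?thesis using S(1) by (intro exI[of _ S] exI[of _ ?p]) simp
  next
    case False
    let ?p = "p(c := q)"
    have "(\<Sum>c\<in>insert c S. fps_exp c * fps_of_poly (?p c)) = g + fps_exp c * fps_of_poly q"
      using S(1) False by (simp add: S(2) add.commute) (rule sum.cong, auto)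
    moreover have "(\<Sum>c\<in>insert c S. fps_exp c * fps_of_poly (pderiv (?p c))) = h + fps_exp c * fps_of_poly (pderiv q)"
      using S(1) False by (simp add: S(3) add.commute) (rule sum.cong, auto)
    ultimately show ?thesis using S(1) by (intro exI[of _ "insert c S"] exI[of _ ?p]) simp
  qed
qed

text \<open>\<open>pderiv p\<close> has smaller degree than a nonconstant \<open>p\<close> and is
  zero for a constant one, so the leading coefficient of the sum is
  \<open>c * lead_coeff p\<close>.\<close>

lemma smult_add_pderiv_eq_0_iff:
  fixes p :: "'k::field_char_0 poly"
  assumes "c \<noteq> 0"
  shows "smult c p + pderiv p = 0 \<longleftrightarrow> p = 0"
proof
  assume eq: "smult c p + pderiv p = 0"
  show "p = 0"
  proof (rule ccontr)
    assume "p \<noteq> 0"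
    have "coeff (smult c p + pderiv p) (degree p) = c * lead_coeff p"
      by (simp add: coeff_pderiv coeff_eq_0)
    with eq assms \<open>p \<noteq> 0\<close> show False by simp
  qed
qed simp

text \<open>After division by \<open>fps_exp a\<close>, enough derivatives annihilate the polynomial
  at \<open>a\<close>, while on the other terms they act injectively on the polynomial factors. The
  induction hypothesis, stated for arbitrary \<open>p\<close>, is then applied to the transformed
  polynomials.\<close>

lemma exp_polys_independent:
  assumes "finite S" "(\<Sum>c\<in>S. fps_exp c * fps_of_poly (p c)) = 0" "c \<in> S"
  shows "p c = (0 :: 'k::field_char_0 poly)"
  using assms
proof (induction S arbitrary: p c rule: finite_induct)
  case (insert a S)
  \<comment> \<open>\<open>T b\<close> is the effect of differentiation on the polynomial factor of
    \<open>fps_exp (b - a)\<close>; in particular \<open>T a\<close> is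
    \<open>pderiv\<close>.\<close>
  define T where "T = (\<lambda>b q. smult (b - a) q + pderiv q :: 'k poly)"
  have T0: "(T b ^^ m) q = 0 \<longleftrightarrow> q = 0" if "b \<noteq> a" for b m q
    using that by (induction m) (simp_all add: T_def smult_add_pderiv_eq_0_iff)
  have deriv1: "fps_deriv (fps_exp (b - a) * fps_of_poly q) = fps_exp (b - a) * fps_of_poly (T b q)" for b q
    by (simp add: T_def fps_of_poly_add fps_of_poly_smult fps_of_poly_pderiv algebra_simps)
  have deriv: "(fps_deriv ^^ m) (\<Sum>b\<in>A. fps_exp (b - a) * fps_of_poly (p b)) =
      (\<Sum>b\<in>A. fps_exp (b - a) * fps_of_poly ((T b ^^ m) (p b)))" for m A
    by (induction m) (simp_all add: fps_deriv_sum deriv1 del: fps_deriv_mult)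
  define m where "m = Suc (degree (p a))"
  have Ta: "(T a ^^ m) (p a) = 0"
  proof -
    have "degree ((pderiv ^^ n) (p a)) = degree (p a) - n" for n
      by (induction n) (simp_all add: degree_pderiv)
    moreover have "T a = pderiv" by (auto simp: T_def)
    ultimately show ?thesis
      by (simp add: m_def pderiv_eq_0_iff)
  qed
  have "0 = fps_exp (- a) * (\<Sum>b\<in>insert a S. fps_exp b * fps_of_poly (p b))"
    using insert.prems by simp
  also have "\<dots> = (\<Sum>b\<in>insert a S. fps_exp (b - a) * fps_of_poly (p b))"
    by (simp only: sum_distrib_left mult.assoc[symmetric] fps_exp_add_mult[symmetric]) simp
  finally have eq0: "(\<Sum>b\<in>insert a S. fps_exp (b - a) * fps_of_poly (p b)) = 0" ..
  have "(fps_deriv ^^ m) 0 = (0 :: 'k fps)"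
    by (induction m) simp_all
  with eq0 deriv[of m "insert a S"]
  have "(\<Sum>b\<in>insert a S. fps_exp (b - a) * fps_of_poly ((T b ^^ m) (p b))) = 0"
    by simp
  then have "(\<Sum>b\<in>S. fps_exp (b - a) * fps_of_poly ((T b ^^ m) (p b))) = 0"
    using insert.hyps Ta by simp
  then have "fps_exp a * (\<Sum>b\<in>S. fps_exp (b - a) * fps_of_poly ((T b ^^ m) (p b))) = 0"
    by simp
  then have "(\<Sum>b\<in>S. fps_exp b * fps_of_poly ((T b ^^ m) (p b))) = 0"
    by (simp only: sum_distrib_left mult.assoc[symmetric] fps_exp_add_mult[symmetric]) simp
  from insert.IH[OF this] have "(T b ^^ m) (p b) = 0" if "b \<in> S" for b using that .
  with T0 insert.hyps have S0: "p b = 0" if "b \<in> S" for b using that by metis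
  then have "(\<Sum>b\<in>S. fps_exp b * fps_of_poly (p b)) = 0" by simp
  with insert.prems(1) insert.hyps have "fps_exp a * fps_of_poly (p a) = 0"
    by simp
  then have "p a = 0"
    using fps_of_poly_eq_iff[of "p a" 0] by simp
  with S0 insert.prems show ?case by auto
qed simp

text \<open>Independence enters here: in an expansion of 0 every polynomial is 0, and hence every
  derivative too.\<close>

lemma exp_polys_unique:
  assumes "(g, h) \<in> exp_polys" "(g, h') \<in> exp_polys"
  shows "h = h'"
proof -
  have "(- 1 * g, - 1 * h' + 0 * g) \<in> exp_polys"
    using exp_polys_mult[OF exp_polys_const[of "- 1"] assms(2)] by (simp add: fps_const_neg[symmetric] del: fps_const_neg)
  from exp_polys_add[OF assms(1) this] have "(0, h - h') \<in> exp_polys" by simp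
  from exp_polys_expand[OF this] obtain S p where S: "finite S"
    "0 = (\<Sum>c\<in>S. fps_exp c * fps_of_poly (p c))"
    "h - h' = (\<Sum>c\<in>S. fps_exp c * fps_of_poly (pderiv (p c)))" by blast
  with exp_polys_independent[OF S(1) S(2)[symmetric]] show ?thesis by simp
qed

definition exp_poly_deriv :: "'k::field_char_0 fps \<Rightarrow> 'k fps" where
  "exp_poly_deriv g = (THE h. (g, h) \<in> exp_polys)"

lemma exp_poly_deriv_eq: "(g, h) \<in> exp_polys \<Longrightarrow> exp_poly_deriv g = h"
  unfolding exp_poly_deriv_def by (rule the_equality) (auto intro: exp_polys_unique)

section \<open>Superalgebras and tensors\<close>

lemma ground_simps [simp]:
  "carrier ground = UNIV" "x \<otimes>\<^bsub>ground\<^esub> y = x * y" "\<one>\<^bsub>ground\<^esub> = 1" "\<zero>\<^bsub>ground\<^esub> = 0"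
  "x \<oplus>\<^bsub>ground\<^esub> y = x + y" "r \<odot>\<^bsub>ground\<^esub> x = r * x"
  "part ground i = (if i = 0 then UNIV else {0})"
  by (simp_all add: ground_def)

lemma cring_ground: "cring (ground :: ('k::field, 'k) superalgebra)"
  by (intro cringI abelian_groupI comm_monoidI)
    (auto simp: algebra_simps intro: exI[of _ "- x" for x])

lemma bit_exhaust: "(i :: bit) = 0 \<or> i = 1"
  by (cases i) auto

lemma bit_add_one_one: "(i :: bit) + 1 + 1 = i"
  by (cases i) simp_all

section \<open>Homogeneous components and separation by linear functionals\<close>

context superalgebra
begin

lemma smult_closed [simp]: "x \<in> carrier A \<Longrightarrow> r \<odot> x \<in> carrier A"
  using module.smult_closed[OF module, of r x] by simp

lemma smult_add_left: "x \<in> carrier A \<Longrightarrow> (r + s) \<odot> x = r \<odot> x \<oplus> s \<odot> x"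
  using module.smult_l_distr[OF module, of r s x] by simp

lemma smult_add_right: "x \<in> carrier A \<Longrightarrow> y \<in> carrier A \<Longrightarrow> r \<odot> (x \<oplus> y) = r \<odot> x \<oplus> r \<odot> y"
  using module.smult_r_distr[OF module, of r x y] by simp

lemma smult_smult: "x \<in> carrier A \<Longrightarrow> r \<odot> (s \<odot> x) = (r * s) \<odot> x"
  using module.smult_assoc1[OF module, of r s x] by simp

lemma smult_one [simp]: "x \<in> carrier A \<Longrightarrow> 1 \<odot> x = x"
  using module.smult_one[OF module, of x] by simp

lemma smult_zero_left [simp]: "x \<in> carrier A \<Longrightarrow> 0 \<odot> x = \<zero>"
  using module.smult_l_null[OF module, of x] by simp

lemma smult_zero_right [simp]: "r \<odot> \<zero> = \<zero>"
  using module.smult_r_null[OF module, of r] by simp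

lemma smult_minus_one: "x \<in> carrier A \<Longrightarrow> (- 1) \<odot> x = \<ominus> x"
  using smult_add_left[of x "- 1" 1] by (simp add: minus_equality)

lemma part_subset: "part A i \<subseteq> carrier A"
  using submodule.axioms(1)[OF part_submodule] subgroup.subset by fastforce

lemma part_carrier: "x \<in> part A i \<Longrightarrow> x \<in> carrier A"
  using part_subset by blast

lemma part_add [simp]: "x \<in> part A i \<Longrightarrow> y \<in> part A i \<Longrightarrow> x \<oplus> y \<in> part A i"
  using subgroup.m_closed[OF submodule.axioms(1)[OF part_submodule]] by fastforce

lemma part_zero [simp]: "\<zero> \<in> part A i"
  using subgroup.one_closed[OF submodule.axioms(1)[OF part_submodule]] by fastforce

lemma part_smult [simp]: "x \<in> part A i \<Longrightarrow> r \<odot> x \<in> part A i"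
  using submodule.smult_closed[OF part_submodule, of r x i] by simp

lemma part_minus [simp]: "x \<in> part A i \<Longrightarrow> \<ominus> x \<in> part A i"
  using part_smult[of x i "- 1"] by (simp add: smult_minus_one part_carrier)

lemma part_disjoint: "x \<in> part A i \<Longrightarrow> x \<in> part A (i + 1) \<Longrightarrow> x = \<zero>"
  using part_inter bit_exhaust[of i] by (elim disjE) auto

lemma decompose: "x \<in> carrier A \<Longrightarrow> \<exists>y\<in>part A i. \<exists>z\<in>part A (i + 1). x = y \<oplus> z"
proof -
  assume "x \<in> carrier A"
  then obtain y z where yz: "y \<in> part A 0" "z \<in> part A 1" "x = y \<oplus> z"
    using part_sum by blast
  then have "x = z \<oplus> y" by (simp add: a_comm part_carrier)
  then have "\<exists>y'\<in>part A 1. \<exists>z'\<in>part A 0. x = y' \<oplus> z'"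
    using yz(1,2) by blast
  with yz bit_exhaust[of i] show ?thesis by (elim disjE) auto
qed

text \<open>The difference of \<open>y\<close> and \<open>y'\<close> equals that of
  \<open>z'\<close> and \<open>z\<close>, so it lies in both parts.\<close>

lemma decompose_unique:
  assumes "y \<in> part A i" "y' \<in> part A i" "z \<in> part A (i + 1)" "z' \<in> part A (i + 1)"
    "y \<oplus> z = y' \<oplus> z'"
  shows "y = y'"
proof -
  note c = assms(1-4)[THEN part_carrier]
  have "y \<oplus> \<ominus> y' = z' \<oplus> \<ominus> z"
  proof -
    have "y \<oplus> \<ominus> y' = (y \<oplus> z) \<oplus> (\<ominus> y' \<oplus> \<ominus> z)"
      using c by (simp add: a_ac r_neg)
    also have "\<dots> = (y' \<oplus> z') \<oplus> (\<ominus> y' \<oplus> \<ominus> z)" using assms by simp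
    also have "\<dots> = z' \<oplus> (y' \<oplus> (\<ominus> y' \<oplus> \<ominus> z))"
      using c by (simp add: a_ac)
    also have "\<dots> = z' \<oplus> \<ominus> z"
      using c by (simp add: r_neg2)
    finally show ?thesis .
  qed
  then have "y \<oplus> \<ominus> y' = \<zero>"
    using part_disjoint[of "y \<oplus> \<ominus> y'" i] assms(1-4) by (metis part_add part_minus)
  then show ?thesis using c by (metis a_inv_closed minus_equality minus_minus)
qed

lemma component_eqI:
  assumes "y \<in> part A i" "z \<in> part A (i + 1)" "x = y \<oplus> z"
  shows "component A i x = y"
  unfolding component_def
  using assms by (intro the_equality) (auto intro: decompose_unique)

lemma component_part [simp]: "x \<in> carrier A \<Longrightarrow> component A i x \<in> part A i"
  using decompose[of x i] component_eqI by metis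

lemma component_carrier [simp]: "x \<in> carrier A \<Longrightarrow> component A i x \<in> carrier A"
  using component_part part_carrier by blast

lemma component_sum: "x \<in> carrier A \<Longrightarrow> x = component A i x \<oplus> component A (i + 1) x"
proof -
  assume "x \<in> carrier A"
  then obtain y z where yz: "y \<in> part A i" "z \<in> part A (i + 1)" "x = y \<oplus> z"
    using decompose by blast
  then have "component A i x = y" by (rule component_eqI)
  moreover have "component A (i + 1) x = z"
    using yz by (intro component_eqI[of _ _ y]) (simp_all only: bit_add_one_one a_comm part_carrier)
  ultimately show ?thesis using yz by simp
qed

lemma component_same [simp]: "x \<in> part A i \<Longrightarrow> component A i x = x"
  by (rule component_eqI[of _ _ \<zero>]) (simp_all add: part_carrier)

lemma component_other: "x \<in> part A j \<Longrightarrow> i \<noteq> j \<Longrightarrow> component A i x = \<zero>"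
  using bit_exhaust[of i] bit_exhaust[of j] by (intro component_eqI[of _ _ x]) (auto simp: part_carrier)

lemma component_add:
  assumes "x \<in> carrier A" "y \<in> carrier A"
  shows "component A i (x \<oplus> y) = component A i x \<oplus> component A i y"
proof (rule component_eqI)
  have "x \<oplus> y = (component A i x \<oplus> component A (i + 1) x) \<oplus> (component A i y \<oplus> component A (i + 1) y)"
    using component_sum[of _ i] assms by metis
  then show "x \<oplus> y = (component A i x \<oplus> component A i y) \<oplus> (component A (i + 1) x \<oplus> component A (i + 1) y)"
    using assms by (simp add: a_ac)
qed (use assms in auto)

lemma component_smult:
  assumes "x \<in> carrier A"
  shows "component A i (r \<odot> x) = r \<odot> component A i x"
proof (rule component_eqI)
  show "r \<odot> x = r \<odot> component A i x \<oplus> r \<odot> component A (i + 1) x"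
    using component_sum[of x i] assms by (metis smult_add_right component_carrier)
qed (use assms in auto)

lemma linear_component: "linear_map A A (component A i)"
  unfolding linear_map_def by (auto simp: component_add component_smult)

text \<open>By Zorn there is a subspace \<open>M\<close> maximal among those that avoid
  \<open>c\<close>. It is a hyperplane complementary to the line of \<open>c\<close>, and
  \<open>f\<close> reads off the coefficient of \<open>c\<close>.\<close>

lemma functional_separates:
  assumes c: "c \<in> carrier A" "c \<noteq> \<zero>"
  shows "\<exists>f. linear_map A (ground :: ('k, 'k) superalgebra) f \<and> f c \<noteq> 0"
proof -
  define \<S> where "\<S> = {M. M \<subseteq> carrier A \<and> \<zero> \<in> M \<and> (\<forall>x\<in>M. \<forall>y\<in>M. x \<oplus> y \<in> M) \<and>
    (\<forall>r. \<forall>x\<in>M. r \<odot> x \<in> M) \<and> c \<notin> M}"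
  have "{\<zero>} \<in> \<S>" using c by (auto simp: \<S>_def)
  then have "\<exists>M\<in>\<S>. \<forall>X\<in>\<S>. M \<subseteq> X \<longrightarrow> X = M"
  proof (intro subset_Zorn_nonempty)
    fix \<C> assume C: "\<C> \<noteq> {}" "subset.chain \<S> \<C>"
    then have sub: "\<C> \<subseteq> \<S>" and lin: "\<And>X Y. X \<in> \<C> \<Longrightarrow> Y \<in> \<C> \<Longrightarrow> X \<subseteq> Y \<or> Y \<subseteq> X"
      by (auto simp: subset.chain_def)
    have "x \<oplus> y \<in> \<Union>\<C>" if xy: "x \<in> \<Union>\<C>" "y \<in> \<Union>\<C>" for x y
    proof -
      obtain X Y where XY: "x \<in> X" "X \<in> \<C>" "y \<in> Y" "Y \<in> \<C>" using xy by blast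
      with lin obtain Z where "x \<in> Z" "y \<in> Z" "Z \<in> \<C>" by blast
      with sub have "x \<oplus> y \<in> Z" unfolding \<S>_def by blast
      with \<open>Z \<in> \<C>\<close> show ?thesis by blast
    qed
    then show "\<Union>\<C> \<in> \<S>" using sub C(1) unfolding \<S>_def by blast
  qed auto
  then obtain M where M: "M \<in> \<S>" "\<And>X. X \<in> \<S> \<Longrightarrow> M \<subseteq> X \<Longrightarrow> X = M" by blast
  from M(1) have Msub: "M \<subseteq> carrier A" and M0: "\<zero> \<in> M"
    and Madd: "\<And>x y. x \<in> M \<Longrightarrow> y \<in> M \<Longrightarrow> x \<oplus> y \<in> M"
    and Msm: "\<And>r x. x \<in> M \<Longrightarrow> r \<odot> x \<in> M" and cM: "c \<notin> M" by (auto simp: \<S>_def)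
  \<comment> \<open>If \<open>x\<close> is outside \<open>M\<close>, then \<open>M\<close> together
    with \<open>x\<close> spans a larger subspace, which by maximality contains \<open>c\<close>.
    The coefficient of \<open>x\<close> in that expression of \<open>c\<close> is nonzero because
    \<open>c\<close> is not in \<open>M\<close>, so it can be solved for \<open>x\<close>.\<close>
  have ex: "\<exists>k. \<exists>m\<in>M. x = m \<oplus> k \<odot> c" if x: "x \<in> carrier A" for x
  proof (cases "x \<in> M")
    case True
    then show ?thesis using c Msub by (intro exI[of _ 0] bexI[of _ x]) auto
  next
    case False
    define X where "X = {m \<oplus> k \<odot> x | m k. m \<in> M}"
    have "M \<subseteq> X"
    proof
      fix m assume m: "m \<in> M"
      then have "m = m \<oplus> 0 \<odot> x" using x Msub by auto
      with m show "m \<in> X" unfolding X_def by blast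
    qed
    moreover have "x \<in> X"
    proof -
      have "x = \<zero> \<oplus> 1 \<odot> x" using x by simp
      with M0 show ?thesis unfolding X_def by blast
    qed
    ultimately have "X \<notin> \<S>" using M(2)[of X] False by blast
    moreover have "X \<subseteq> carrier A" using x Msub by (auto simp: X_def)
    moreover have "\<zero> \<in> X" using \<open>M \<subseteq> X\<close> M0 by blast
    moreover have "\<forall>y\<in>X. \<forall>z\<in>X. y \<oplus> z \<in> X"
    proof (intro ballI)
      fix y z assume "y \<in> X" "z \<in> X"
      then obtain m k n l where *: "y = m \<oplus> k \<odot> x" "z = n \<oplus> l \<odot> x" "m \<in> M" "n \<in> M"
        unfolding X_def by blast
      then have "m \<in> carrier A" "n \<in> carrier A" using Msub by auto
      then have "y \<oplus> z = (m \<oplus> n) \<oplus> (k + l) \<odot> x"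
        using x by (simp add: * smult_add_left a_ac)
      with Madd * show "y \<oplus> z \<in> X" unfolding X_def by blast
    qed
    moreover have "\<forall>r. \<forall>y\<in>X. r \<odot> y \<in> X"
    proof (intro allI ballI)
      fix r y assume "y \<in> X"
      then obtain m k where *: "y = m \<oplus> k \<odot> x" "m \<in> M" unfolding X_def by blast
      then have "r \<odot> y = r \<odot> m \<oplus> (r * k) \<odot> x"
        using x Msub by (simp add: smult_add_right smult_smult subset_iff)
      with Msm * show "r \<odot> y \<in> X" unfolding X_def by blast
    qed
    ultimately have "c \<in> X" by (auto simp: \<S>_def)
    then obtain m k where mk: "c = m \<oplus> k \<odot> x" "m \<in> M" unfolding X_def by blast
    have mc: "m \<in> carrier A" using mk Msub by blast
    have "k \<noteq> 0" using mk cM x mc by auto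
    have "k \<odot> x = c \<oplus> \<ominus> m" using mk(1) mc x by (metis a_comm a_inv_closed add.m_closed r_neg1 smult_closed)
    then have "inverse k \<odot> (k \<odot> x) = inverse k \<odot> (c \<oplus> \<ominus> m)" by simp
    then have "x = inverse k \<odot> \<ominus> m \<oplus> inverse k \<odot> c"
      using \<open>k \<noteq> 0\<close> x c mc by (simp add: smult_smult smult_add_right a_comm)
    moreover have "inverse k \<odot> \<ominus> m \<in> M"
      using Msm[OF Msm[OF mk(2), of "- 1"], of "inverse k"] mc by (simp add: smult_minus_one)
    ultimately show ?thesis by blast
  qed
  have uniq: "k = l" if *: "m \<in> M" "n \<in> M" "m \<oplus> k \<odot> c = n \<oplus> l \<odot> c" for m n k l
  proof (rule ccontr)
    assume "k \<noteq> l"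
    have mn: "m \<in> carrier A" "n \<in> carrier A" using * Msub by auto
    have "(k - l) \<odot> c = k \<odot> c \<oplus> \<ominus> (l \<odot> c)"
      using smult_add_left[OF c(1), of k "- l"] smult_smult[OF c(1), of "- 1" l] c
      by (simp add: smult_minus_one)
    also have "\<dots> = n \<oplus> \<ominus> m"
    proof -
      have "k \<odot> c = \<ominus> m \<oplus> (n \<oplus> l \<odot> c)"
        using *(3) mn c by (metis r_neg1 smult_closed)
      then show ?thesis using mn c by (simp add: a_ac r_neg)
    qed
    finally have "(k - l) \<odot> c \<in> M"
      using Madd[OF *(2) Msm[OF *(1), of "- 1"]] mn by (simp add: smult_minus_one)
    from Msm[OF this, of "inverse (k - l)"] have "c \<in> M"
      using \<open>k \<noteq> l\<close> c by (simp add: smult_smult)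
    with cM show False ..
  qed
  define f where "f = (\<lambda>x. THE k. \<exists>m\<in>M. x = m \<oplus> k \<odot> c)"
  have f_eq: "f (m \<oplus> k \<odot> c) = k" if "m \<in> M" for m k
    unfolding f_def by (rule the_equality) (use that uniq in blast)+
  have "linear_map A (ground :: ('k, 'k) superalgebra) f"
    unfolding linear_map_def
  proof (intro conjI ballI allI)
    fix x y assume "x \<in> carrier A" "y \<in> carrier A"
    with ex obtain m k n l where *: "x = m \<oplus> k \<odot> c" "y = n \<oplus> l \<odot> c" "m \<in> M" "n \<in> M" by metis
    then have "m \<in> carrier A" "n \<in> carrier A" using Msub by auto
    then have "x \<oplus> y = (m \<oplus> n) \<oplus> (k + l) \<odot> c"
      using c by (simp add: * smult_add_left a_ac)
    with Madd * f_eq show "f (x \<oplus> y) = f x \<oplus>\<^bsub>ground\<^esub> f y" by simp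
  next
    fix r x assume "x \<in> carrier A"
    with ex obtain m k where *: "x = m \<oplus> k \<odot> c" "m \<in> M" by metis
    then have "r \<odot> x = r \<odot> m \<oplus> (r * k) \<odot> c"
      using c Msub by (simp add: smult_add_right smult_smult subset_iff)
    with Msm * f_eq show "f (r \<odot> x) = r \<odot>\<^bsub>ground\<^esub> f x" by simp
  qed simp
  moreover have "f c = 1" using f_eq[OF M0, of 1] c by simp
  ultimately show ?thesis by (intro exI[of _ f]) simp
qed

text \<open>The standard route to identities between elements of a superalgebra: a functional turns
  an induced map on a tensor product into an evaluation of the tensor at a bilinear form.\<close>

lemma functional_eqI:
  assumes "x \<in> carrier A" "y \<in> carrier A"
    "\<And>f. linear_map A (ground :: ('k, 'k) superalgebra) f \<Longrightarrow> f x = f y"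
  shows "x = y"
proof -
  have "x \<oplus> (- 1) \<odot> y = \<zero>"
  proof (rule ccontr)
    assume "x \<oplus> (- 1) \<odot> y \<noteq> \<zero>"
    with assms functional_separates[of "x \<oplus> (- 1) \<odot> y"] obtain f
      where f: "linear_map A (ground :: ('k, 'k) superalgebra) f" "f (x \<oplus> (- 1) \<odot> y) \<noteq> 0" by auto
    then have "f (x \<oplus> (- 1) \<odot> y) = f x + (- 1) * f y"
      using assms(1,2) by (simp add: linear_map_def)
    with f assms(3)[OF f(1)] show False by simp
  qed
  then have "x \<oplus> \<ominus> y = \<zero>" using assms by (simp add: smult_minus_one)
  then show ?thesis using assms(1,2) by (metis a_inv_closed minus_equality minus_minus)
qed

end

section \<open>Linear and bilinear maps, evaluation of tensors\<close>

lemma linear_mapD: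
  assumes "linear_map A B f"
  shows "x \<in> carrier A \<Longrightarrow> f x \<in> carrier B"
    "x \<in> carrier A \<Longrightarrow> y \<in> carrier A \<Longrightarrow> f (x \<oplus>\<^bsub>A\<^esub> y) = f x \<oplus>\<^bsub>B\<^esub> f y"
    "x \<in> carrier A \<Longrightarrow> f (r \<odot>\<^bsub>A\<^esub> x) = r \<odot>\<^bsub>B\<^esub> f x"
  using assms by (auto simp: linear_map_def)

lemma linear_map_comp:
  assumes "linear_map A B f" "linear_map B C g"
  shows "linear_map A C (\<lambda>x. g (f x))"
  using assms by (auto simp: linear_map_def Pi_iff)

lemma linear_map_zero:
  assumes "superalgebra A" "superalgebra B" "linear_map A B f"
  shows "f \<zero>\<^bsub>A\<^esub> = \<zero>\<^bsub>B\<^esub>"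
proof -
  interpret A: superalgebra A by fact
  interpret B: superalgebra B by fact
  have "f (0 \<odot>\<^bsub>A\<^esub> \<zero>\<^bsub>A\<^esub>) = 0 \<odot>\<^bsub>B\<^esub> f \<zero>\<^bsub>A\<^esub>"
    by (rule linear_mapD(3)[OF assms(3)]) simp
  then show ?thesis using linear_mapD(1)[OF assms(3), of "\<zero>\<^bsub>A\<^esub>"] by simp
qed

lemma functional_zero:
  assumes "superalgebra A" "linear_map A ground f"
  shows "f \<zero>\<^bsub>A\<^esub> = 0"
proof -
  interpret A: superalgebra A by fact
  show ?thesis using linear_mapD(3)[OF assms(2), of "\<zero>\<^bsub>A\<^esub>" 0] by simp
qed

lemma functional_finsum:
  assumes "superalgebra C" "linear_map C ground f" "finite I" "\<And>i. i \<in> I \<Longrightarrow> x i \<in> carrier C"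
  shows "f (\<Oplus>\<^bsub>C\<^esub>i\<in>I. x i) = (\<Sum>i\<in>I. f (x i))"
proof -
  interpret C: superalgebra C by fact
  show ?thesis using assms(3,4)
  proof (induction rule: finite_induct)
    case empty
    then show ?case using functional_zero[OF assms(1,2)] by simp
  next
    case (insert i I)
    then show ?case using linear_mapD(2)[OF assms(2)] by simp
  qed
qed

definition bilinear_map where
  "bilinear_map A B C h \<longleftrightarrow>
     (\<forall>b\<in>carrier B. linear_map A C (\<lambda>a. h a b)) \<and> (\<forall>a\<in>carrier A. linear_map B C (h a))"

lemma bilinear_form_comp:
  assumes "bilinear_map A B C h" "linear_map C ground f"
  shows "bilinear_form A B (\<lambda>a b. f (h a b))"
  using assms unfolding bilinear_map_def bilinear_form_def
  by (auto intro: linear_map_comp[where B = C])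

lemma bilinear_form_cong:
  assumes "superalgebra A" "superalgebra B" "bilinear_form A B \<beta>"
    "\<And>a b. a \<in> carrier A \<Longrightarrow> b \<in> carrier B \<Longrightarrow> \<beta> a b = \<beta>' a b"
  shows "bilinear_form A B \<beta>'"
proof -
  interpret A: superalgebra A by fact
  interpret B: superalgebra B by fact
  show ?thesis using assms(3)
    by (auto simp: bilinear_form_def linear_map_def assms(4)[symmetric])
qed

lemma bilinear_form_product:
  assumes "linear_map A ground f" "linear_map B ground g"
  shows "bilinear_form A B (\<lambda>a b. f a * g b)"
  using assms by (auto simp: bilinear_form_def linear_map_def algebra_simps)

lemma bilinear_form_scale:
  "bilinear_form A B \<beta> \<Longrightarrow> bilinear_form A B (\<lambda>a b. r * \<beta> a b)"
  by (auto simp: bilinear_form_def linear_map_def algebra_simps)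

lemma tensor_rep:
  assumes "u \<in> carrier (tensor A B)"
  obtains n a b where "\<And>i. i < (n::nat) \<Longrightarrow> a i \<in> carrier A" "\<And>i. i < n \<Longrightarrow> b i \<in> carrier B"
    "u = (\<lambda>\<beta>. \<Sum>i<n. pure_tensor A B (a i) (b i) \<beta>)"
  using assms by (auto simp: tensor_def tensor_span_def)

text \<open>As a function a tensor could depend on values of \<beta> outside the carriers. Being a
  sum of evaluations at carrier elements, it does not see them, and bilinearity passes from \<beta>
  to \<open>\<beta>'\<close>.\<close>

lemma tensor_cong:
  assumes "superalgebra A" "superalgebra B" "u \<in> carrier (tensor A B)" "bilinear_form A B \<beta>"
    "\<And>a b. a \<in> carrier A \<Longrightarrow> b \<in> carrier B \<Longrightarrow> \<beta> a b = \<beta>' a b"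
  shows "u \<beta> = u \<beta>'"
proof -
  have "bilinear_form A B \<beta>'" by (rule bilinear_form_cong[OF assms(1,2,4,5)])
  with assms(4,5) show ?thesis
    by - (rule tensor_rep[OF assms(3)], simp add: pure_tensor_def)
qed

lemma tensor_scale:
  assumes "u \<in> carrier (tensor A B)" "bilinear_form A B \<beta>"
  shows "u (\<lambda>a b. r * \<beta> a b) = r * u \<beta>"
  by (rule tensor_rep[OF assms(1)]) (simp add: pure_tensor_def sum_distrib_left bilinear_form_scale[OF assms(2)] assms(2))

text \<open>The description by \<open>THE\<close> is independent of the representation of
  \<open>u\<close>: every functional \<open>f\<close> takes the value
  \<open>u (\<lambda>x y. f (h x y))\<close> at each candidate, and functionals separate
  elements.\<close>

lemma tensor_lift_eq:
  fixes C :: "('k::field, 'c, 'o) superalgebra_scheme"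
  assumes "superalgebra C" "bilinear_map A B C h"
    "\<And>i. i < (n::nat) \<Longrightarrow> a i \<in> carrier A" "\<And>i. i < n \<Longrightarrow> b i \<in> carrier B"
    "u = (\<lambda>\<beta>. \<Sum>i<n. pure_tensor A B (a i) (b i) \<beta>)"
  shows "tensor_lift A B C h u = (\<Oplus>\<^bsub>C\<^esub>i\<in>{..<n}. h (a i) (b i))"
proof -
  interpret C: superalgebra C by fact
  have h: "h x y \<in> carrier C" if "x \<in> carrier A" "y \<in> carrier B" for x y
    using assms(2) that by (auto simp: bilinear_map_def linear_map_def Pi_iff)
  have *: "(\<Oplus>\<^bsub>C\<^esub>i\<in>{..<m}. h (a' i) (b' i)) \<in> carrier C"
    if "\<And>i. i < (m::nat) \<Longrightarrow> a' i \<in> carrier A \<and> b' i \<in> carrier B" for m a' b'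
    using h that by (intro C.finsum_closed) auto
  have **: "f (\<Oplus>\<^bsub>C\<^esub>i\<in>{..<m}. h (a' i) (b' i)) = u (\<lambda>x y. f (h x y))"
    if "\<And>i. i < (m::nat) \<Longrightarrow> a' i \<in> carrier A \<and> b' i \<in> carrier B"
      "u = (\<lambda>\<beta>. \<Sum>i<m. pure_tensor A B (a' i) (b' i) \<beta>)" "linear_map C ground f" for m a' b' f
    using that h bilinear_form_comp[OF assms(2) that(3)]
    by (subst functional_finsum[OF assms(1) that(3)]) (auto simp: pure_tensor_def)
  show ?thesis
    unfolding tensor_lift_def
  proof (rule the_equality)
    fix c assume "\<exists>(m::nat) a' b'. (\<forall>i<m. a' i \<in> carrier A \<and> b' i \<in> carrier B) \<and>
      u = (\<lambda>\<beta>. \<Sum>i<m. pure_tensor A B (a' i) (b' i) \<beta>) \<and> c = (\<Oplus>\<^bsub>C\<^esub>i\<in>{..<m}. h (a' i) (b' i))"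
    then obtain m a' b' where m: "\<And>i. i < (m::nat) \<Longrightarrow> a' i \<in> carrier A \<and> b' i \<in> carrier B"
      "u = (\<lambda>\<beta>. \<Sum>i<m. pure_tensor A B (a' i) (b' i) \<beta>)"
      "c = (\<Oplus>\<^bsub>C\<^esub>i\<in>{..<m}. h (a' i) (b' i))" by blast
    show "c = (\<Oplus>\<^bsub>C\<^esub>i\<in>{..<n}. h (a i) (b i))"
    proof (rule C.functional_eqI)
      fix f assume f: "linear_map C (ground :: ('k, 'k) superalgebra) f"
      show "f c = f (\<Oplus>\<^bsub>C\<^esub>i\<in>{..<n}. h (a i) (b i))"
        unfolding m(3) using **[OF m(1,2) f] **[OF _ assms(5) f] assms(3,4) by simp
    qed (use * m assms(3,4) in auto)
  qed (use assms in blast)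
qed

lemma tensor_lift_closed:
  assumes "superalgebra C" "bilinear_map A B C h" "u \<in> carrier (tensor A B)"
  shows "tensor_lift A B C h u \<in> carrier C"
proof -
  interpret C: superalgebra C by fact
  have "h x y \<in> carrier C" if "x \<in> carrier A" "y \<in> carrier B" for x y
    using assms(2) that by (auto simp: bilinear_map_def linear_map_def Pi_iff)
  then show ?thesis
    by - (rule tensor_rep[OF assms(3)], subst tensor_lift_eq[OF assms(1,2)], auto intro!: C.finsum_closed)
qed

lemma tensor_lift_functional:
  assumes "superalgebra C" "bilinear_map A B C h" "u \<in> carrier (tensor A B)" "linear_map C ground f"
  shows "f (tensor_lift A B C h u) = u (\<lambda>a b. f (h a b))"
proof -
  have h: "h x y \<in> carrier C" if "x \<in> carrier A" "y \<in> carrier B" for x y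
    using assms(2) that by (auto simp: bilinear_map_def linear_map_def Pi_iff)
  obtain n a b where u: "\<And>i. i < (n::nat) \<Longrightarrow> a i \<in> carrier A" "\<And>i. i < n \<Longrightarrow> b i \<in> carrier B"
    "u = (\<lambda>\<beta>. \<Sum>i<n. pure_tensor A B (a i) (b i) \<beta>)"
    using assms(3) by (rule tensor_rep) blast
  have "f (tensor_lift A B C h u) = f (\<Oplus>\<^bsub>C\<^esub>i\<in>{..<n}. h (a i) (b i))"
    using tensor_lift_eq[OF assms(1,2) u] by simp
  also have "\<dots> = (\<Sum>i<n. f (h (a i) (b i)))"
    using u h by (intro functional_finsum[OF assms(1,4)]) auto
  also have "\<dots> = u (\<lambda>a b. f (h a b))"
    using bilinear_form_comp[OF assms(2,4)] by (simp add: u(3) pure_tensor_def)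
  finally show ?thesis .
qed

section \<open>Points, convolution and functionals\<close>

lemma superalgebra_homD:
  assumes "superalgebra_hom A B f"
  shows "linear_map A B f" "f \<one>\<^bsub>A\<^esub> = \<one>\<^bsub>B\<^esub>" "x \<in> part A i \<Longrightarrow> f x \<in> part B i"
    "x \<in> carrier A \<Longrightarrow> y \<in> carrier A \<Longrightarrow> f (x \<otimes>\<^bsub>A\<^esub> y) = f x \<otimes>\<^bsub>B\<^esub> f y"
    "x \<in> carrier A \<Longrightarrow> f x \<in> carrier B"
  using assms by (auto simp: superalgebra_hom_def even_linear_map_def linear_map_def image_subset_iff)

lemma superalgebra_homI:
  assumes "\<And>x. x \<in> carrier A \<Longrightarrow> f x \<in> carrier B"
    "\<And>x y. x \<in> carrier A \<Longrightarrow> y \<in> carrier A \<Longrightarrow> f (x \<oplus>\<^bsub>A\<^esub> y) = f x \<oplus>\<^bsub>B\<^esub> f y"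
    "\<And>r x. x \<in> carrier A \<Longrightarrow> f (r \<odot>\<^bsub>A\<^esub> x) = r \<odot>\<^bsub>B\<^esub> f x"
    "\<And>i x. x \<in> part A i \<Longrightarrow> f x \<in> part B i"
    "f \<one>\<^bsub>A\<^esub> = \<one>\<^bsub>B\<^esub>"
    "\<And>x y. x \<in> carrier A \<Longrightarrow> y \<in> carrier A \<Longrightarrow> f (x \<otimes>\<^bsub>A\<^esub> y) = f x \<otimes>\<^bsub>B\<^esub> f y"
  shows "superalgebra_hom A B f"
  using assms by (auto simp: superalgebra_hom_def even_linear_map_def linear_map_def)

lemma (in superalgebra) linear_mult_left: "c \<in> carrier A \<Longrightarrow> linear_map A A (\<lambda>x. c \<otimes> x)"
  by (auto simp: linear_map_def r_distr smult_mult_right)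

lemma (in superalgebra) linear_mult_right: "c \<in> carrier A \<Longrightarrow> linear_map A A (\<lambda>x. x \<otimes> c)"
  by (auto simp: linear_map_def l_distr smult_mult_left)

lemma ksign_simps [simp]:
  "ksign 0 i = 1" "ksign i 0 = 1" "ksign 1 1 = - 1"
  "ksign i j * ksign i j = 1" "ksign i j * ksign j i = 1"
  "ksign i j * (ksign i j * x) = x" "ksign i j * (ksign j i * x) = x"
  by (auto simp: ksign_def)

lemma superalgebra_hom_component:
  assumes "superalgebra A" "superalgebra B" "superalgebra_hom A B f" "x \<in> carrier A"
  shows "component B i (f x) = f (component A i x)"
proof -
  interpret A: superalgebra A by fact
  interpret B: superalgebra B by fact
  show ?thesis
  proof (rule B.component_eqI)
    show "f x = f (component A i x) \<oplus>\<^bsub>B\<^esub> f (component A (i + 1) x)"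
      using A.component_sum[OF assms(4), of i] assms(4) linear_mapD(2)[OF superalgebra_homD(1)[OF assms(3)]]
      by (metis A.component_carrier)
  qed (use assms superalgebra_homD(3)[OF assms(3)] in auto)
qed

context hopf_superalgebra
begin

lemma is_superalgebra: "superalgebra H"
  by (rule superalgebra_axioms)

lemma comult_closed [simp]: "x \<in> carrier H \<Longrightarrow> comult H x \<in> carrier (tensor H H)"
  using superalgebra_homD(5)[OF comult_hom] .

lemma comult_add: "x \<in> carrier H \<Longrightarrow> y \<in> carrier H \<Longrightarrow>
    comult H (x \<oplus> y) \<beta> = comult H x \<beta> + comult H y \<beta>"
  using linear_mapD(2)[OF superalgebra_homD(1)[OF comult_hom], of x y] by (simp add: tensor_def)

lemma comult_smult: "x \<in> carrier H \<Longrightarrow> comult H (r \<odot> x) \<beta> = r * comult H x \<beta>"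
  using linear_mapD(3)[OF superalgebra_homD(1)[OF comult_hom], of x r] by (simp add: tensor_def)

lemma comult_one: "bilinear_form H H \<beta> \<Longrightarrow> comult H \<one> \<beta> = \<beta> \<one> \<one>"
  using superalgebra_homD(2)[OF comult_hom] by (simp add: tensor_def pure_tensor_def)

lemma comult_mult: "x \<in> carrier H \<Longrightarrow> y \<in> carrier H \<Longrightarrow> bilinear_form H H \<beta> \<Longrightarrow>
    comult H (x \<otimes> y) \<beta> = comult H x (\<lambda>a b. comult H y (\<lambda>a' b'. \<Sum>i\<in>{0, 1}. \<Sum>j\<in>{0, 1}.
      ksign i j * \<beta> (a \<otimes> component H j a') (component H i b \<otimes> b')))"
  using superalgebra_homD(4)[OF comult_hom, of x y] by (simp add: tensor_def)

lemma comult_part: "x \<in> part H k \<Longrightarrow> comult H x \<in> tensor_span H H (\<Union>i. part H i \<times> part H (i + k))"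
  using superalgebra_homD(3)[OF comult_hom, of x k] by (simp add: tensor_def)

lemma counit_simps:
  "counit H \<one> = 1" "x \<in> carrier H \<Longrightarrow> y \<in> carrier H \<Longrightarrow> counit H (x \<oplus> y) = counit H x + counit H y"
  "x \<in> carrier H \<Longrightarrow> y \<in> carrier H \<Longrightarrow> counit H (x \<otimes> y) = counit H x * counit H y"
  "x \<in> carrier H \<Longrightarrow> counit H (r \<odot> x) = r * counit H x"
  "x \<in> part H 1 \<Longrightarrow> counit H x = 0"
  using superalgebra_homD(2-4)[OF counit_hom] linear_mapD[OF superalgebra_homD(1)[OF counit_hom]]
  by fastforce+

lemma linear_counit: "linear_map H ground (counit H)"
  using superalgebra_homD(1)[OF counit_hom] .

text \<open>The product \<open>(f \<otimes> g) \<circ> \<Delta>\<close> of the dual algebra, without the Koszul sign.\<close>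

definition star :: "('a \<Rightarrow> 'k) \<Rightarrow> ('a \<Rightarrow> 'k) \<Rightarrow> 'a \<Rightarrow> 'k" where
  "star f g x = comult H x (\<lambda>a b. f a * g b)"

lemma linear_star: "linear_map H ground (star f g)"
  by (simp add: linear_map_def star_def comult_add comult_smult)

lemma counit_star:
  assumes "linear_map H ground g" "x \<in> carrier H"
  shows "star (counit H) g x = g x"
proof -
  have bil: "bilinear_map H H H (\<lambda>a b. counit H a \<odot> b)"
    by (auto simp: bilinear_map_def linear_map_def counit_simps smult_add_left smult_add_right
        smult_smult mult.commute)
  have "g x = g (tensor_lift H H H (\<lambda>a b. counit H a \<odot> b) (comult H x))"
    using counit_left[OF assms(2)] by simp
  also have "\<dots> = comult H x (\<lambda>a b. g (counit H a \<odot> b))"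
    by (rule tensor_lift_functional[OF is_superalgebra bil comult_closed[OF assms(2)] assms(1)])
  also have "\<dots> = comult H x (\<lambda>a b. counit H a * g b)"
    by (rule tensor_cong[OF is_superalgebra is_superalgebra comult_closed[OF assms(2)]
          bilinear_form_comp[OF bil assms(1)]]) (use linear_mapD(3)[OF assms(1)] in simp)
  finally show ?thesis by (simp add: star_def)
qed

lemma star_counit:
  assumes "linear_map H ground g" "x \<in> carrier H"
  shows "star g (counit H) x = g x"
proof -
  have bil: "bilinear_map H H H (\<lambda>a b. counit H b \<odot> a)"
    by (auto simp: bilinear_map_def linear_map_def counit_simps smult_add_left smult_add_right
        smult_smult mult.commute)
  have "g x = g (tensor_lift H H H (\<lambda>a b. counit H b \<odot> a) (comult H x))"
    using counit_right[OF assms(2)] by simp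
  also have "\<dots> = comult H x (\<lambda>a b. g (counit H b \<odot> a))"
    by (rule tensor_lift_functional[OF is_superalgebra bil comult_closed[OF assms(2)] assms(1)])
  also have "\<dots> = comult H x (\<lambda>a b. g a * counit H b)"
    by (rule tensor_cong[OF is_superalgebra is_superalgebra comult_closed[OF assms(2)]
          bilinear_form_comp[OF bil assms(1)]]) (use linear_mapD(3)[OF assms(1)] in simp)
  finally show ?thesis by (simp add: star_def)
qed

end

section \<open>Convolution of points with values in a supercommutative superalgebra\<close>

context
  fixes H :: "('k::field, 'a, 'm) hopf_superalgebra_scheme"
    and C :: "('k, 'c, 'n) superalgebra_scheme"
  assumes H: "hopf_superalgebra H" and C: "supercommutative_superalgebra C"
begin

interpretation H: hopf_superalgebra H by (rule H)
interpretation C: supercommutative_superalgebra C by (rule C)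

lemma bilinear_map_mult:
  assumes "linear_map H C f" "linear_map H C g"
  shows "bilinear_map H H C (\<lambda>a b. f a \<otimes>\<^bsub>C\<^esub> g b)"
proof -
  have "linear_map H C (\<lambda>a. f a \<otimes>\<^bsub>C\<^esub> g b)" if "b \<in> carrier H" for b
    by (rule linear_map_comp[OF assms(1) C.linear_mult_right]) (rule linear_mapD(1)[OF assms(2) that])
  moreover have "linear_map H C (\<lambda>b. f a \<otimes>\<^bsub>C\<^esub> g b)" if "a \<in> carrier H" for a
    by (rule linear_map_comp[OF assms(2) C.linear_mult_left]) (rule linear_mapD(1)[OF assms(1) that])
  ultimately show ?thesis unfolding bilinear_map_def by blast
qed

lemma convolution_closed:
  assumes "linear_map H C f" "linear_map H C g" "x \<in> carrier H"
  shows "convolution H C f g x \<in> carrier C"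
  unfolding convolution_def
  by (rule tensor_lift_closed[OF C.superalgebra_axioms bilinear_map_mult[OF assms(1,2)]
        H.comult_closed[OF assms(3)]])

lemma convolution_functional:
  assumes "linear_map H C f" "linear_map H C g" "x \<in> carrier H" "linear_map C ground l"
  shows "l (convolution H C f g x) = comult H x (\<lambda>a b. l (f a \<otimes>\<^bsub>C\<^esub> g b))"
  unfolding convolution_def
  by (rule tensor_lift_functional[OF C.superalgebra_axioms bilinear_map_mult[OF assms(1,2)]
        H.comult_closed[OF assms(3)] assms(4)])

lemma convolution_part:
  assumes f: "superalgebra_hom H C f" and g: "superalgebra_hom H C g" and x: "x \<in> part H k"
  shows "convolution H C f g x \<in> part C k"
proof -
  note lin = superalgebra_homD(1)[OF f] superalgebra_homD(1)[OF g]
  obtain n a b where ab: "\<And>i. i < (n::nat) \<Longrightarrow> (a i, b i) \<in> (\<Union>i. part H i \<times> part H (i + k))"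
    "comult H x = (\<lambda>\<beta>. \<Sum>i<n. pure_tensor H H (a i) (b i) \<beta>)"
    using H.comult_part[OF x] unfolding tensor_span_def by blast
  have c: "a i \<in> carrier H" "b i \<in> carrier H" if "i < n" for i
    using ab(1)[OF that] H.part_carrier by auto
  have eq: "convolution H C f g x = (\<Oplus>\<^bsub>C\<^esub>i\<in>{..<n}. f (a i) \<otimes>\<^bsub>C\<^esub> g (b i))"
    unfolding convolution_def
    by (rule tensor_lift_eq[OF C.superalgebra_axioms bilinear_map_mult[OF lin] c ab(2)])
  have *: "f (a i) \<otimes>\<^bsub>C\<^esub> g (b i) \<in> part C k" if i: "i < n" for i
  proof -
    obtain j where "a i \<in> part H j" "b i \<in> part H (j + k)" using ab(1)[OF i] by blast
    then have "f (a i) \<otimes>\<^bsub>C\<^esub> g (b i) \<in> part C (j + (j + k))"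
      by (intro C.mult_part superalgebra_homD(3)[OF f] superalgebra_homD(3)[OF g])
    moreover have "j + (j + k) = k" by (cases j; cases k) simp_all
    ultimately show ?thesis by simp
  qed
  have "(\<Oplus>\<^bsub>C\<^esub>i\<in>I. f (a i) \<otimes>\<^bsub>C\<^esub> g (b i)) \<in> part C k" if "finite I" "I \<subseteq> {..<n}" for I
    using that
  proof (induction rule: finite_induct)
    case (insert i I)
    then have "(\<Oplus>\<^bsub>C\<^esub>i\<in>insert i I. f (a i) \<otimes>\<^bsub>C\<^esub> g (b i)) =
        f (a i) \<otimes>\<^bsub>C\<^esub> g (b i) \<oplus>\<^bsub>C\<^esub> (\<Oplus>\<^bsub>C\<^esub>i\<in>I. f (a i) \<otimes>\<^bsub>C\<^esub> g (b i))"
      using C.part_carrier[OF *] by (intro C.finsum_insert) auto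
    with insert * show ?case by auto
  qed simp
  with eq show ?thesis by simp
qed

text \<open>The Koszul sign in the product of the tensor square cancels the sign from exchanging the
  two middle factors in the supercommutative \<open>C\<close>. Both sides are compared under an
  arbitrary functional.\<close>

lemma convolution_mult:
  assumes f: "superalgebra_hom H C f" and g: "superalgebra_hom H C g"
    and x: "x \<in> carrier H" and y: "y \<in> carrier H"
  shows "convolution H C f g (x \<otimes>\<^bsub>H\<^esub> y) = convolution H C f g x \<otimes>\<^bsub>C\<^esub> convolution H C f g y"
proof (rule C.functional_eqI)
  note lin = superalgebra_homD(1)[OF f] superalgebra_homD(1)[OF g]
  note closed = superalgebra_homD(5)[OF f] superalgebra_homD(5)[OF g] convolution_closed[OF lin]
  note Halg = H.is_superalgebra
  let ?F = "convolution H C f g"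
  fix l assume l: "linear_map C (ground :: ('k, 'k) superalgebra) l"
  \<comment> \<open>With \<open>a\<close> and \<open>b\<close> fixed, the inner evaluation at
    \<open>comult H y\<close> collapses to a product with the convolution at \<open>y\<close>; the
    outer evaluation at \<open>comult H x\<close> is then treated alike.\<close>
  have inner: "comult H y (\<lambda>a' b'. \<Sum>i\<in>{0, 1}. \<Sum>j\<in>{0, 1}. ksign i j *
        l (f (a \<otimes>\<^bsub>H\<^esub> component H j a') \<otimes>\<^bsub>C\<^esub> g (component H i b \<otimes>\<^bsub>H\<^esub> b'))) =
      l ((f a \<otimes>\<^bsub>C\<^esub> g b) \<otimes>\<^bsub>C\<^esub> ?F y)" if ab: "a \<in> carrier H" "b \<in> carrier H" for a b
  proof -
    let ?l = "\<lambda>z. l ((f a \<otimes>\<^bsub>C\<^esub> g b) \<otimes>\<^bsub>C\<^esub> z)"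
    have l': "linear_map C ground ?l"
      using ab closed by (intro linear_map_comp[OF C.linear_mult_left l]) auto
    have pt: "?l (f a' \<otimes>\<^bsub>C\<^esub> g b') = (\<Sum>i\<in>{0, 1}. \<Sum>j\<in>{0, 1}. ksign i j *
        l (f (a \<otimes>\<^bsub>H\<^esub> component H j a') \<otimes>\<^bsub>C\<^esub> g (component H i b \<otimes>\<^bsub>H\<^esub> b')))"
      if ab': "a' \<in> carrier H" "b' \<in> carrier H" for a' b'
    proof -
      \<comment> \<open>The arguments of \<open>m\<close> are the two exchanged middle factors.
        Biadditivity in them allows splitting into homogeneous components, where the sign is
        known.\<close>
      define m where "m = (\<lambda>u v. l ((f a \<otimes>\<^bsub>C\<^esub> u) \<otimes>\<^bsub>C\<^esub> (v \<otimes>\<^bsub>C\<^esub> g b')))"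
      have m1: "m (u \<oplus>\<^bsub>C\<^esub> u') v = m u v + m u' v"
        if "u \<in> carrier C" "u' \<in> carrier C" "v \<in> carrier C" for u u' v
        using that ab ab' closed linear_mapD(2)[OF l] by (simp_all add: m_def C.l_distr C.r_distr)
      have m2: "m u (v \<oplus>\<^bsub>C\<^esub> v') = m u v + m u v'"
        if "u \<in> carrier C" "v \<in> carrier C" "v' \<in> carrier C" for u v v'
        using that ab ab' closed linear_mapD(2)[OF l] by (simp_all add: m_def C.l_distr C.r_distr)
      have term_eq: "ksign i j * l (f (a \<otimes>\<^bsub>H\<^esub> component H j a') \<otimes>\<^bsub>C\<^esub> g (component H i b \<otimes>\<^bsub>H\<^esub> b')) =
          m (g (component H i b)) (f (component H j a'))" for i j
      proof -
        let ?u = "g (component H i b)" and ?v = "f (component H j a')"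
        have uv: "?u \<in> part C i" "?v \<in> part C j"
          using ab ab' superalgebra_homD(3)[OF f] superalgebra_homD(3)[OF g] by auto
        note uvc = uv[THEN C.part_carrier]
        have "f (a \<otimes>\<^bsub>H\<^esub> component H j a') \<otimes>\<^bsub>C\<^esub> g (component H i b \<otimes>\<^bsub>H\<^esub> b') =
            (f a \<otimes>\<^bsub>C\<^esub> ?v) \<otimes>\<^bsub>C\<^esub> (?u \<otimes>\<^bsub>C\<^esub> g b')"
          using ab ab' superalgebra_homD(4)[OF f] superalgebra_homD(4)[OF g] by simp
        also have "\<dots> = f a \<otimes>\<^bsub>C\<^esub> (?v \<otimes>\<^bsub>C\<^esub> ?u) \<otimes>\<^bsub>C\<^esub> g b'"
          using ab ab' closed uvc by (simp add: C.m_assoc)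
        also have "\<dots> = f a \<otimes>\<^bsub>C\<^esub> (ksign j i \<odot>\<^bsub>C\<^esub> (?u \<otimes>\<^bsub>C\<^esub> ?v)) \<otimes>\<^bsub>C\<^esub> g b'"
          using C.supercomm[OF uv(2,1)] by simp
        also have "\<dots> = ksign j i \<odot>\<^bsub>C\<^esub> ((f a \<otimes>\<^bsub>C\<^esub> ?u) \<otimes>\<^bsub>C\<^esub> (?v \<otimes>\<^bsub>C\<^esub> g b'))"
          using ab ab' closed uvc by (simp add: C.m_assoc C.smult_mult_left C.smult_mult_right)
        finally have "l (f (a \<otimes>\<^bsub>H\<^esub> component H j a') \<otimes>\<^bsub>C\<^esub> g (component H i b \<otimes>\<^bsub>H\<^esub> b')) =
            ksign j i * m ?u ?v"
          using ab ab' closed uvc linear_mapD(3)[OF l] by (simp add: m_def)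
        then show ?thesis by simp
      qed
      have "?l (f a' \<otimes>\<^bsub>C\<^esub> g b') = m (g b) (f a')"
        by (simp add: m_def)
      also have "\<dots> = m (g (component H 0 b) \<oplus>\<^bsub>C\<^esub> g (component H 1 b))
          (f (component H 0 a') \<oplus>\<^bsub>C\<^esub> f (component H 1 a'))"
        using H.component_sum[of b 0] H.component_sum[of a' 0] ab ab'
          linear_mapD(2)[OF lin(1), of "component H 0 a'" "component H 1 a'"]
          linear_mapD(2)[OF lin(2), of "component H 0 b" "component H 1 b"] by simp
      also have "\<dots> = (\<Sum>i\<in>{0, 1}. \<Sum>j\<in>{0, 1}. m (g (component H i b)) (f (component H j a')))"
        using ab ab' closed by (simp add: m1 m2)
      finally show ?thesis by (simp only: term_eq)
    qed
    have "comult H y (\<lambda>a' b'. ?l (f a' \<otimes>\<^bsub>C\<^esub> g b')) = l ((f a \<otimes>\<^bsub>C\<^esub> g b) \<otimes>\<^bsub>C\<^esub> ?F y)"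
      using convolution_functional[OF lin y l'] by simp
    with tensor_cong[OF Halg Halg H.comult_closed[OF y] bilinear_form_comp[OF bilinear_map_mult[OF lin] l'] pt]
    show ?thesis by simp
  qed
  have l': "linear_map C ground (\<lambda>z. l (z \<otimes>\<^bsub>C\<^esub> ?F y))"
    using closed y by (intro linear_map_comp[OF C.linear_mult_right l]) auto
  have "l (?F (x \<otimes>\<^bsub>H\<^esub> y)) = comult H (x \<otimes>\<^bsub>H\<^esub> y) (\<lambda>a b. l (f a \<otimes>\<^bsub>C\<^esub> g b))"
    using x y by (intro convolution_functional[OF lin _ l]) simp
  also have "\<dots> = comult H x (\<lambda>a b. comult H y (\<lambda>a' b'. \<Sum>i\<in>{0, 1}. \<Sum>j\<in>{0, 1}. ksign i j *
        l (f (a \<otimes>\<^bsub>H\<^esub> component H j a') \<otimes>\<^bsub>C\<^esub> g (component H i b \<otimes>\<^bsub>H\<^esub> b'))))"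
    by (rule H.comult_mult[OF x y bilinear_form_comp[OF bilinear_map_mult[OF lin] l]])
  also have "\<dots> = comult H x (\<lambda>a b. l ((f a \<otimes>\<^bsub>C\<^esub> g b) \<otimes>\<^bsub>C\<^esub> ?F y))"
    using tensor_cong[OF Halg Halg H.comult_closed[OF x] bilinear_form_comp[OF bilinear_map_mult[OF lin] l'] inner[symmetric]]
    by simp
  also have "\<dots> = l (?F x \<otimes>\<^bsub>C\<^esub> ?F y)"
    using convolution_functional[OF lin x l'] by simp
  finally show "l (?F (x \<otimes>\<^bsub>H\<^esub> y)) = l (?F x \<otimes>\<^bsub>C\<^esub> ?F y)" .
qed (use assms convolution_closed[OF superalgebra_homD(1)[OF f] superalgebra_homD(1)[OF g]] in auto)

lemma convolution_hom:
  assumes f: "superalgebra_hom H C f" and g: "superalgebra_hom H C g"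
  shows "superalgebra_hom H C (convolution H C f g)"
proof (rule superalgebra_homI)
  note lin = superalgebra_homD(1)[OF f] superalgebra_homD(1)[OF g]
  note closed = convolution_closed[OF lin]
  note fn = convolution_functional[OF lin]
  show "convolution H C f g x \<in> carrier C" if "x \<in> carrier H" for x
    using closed that .
  show "convolution H C f g (x \<oplus>\<^bsub>H\<^esub> y) = convolution H C f g x \<oplus>\<^bsub>C\<^esub> convolution H C f g y"
    if "x \<in> carrier H" "y \<in> carrier H" for x y
  proof (rule C.functional_eqI)
    fix l assume l: "linear_map C (ground :: ('k, 'k) superalgebra) l"
    show "l (convolution H C f g (x \<oplus>\<^bsub>H\<^esub> y)) = l (convolution H C f g x \<oplus>\<^bsub>C\<^esub> convolution H C f g y)"
      using that closed linear_mapD(2)[OF l] by (simp add: fn[OF _ l] H.comult_add)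
  qed (use that closed in auto)
  show "convolution H C f g (r \<odot>\<^bsub>H\<^esub> x) = r \<odot>\<^bsub>C\<^esub> convolution H C f g x"
    if "x \<in> carrier H" for r x
  proof (rule C.functional_eqI)
    fix l assume l: "linear_map C (ground :: ('k, 'k) superalgebra) l"
    show "l (convolution H C f g (r \<odot>\<^bsub>H\<^esub> x)) = l (r \<odot>\<^bsub>C\<^esub> convolution H C f g x)"
      using that closed linear_mapD(3)[OF l] by (simp add: fn[OF _ l] H.comult_smult)
  qed (use that closed in auto)
  show "convolution H C f g x \<in> part C i" if "x \<in> part H i" for i x
    using convolution_part[OF f g that] .
  show "convolution H C f g \<one>\<^bsub>H\<^esub> = \<one>\<^bsub>C\<^esub>"
  proof (rule C.functional_eqI)
    fix l assume l: "linear_map C (ground :: ('k, 'k) superalgebra) l"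
    show "l (convolution H C f g \<one>\<^bsub>H\<^esub>) = l \<one>\<^bsub>C\<^esub>"
      using superalgebra_homD(2)[OF f] superalgebra_homD(2)[OF g]
        H.comult_one[OF bilinear_form_comp[OF bilinear_map_mult[OF lin] l]]
      by (simp add: fn[OF _ l])
  qed (use closed in auto)
  show "convolution H C f g (x \<otimes>\<^bsub>H\<^esub> y) = convolution H C f g x \<otimes>\<^bsub>C\<^esub> convolution H C f g y"
    if "x \<in> carrier H" "y \<in> carrier H" for x y
    using convolution_mult[OF f g that] .
qed

end

lemma comult_hopf_hom:
  assumes "hopf_superalgebra_hom H H' p" "x \<in> carrier H" "bilinear_form H' H' \<beta>"
  shows "comult H' (p x) \<beta> = comult H x (\<lambda>a b. \<beta> (p a) (p b))"
  using assms by (simp add: hopf_superalgebra_hom_def tensor_map_def)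

text \<open>Precomposition with a Hopf map respects the product of points. \<open>f'\<close> and
  \<open>g'\<close> need only agree with the composites on the carrier, because points are
  normalized outside it.\<close>

lemma convolution_hopf_hom:
  fixes H :: "('k::field, 'a, 'm) hopf_superalgebra_scheme"
    and H' :: "('k, 'b, 'n) hopf_superalgebra_scheme"
    and C :: "('k, 'c, 'o) superalgebra_scheme"
  assumes "hopf_superalgebra H" "hopf_superalgebra H'" "supercommutative_superalgebra C"
    "hopf_superalgebra_hom H H' p" "linear_map H' C f" "linear_map H' C g" "x \<in> carrier H"
    "\<And>x. x \<in> carrier H \<Longrightarrow> f' x = f (p x)" "\<And>x. x \<in> carrier H \<Longrightarrow> g' x = g (p x)"
  shows "convolution H C f' g' x = convolution H' C f g (p x)"
proof -
  interpret C: supercommutative_superalgebra C by fact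
  interpret H: hopf_superalgebra H by fact
  have p: "superalgebra_hom H H' p" using assms(4) by (simp add: hopf_superalgebra_hom_def)
  have px: "p x \<in> carrier H'" using superalgebra_homD(5)[OF p assms(7)] .
  have lin: "linear_map H C f'" "linear_map H C g'"
    using linear_map_comp[OF superalgebra_homD(1)[OF p] assms(5)]
      linear_map_comp[OF superalgebra_homD(1)[OF p] assms(6)] assms(8,9)
    by (auto simp: linear_map_def)
  show ?thesis
  proof (rule C.functional_eqI)
    fix l assume l: "linear_map C (ground :: ('k, 'k) superalgebra) l"
    have bil: "bilinear_form H' H' (\<lambda>a b. l (f a \<otimes>\<^bsub>C\<^esub> g b))"
      by (rule bilinear_form_comp[OF bilinear_map_mult[OF assms(2,3,5,6)] l])
    have bil': "bilinear_form H H (\<lambda>a b. l (f' a \<otimes>\<^bsub>C\<^esub> g' b))"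
      by (rule bilinear_form_comp[OF bilinear_map_mult[OF assms(1,3) lin] l])
    have "l (convolution H C f' g' x) = comult H x (\<lambda>a b. l (f' a \<otimes>\<^bsub>C\<^esub> g' b))"
      by (rule convolution_functional[OF assms(1,3) lin assms(7) l])
    also have "\<dots> = comult H x (\<lambda>a b. l (f (p a) \<otimes>\<^bsub>C\<^esub> g (p b)))"
      by (rule tensor_cong[OF H.is_superalgebra H.is_superalgebra H.comult_closed[OF assms(7)] bil'])
        (simp add: assms(8,9))
    also have "\<dots> = l (convolution H' C f g (p x))"
      using comult_hopf_hom[OF assms(4,7) bil] convolution_functional[OF assms(2,3,5,6) px l] by simp
    finally show "l (convolution H C f' g' x) = l (convolution H' C f g (p x))" .
  qed (use convolution_closed[OF assms(1,3) lin assms(7)] convolution_closed[OF assms(2,3,5,6) px] in auto)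
qed

section \<open>The bracket\<close>

context hopf_superalgebra
begin

lemma dual_component_linear:
  assumes "linear_map H ground f"
  shows "linear_map H ground (dual_component H i f)"
  using linear_map_comp[OF linear_component assms] by (auto simp: linear_map_def dual_component_def)

lemma dual_component_dual: "f \<in> dual H \<Longrightarrow> dual_component H i f \<in> dual H"
  using dual_component_linear by (auto simp: dual_def dual_component_def)

lemma dual_component_component:
  assumes "linear_map H ground f" "x \<in> carrier H"
  shows "dual_component H i f (component H j x) = (if i = j then dual_component H i f x else 0)"
  using assms functional_zero[OF is_superalgebra assms(1)] component_other[OF component_part, of x i j]
  by (auto simp: dual_component_def)

text \<open>Homogeneous forms vanish on components of the other parity, so a single term of the
  double sum survives and its sign factors out.\<close>

lemma dual_convolution_homogeneous:
  assumes f: "linear_map H ground f" and g: "linear_map H ground g" and x: "x \<in> carrier H"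
  shows "dual_convolution H (dual_component H i f) (dual_component H j g) x =
    ksign i j * star (dual_component H i f) (dual_component H j g) x"
proof -
  let ?f = "dual_component H i f" and ?g = "dual_component H j g"
  have bil: "bilinear_form H H (\<lambda>a b. ?f a * ?g b)"
    by (intro bilinear_form_product dual_component_linear f g)
  have "ksign i j * (?f a * ?g b) = (\<Sum>i'\<in>{0, 1}. \<Sum>j'\<in>{0, 1}.
      ksign i' j' * ?f (component H i' a) * ?g (component H j' b))"
    if "a \<in> carrier H" "b \<in> carrier H" for a b
    using bit_exhaust[of i] bit_exhaust[of j]
    by (auto simp: dual_component_component[OF f that(1)] dual_component_component[OF g that(2)])
  from tensor_cong[OF is_superalgebra is_superalgebra comult_closed[OF x] bilinear_form_scale[OF bil] this]
  show ?thesis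
    using x tensor_scale[OF comult_closed[OF x] bil, of "ksign i j"]
    by (simp add: dual_convolution_def star_def)
qed

text \<open>Replacing the signed convolution by \<open>star\<close> changes the bracket in bidegree
  \<open>(i, j)\<close> only by the factor \<open>ksign i j\<close>. Odd-odd brackets thus change
  sign, which does not affect their span.\<close>

lemma Lie_bracket_star:
  assumes "linear_map H ground f" "linear_map H ground g" "x \<in> carrier H"
  shows "Lie_bracket H f g x = (\<Sum>i\<in>{0, 1}. \<Sum>j\<in>{0, 1}. ksign i j *
     (star (dual_component H i f) (dual_component H j g) x -
      ksign i j * star (dual_component H j g) (dual_component H i f) x))"
  unfolding Lie_bracket_def
  by (intro sum.cong refl)
    (simp only: dual_convolution_homogeneous[OF assms] dual_convolution_homogeneous[OF assms(2,1,3)]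
      right_diff_distrib ksign_simps)

end

section \<open>Test algebras\<close>

definition exp_poly_ring :: "'k::field_char_0 fps set" where
  "exp_poly_ring = Domain exp_polys"

lemma exp_poly_ring_closed [simp]:
  fixes g h :: "'k::field_char_0 fps"
  shows "(0 :: 'k fps) \<in> exp_poly_ring" "(1 :: 'k fps) \<in> exp_poly_ring"
  "fps_const (r :: 'k) \<in> exp_poly_ring" "fps_exp (c :: 'k) \<in> exp_poly_ring" "(fps_X :: 'k fps) \<in> exp_poly_ring"
  "g \<in> exp_poly_ring \<Longrightarrow> h \<in> exp_poly_ring \<Longrightarrow> g + h \<in> exp_poly_ring"
  "g \<in> exp_poly_ring \<Longrightarrow> h \<in> exp_poly_ring \<Longrightarrow> g * h \<in> exp_poly_ring"
  "g \<in> exp_poly_ring \<Longrightarrow> fps_deriv g \<in> exp_poly_ring"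
proof -
  have const: "fps_const r \<in> exp_poly_ring" for r :: 'k
    using exp_polys_const by (force simp: exp_poly_ring_def)
  from const show "fps_const r \<in> exp_poly_ring" .
  from const[of 0] const[of 1] show "(0 :: 'k fps) \<in> exp_poly_ring" "(1 :: 'k fps) \<in> exp_poly_ring"
    by simp_all
  show "fps_exp c \<in> exp_poly_ring"
    using exp_polys_monomial[of c 1] by (force simp: exp_poly_ring_def)
  show "(fps_X :: 'k fps) \<in> exp_poly_ring"
    using exp_polys_monomial[of 0 "[:0, 1:]"] by (force simp: exp_poly_ring_def)
  show "g \<in> exp_poly_ring \<Longrightarrow> h \<in> exp_poly_ring \<Longrightarrow> g + h \<in> exp_poly_ring"
    using exp_polys_add by (force simp: exp_poly_ring_def)
  show "g \<in> exp_poly_ring \<Longrightarrow> h \<in> exp_poly_ring \<Longrightarrow> g * h \<in> exp_poly_ring"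
    using exp_polys_mult by (force simp: exp_poly_ring_def)
  show "g \<in> exp_poly_ring \<Longrightarrow> fps_deriv g \<in> exp_poly_ring"
    using exp_polys_deriv by (force simp: exp_poly_ring_def)
qed

lemma exp_poly_ring_minus [simp]: "g \<in> exp_poly_ring \<Longrightarrow> - g \<in> exp_poly_ring"
  using exp_poly_ring_closed(7)[OF exp_poly_ring_closed(3)[of "- 1"], of g]
  by (simp add: fps_const_neg[symmetric] del: fps_const_neg)

lemma exp_poly_ring_deriv: "g \<in> exp_poly_ring \<Longrightarrow> (g, exp_poly_deriv g) \<in> exp_polys"
  using exp_poly_deriv_eq by (force simp: exp_poly_ring_def)

type_synonym 'k quad = "'k fps \<times> 'k fps \<times> 'k fps \<times> 'k fps"

text \<open>\<open>Q i j\<close> is \<open>R \<oplus> R \<epsilon> \<oplus> R \<eta> \<oplus> R \<epsilon> \<eta>\<close>, where \<open>R\<close> is the ring of exponential polynomials,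
  \<open>\<epsilon>\<close> and \<open>\<eta>\<close> have parities \<open>i\<close> and \<open>j\<close>, \<open>\<epsilon>\<^sup>2 = \<eta>\<^sup>2 = 0\<close>, and \<open>\<eta> \<epsilon> = (-1)^(i j) \<epsilon> \<eta>\<close>.\<close>

locale quad_algebra =
  fixes enc :: "'k::field_char_0 quad \<Rightarrow> 'c"
  assumes inj_enc: "inj enc"
begin

definition dec :: "'c \<Rightarrow> 'k quad" where
  "dec = inv_into UNIV enc"

lemma dec_enc [simp]: "dec (enc a) = a"
  by (simp add: dec_def inj_enc)

lemma enc_eq_iff [simp]: "enc a = enc b \<longleftrightarrow> a = b"
  using inj_enc by (simp add: inj_eq)

definition quads :: "'k quad set" where
  "quads = exp_poly_ring \<times> exp_poly_ring \<times> exp_poly_ring \<times> exp_poly_ring"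

definition Q :: "bit \<Rightarrow> bit \<Rightarrow> ('k, 'c) superalgebra" where
  "Q i j =
    \<lparr>carrier = enc ` quads,
     monoid.mult = (\<lambda>x y. case (dec x, dec y) of ((a, b, c, d), (a', b', c', d')) \<Rightarrow>
       enc (a * a', a * b' + b * a', a * c' + c * a',
         a * d' + d * a' + b * c' + fps_const (ksign i j) * c * b')),
     one = enc (1, 0, 0, 0),
     zero = enc (0, 0, 0, 0),
     add = (\<lambda>x y. case (dec x, dec y) of ((a, b, c, d), (a', b', c', d')) \<Rightarrow>
       enc (a + a', b + b', c + c', d + d')),
     module.smult = (\<lambda>r x. case dec x of (a, b, c, d) \<Rightarrow>
       enc (fps_const r * a, fps_const r * b, fps_const r * c, fps_const r * d)),
     part = (\<lambda>k. {enc (a, b, c, d) | a b c d. (a, b, c, d) \<in> quads \<and> (a \<noteq> 0 \<longrightarrow> k = 0) \<and>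
       (b \<noteq> 0 \<longrightarrow> k = i) \<and> (c \<noteq> 0 \<longrightarrow> k = j) \<and> (d \<noteq> 0 \<longrightarrow> k = i + j)})\<rparr>"

lemma Q_simps [simp]:
  "enc (a, b, c, d) \<otimes>\<^bsub>Q i j\<^esub> enc (a', b', c', d') = enc (a * a', a * b' + b * a', a * c' + c * a',
         a * d' + d * a' + b * c' + fps_const (ksign i j) * c * b')"
  "enc (a, b, c, d) \<oplus>\<^bsub>Q i j\<^esub> enc (a', b', c', d') = enc (a + a', b + b', c + c', d + d')"
  "r \<odot>\<^bsub>Q i j\<^esub> enc (a, b, c, d) = enc (fps_const r * a, fps_const r * b, fps_const r * c, fps_const r * d)"
  "\<one>\<^bsub>Q i j\<^esub> = enc (1, 0, 0, 0)" "\<zero>\<^bsub>Q i j\<^esub> = enc (0, 0, 0, 0)"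
  "enc (a, b, c, d) \<in> carrier (Q i j) \<longleftrightarrow>
    a \<in> exp_poly_ring \<and> b \<in> exp_poly_ring \<and> c \<in> exp_poly_ring \<and> d \<in> exp_poly_ring"
  "enc (a, b, c, d) \<in> part (Q i j) k \<longleftrightarrow>
    (a \<in> exp_poly_ring \<and> b \<in> exp_poly_ring \<and> c \<in> exp_poly_ring \<and> d \<in> exp_poly_ring) \<and>
    (a \<noteq> 0 \<longrightarrow> k = 0) \<and> (b \<noteq> 0 \<longrightarrow> k = i) \<and> (c \<noteq> 0 \<longrightarrow> k = j) \<and> (d \<noteq> 0 \<longrightarrow> k = i + j)"
  by (auto simp: Q_def quads_def image_iff)

lemma Q_carrierE:
  assumes "x \<in> carrier (Q i j)"
  obtains a b c d where "x = enc (a, b, c, d)" "a \<in> exp_poly_ring" "b \<in> exp_poly_ring"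
    "c \<in> exp_poly_ring" "d \<in> exp_poly_ring"
  using assms by (auto simp: Q_def quads_def)

lemma Q_partE:
  assumes "x \<in> part (Q i j) k"
  obtains a b c d where "x = enc (a, b, c, d)" "a \<in> exp_poly_ring" "b \<in> exp_poly_ring"
    "c \<in> exp_poly_ring" "d \<in> exp_poly_ring" "a \<noteq> 0 \<longrightarrow> k = 0" "b \<noteq> 0 \<longrightarrow> k = i" "c \<noteq> 0 \<longrightarrow> k = j"
    "d \<noteq> 0 \<longrightarrow> k = i + j"
  using assms by (auto simp: Q_def quads_def)

lemma Q_abelian_group: "abelian_group (Q i j)"
proof (rule abelian_groupI)
  fix x assume "x \<in> carrier (Q i j)"
  then show "\<exists>y\<in>carrier (Q i j). y \<oplus>\<^bsub>Q i j\<^esub> x = \<zero>\<^bsub>Q i j\<^esub>"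
  proof (rule Q_carrierE)
    fix a b c d assume "x = enc (a, b, c, d)" "a \<in> exp_poly_ring" "b \<in> exp_poly_ring"
      "c \<in> exp_poly_ring" "d \<in> exp_poly_ring"
    then show ?thesis by (intro bexI[of _ "enc (- a, - b, - c, - d)"]) simp_all
  qed
qed (auto elim!: Q_carrierE simp: add_ac)

lemma Q_minus [simp]:
  assumes "enc (a, b, c, d) \<in> carrier (Q i j)"
  shows "\<ominus>\<^bsub>Q i j\<^esub> enc (a, b, c, d) = enc (- a, - b, - c, - d)"
proof -
  interpret abelian_group "Q i j" by (rule Q_abelian_group)
  show ?thesis using assms by (intro minus_equality) auto
qed

lemma Q_ring: "ring (Q i j)"
proof (rule ringI)
  show "Group.monoid (Q i j)"
    by (rule monoidI) (auto elim!: Q_carrierE simp: algebra_simps)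
qed (auto intro: Q_abelian_group elim!: Q_carrierE simp: algebra_simps)

lemma Q_module: "Module.module ground (Q i j)"
  by (rule Module.moduleI[OF cring_ground Q_abelian_group])
    (auto elim!: Q_carrierE simp: algebra_simps fps_const_add[symmetric] fps_const_mult[symmetric]
      simp del: fps_const_add fps_const_mult)

lemma Q_supercommutative_superalgebra: "supercommutative_superalgebra (Q i j)"
proof -
  interpret Q: ring "Q i j" by (rule Q_ring)
  interpret M: Module.module ground "Q i j" by (rule Q_module)
  show ?thesis
  proof (intro supercommutative_superalgebra.intro superalgebra.intro superalgebra_axioms.intro
      supercommutative_superalgebra_axioms.intro Q_ring Q_module)
    show "submodule (part (Q i j) k) ground (Q i j)" for k
    proof (rule M.submoduleI)
      show "\<ominus>\<^bsub>Q i j\<^esub> a \<in> part (Q i j) k" if "a \<in> part (Q i j) k" for a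
        using that by (elim Q_partE) simp
    qed (auto elim!: Q_partE)
    show "\<exists>y\<in>part (Q i j) 0. \<exists>z\<in>part (Q i j) 1. x = y \<oplus>\<^bsub>Q i j\<^esub> z" if x: "x \<in> carrier (Q i j)" for x
    proof -
      obtain a b c d where *: "x = enc (a, b, c, d)" "a \<in> exp_poly_ring" "b \<in> exp_poly_ring"
        "c \<in> exp_poly_ring" "d \<in> exp_poly_ring" using x by (rule Q_carrierE)
      show ?thesis
        by (rule bexI[of _ "enc (a, if i = 0 then b else 0, if j = 0 then c else 0, if i + j = 0 then d else 0)"],
            rule bexI[of _ "enc (0, if i = 0 then 0 else b, if j = 0 then 0 else c, if i + j = 0 then 0 else d)"])
          (use * in simp_all)
    qed
    show "part (Q i j) 0 \<inter> part (Q i j) 1 = {\<zero>\<^bsub>Q i j\<^esub>}"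
      by (auto elim!: Q_partE)
    show "x \<otimes>\<^bsub>Q i j\<^esub> y \<in> part (Q i j) (k + l)" if "x \<in> part (Q i j) k" "y \<in> part (Q i j) l" for x y k l
      using that bit_exhaust[of i] bit_exhaust[of j] bit_exhaust[of k] bit_exhaust[of l]
      by (elim Q_partE disjE) simp_all
    show "x \<otimes>\<^bsub>Q i j\<^esub> y = ksign k l \<odot>\<^bsub>Q i j\<^esub> (y \<otimes>\<^bsub>Q i j\<^esub> x)"
      if "x \<in> part (Q i j) k" "y \<in> part (Q i j) l" for x y k l
      using that bit_exhaust[of i] bit_exhaust[of j] bit_exhaust[of k] bit_exhaust[of l]
      by (elim Q_partE disjE) (simp_all add: mult.commute fps_const_neg[symmetric] del: fps_const_neg)
  qed (auto elim!: Q_carrierE simp: algebra_simps)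
qed

sublocale Q: supercommutative_superalgebra "Q i j" for i j
  by (rule Q_supercommutative_superalgebra)

definition cf0 :: "'c \<Rightarrow> 'k fps" where "cf0 x = fst (dec x)"
definition cf1 :: "'c \<Rightarrow> 'k fps" where "cf1 x = fst (snd (dec x))"
definition cf2 :: "'c \<Rightarrow> 'k fps" where "cf2 x = fst (snd (snd (dec x)))"
definition cf3 :: "'c \<Rightarrow> 'k fps" where "cf3 x = snd (snd (snd (dec x)))"

lemma cf_enc [simp]:
  "cf0 (enc (a, b, c, d)) = a" "cf1 (enc (a, b, c, d)) = b"
  "cf2 (enc (a, b, c, d)) = c" "cf3 (enc (a, b, c, d)) = d"
  by (simp_all add: cf0_def cf1_def cf2_def cf3_def)

lemma enc_cf: "x \<in> carrier (Q i j) \<Longrightarrow> x = enc (cf0 x, cf1 x, cf2 x, cf3 x)"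
  by (erule Q_carrierE) simp

lemma cf_closed:
  "x \<in> carrier (Q i j) \<Longrightarrow> cf0 x \<in> exp_poly_ring" "x \<in> carrier (Q i j) \<Longrightarrow> cf1 x \<in> exp_poly_ring"
  "x \<in> carrier (Q i j) \<Longrightarrow> cf2 x \<in> exp_poly_ring" "x \<in> carrier (Q i j) \<Longrightarrow> cf3 x \<in> exp_poly_ring"
  by (auto elim!: Q_carrierE)

lemma linear_cf:
  "linear_map (Q i j) ground (\<lambda>x. fps_nth (cf0 x) n)" "linear_map (Q i j) ground (\<lambda>x. fps_nth (cf1 x) n)"
  "linear_map (Q i j) ground (\<lambda>x. fps_nth (cf2 x) n)" "linear_map (Q i j) ground (\<lambda>x. fps_nth (cf3 x) n)"
  by (auto simp: linear_map_def elim!: Q_carrierE)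

end

context quad_algebra
begin

text \<open>\<open>F0\<close> is the base point, \<open>F1\<close> and \<open>F2\<close> are
  derivations along it, and \<open>F3\<close> is a second-order term whose product rule has two
  cross terms, from \<epsilon>\<eta> and \<eta>\<epsilon>.\<close>

lemma Q_homI:
  fixes F0 F1 F2 F3 :: "'a \<Rightarrow> 'k fps"
  assumes closed: "\<And>x. x \<in> carrier A \<Longrightarrow> F0 x \<in> exp_poly_ring \<and> F1 x \<in> exp_poly_ring \<and>
      F2 x \<in> exp_poly_ring \<and> F3 x \<in> exp_poly_ring"
    and add: "\<And>x y. x \<in> carrier A \<Longrightarrow> y \<in> carrier A \<Longrightarrow> F0 (x \<oplus>\<^bsub>A\<^esub> y) = F0 x + F0 y \<and>
      F1 (x \<oplus>\<^bsub>A\<^esub> y) = F1 x + F1 y \<and> F2 (x \<oplus>\<^bsub>A\<^esub> y) = F2 x + F2 y \<and> F3 (x \<oplus>\<^bsub>A\<^esub> y) = F3 x + F3 y"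
    and smult: "\<And>r x. x \<in> carrier A \<Longrightarrow> F0 (r \<odot>\<^bsub>A\<^esub> x) = fps_const r * F0 x \<and>
      F1 (r \<odot>\<^bsub>A\<^esub> x) = fps_const r * F1 x \<and> F2 (r \<odot>\<^bsub>A\<^esub> x) = fps_const r * F2 x \<and>
      F3 (r \<odot>\<^bsub>A\<^esub> x) = fps_const r * F3 x"
    and parity: "\<And>k x. x \<in> part A k \<Longrightarrow> x \<in> carrier A \<and> (F0 x \<noteq> 0 \<longrightarrow> k = 0) \<and> (F1 x \<noteq> 0 \<longrightarrow> k = i) \<and>
      (F2 x \<noteq> 0 \<longrightarrow> k = j) \<and> (F3 x \<noteq> 0 \<longrightarrow> k = i + j)"
    and one: "F0 \<one>\<^bsub>A\<^esub> = 1" "F1 \<one>\<^bsub>A\<^esub> = 0" "F2 \<one>\<^bsub>A\<^esub> = 0" "F3 \<one>\<^bsub>A\<^esub> = 0"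
    and mult: "\<And>x y. x \<in> carrier A \<Longrightarrow> y \<in> carrier A \<Longrightarrow> F0 (x \<otimes>\<^bsub>A\<^esub> y) = F0 x * F0 y \<and>
      F1 (x \<otimes>\<^bsub>A\<^esub> y) = F0 x * F1 y + F1 x * F0 y \<and> F2 (x \<otimes>\<^bsub>A\<^esub> y) = F0 x * F2 y + F2 x * F0 y \<and>
      F3 (x \<otimes>\<^bsub>A\<^esub> y) = F0 x * F3 y + F3 x * F0 y + F1 x * F2 y + fps_const (ksign i j) * F2 x * F1 y"
  shows "superalgebra_hom A (Q i j) (\<lambda>x. enc (F0 x, F1 x, F2 x, F3 x))"
proof (rule superalgebra_homI)
  show "enc (F0 x, F1 x, F2 x, F3 x) \<in> part (Q i j) k" if "x \<in> part A k" for k x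
    using parity[OF that] closed[of x] by simp
qed (use closed add smult one mult in simp_all)

lemma Q_hom_cf:
  assumes "superalgebra_hom A (Q i j) F"
  shows "x \<in> carrier A \<Longrightarrow> F x = enc (cf0 (F x), cf1 (F x), cf2 (F x), cf3 (F x))"
    "x \<in> part A k \<Longrightarrow> (cf0 (F x) \<noteq> 0 \<longrightarrow> k = 0) \<and> (cf1 (F x) \<noteq> 0 \<longrightarrow> k = i) \<and>
      (cf2 (F x) \<noteq> 0 \<longrightarrow> k = j) \<and> (cf3 (F x) \<noteq> 0 \<longrightarrow> k = i + j)"
    "x \<in> carrier A \<Longrightarrow> y \<in> carrier A \<Longrightarrow> cf0 (F (x \<otimes>\<^bsub>A\<^esub> y)) = cf0 (F x) * cf0 (F y)"
    "x \<in> carrier A \<Longrightarrow> y \<in> carrier A \<Longrightarrow>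
      cf1 (F (x \<otimes>\<^bsub>A\<^esub> y)) = cf0 (F x) * cf1 (F y) + cf1 (F x) * cf0 (F y)"
    "x \<in> carrier A \<Longrightarrow> y \<in> carrier A \<Longrightarrow>
      cf3 (F (x \<otimes>\<^bsub>A\<^esub> y)) = cf0 (F x) * cf3 (F y) + cf3 (F x) * cf0 (F y) + cf1 (F x) * cf2 (F y) +
        fps_const (ksign i j) * cf2 (F x) * cf1 (F y)"
    "x \<in> carrier A \<Longrightarrow> y \<in> carrier A \<Longrightarrow> cf0 (F (x \<oplus>\<^bsub>A\<^esub> y)) = cf0 (F x) + cf0 (F y)"
    "x \<in> carrier A \<Longrightarrow> cf0 (F (r \<odot>\<^bsub>A\<^esub> x)) = fps_const r * cf0 (F x)"
    "F \<one>\<^bsub>A\<^esub> = enc (1, 0, 0, 0)"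
    "x \<in> carrier A \<Longrightarrow> cf0 (F x) \<in> exp_poly_ring"
proof -
  note F = superalgebra_homD[OF assms]
  show enc: "F x = enc (cf0 (F x), cf1 (F x), cf2 (F x), cf3 (F x))" if "x \<in> carrier A" for x
    using enc_cf[OF F(5)[OF that]] .
  show "(cf0 (F x) \<noteq> 0 \<longrightarrow> k = 0) \<and> (cf1 (F x) \<noteq> 0 \<longrightarrow> k = i) \<and>
      (cf2 (F x) \<noteq> 0 \<longrightarrow> k = j) \<and> (cf3 (F x) \<noteq> 0 \<longrightarrow> k = i + j)" if "x \<in> part A k" for x k
    using F(3)[OF that] by (elim Q_partE) auto
  show "F \<one>\<^bsub>A\<^esub> = enc (1, 0, 0, 0)" using F(2) by simp
  show "cf0 (F x) \<in> exp_poly_ring" if "x \<in> carrier A" using cf_closed(1)[OF F(5)[OF that]] .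
  have mult: "F (x \<otimes>\<^bsub>A\<^esub> y) = enc (cf0 (F x), cf1 (F x), cf2 (F x), cf3 (F x)) \<otimes>\<^bsub>Q i j\<^esub>
      enc (cf0 (F y), cf1 (F y), cf2 (F y), cf3 (F y))" if "x \<in> carrier A" "y \<in> carrier A"
    using F(4)[OF that] enc[OF that(1)] enc[OF that(2)] by simp
  show "cf0 (F (x \<otimes>\<^bsub>A\<^esub> y)) = cf0 (F x) * cf0 (F y)"
    "cf1 (F (x \<otimes>\<^bsub>A\<^esub> y)) = cf0 (F x) * cf1 (F y) + cf1 (F x) * cf0 (F y)"
    "cf3 (F (x \<otimes>\<^bsub>A\<^esub> y)) = cf0 (F x) * cf3 (F y) + cf3 (F x) * cf0 (F y) + cf1 (F x) * cf2 (F y) +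
        fps_const (ksign i j) * cf2 (F x) * cf1 (F y)" if "x \<in> carrier A" "y \<in> carrier A"
    unfolding mult[OF that] by simp_all
  show "cf0 (F (x \<oplus>\<^bsub>A\<^esub> y)) = cf0 (F x) + cf0 (F y)" if "x \<in> carrier A" "y \<in> carrier A"
  proof -
    have "F (x \<oplus>\<^bsub>A\<^esub> y) = enc (cf0 (F x), cf1 (F x), cf2 (F x), cf3 (F x)) \<oplus>\<^bsub>Q i j\<^esub>
        enc (cf0 (F y), cf1 (F y), cf2 (F y), cf3 (F y))"
      using linear_mapD(2)[OF F(1) that] enc[OF that(1)] enc[OF that(2)] by simp
    then show ?thesis by simp
  qed
  show "cf0 (F (r \<odot>\<^bsub>A\<^esub> x)) = fps_const r * cf0 (F x)" if "x \<in> carrier A"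
  proof -
    have "F (r \<odot>\<^bsub>A\<^esub> x) = r \<odot>\<^bsub>Q i j\<^esub> enc (cf0 (F x), cf1 (F x), cf2 (F x), cf3 (F x))"
      using linear_mapD(3)[OF F(1) that] enc[OF that] by simp
    then show ?thesis by simp
  qed
qed

end

section \<open>Coordinates on L\<close>

text \<open>On the test points used below the product of the coordinates \<beta> and t vanishes, so
  the complicated corner entry of the matrix reduces to t.\<close>

lemma (in superalgebra) unipotent_correction:
  assumes "\<alpha> \<in> Units A" "\<beta> \<in> carrier A" "t \<in> carrier A" "\<beta> \<otimes> t = \<zero>"
  shows "(\<one> \<oplus> inv \<alpha> \<otimes> \<beta>) \<otimes> t = t"
  using assms by (simp add: l_distr m_assoc Units_inv_closed)

text \<open>This collects what is known of \<open>L\<close>: its points are the prescribed matrices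
  and multiply as matrices. \<open>hom_unique\<close> stands in for the statement that the entries
  generate the coordinate algebra.\<close>

locale L_points = quad_algebra enc for enc :: "'k::field_char_0 quad \<Rightarrow> 'c" +
  fixes L :: "('k, 'c) hopf_superalgebra" and z :: "nat \<times> nat \<Rightarrow> 'c"
  assumes supergroup: "supergroup L"
    and z_closed: "i < 4 \<Longrightarrow> j < 4 \<Longrightarrow> z (i, j) \<in> carrier L"
    and hom_form: "\<And>C :: ('k, 'c) superalgebra. supercommutative_superalgebra C \<Longrightarrow>
      superalgebra_hom L C f \<Longrightarrow> \<exists>\<alpha> \<beta> t. \<alpha> \<in> part C 0 \<inter> Units C \<and> \<beta> \<in> part C 0 \<and> t \<in> part C 1 \<and>
        (\<forall>i<4. \<forall>j<4. f (z (i, j)) = L_matrix C \<alpha> \<beta> t (i, j))"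
    and hom_exists: "\<And>C :: ('k, 'c) superalgebra. supercommutative_superalgebra C \<Longrightarrow>
      \<alpha> \<in> part C 0 \<inter> Units C \<Longrightarrow> \<beta> \<in> part C 0 \<Longrightarrow> t \<in> part C 1 \<Longrightarrow>
      \<exists>f. superalgebra_hom L C f \<and> (\<forall>i<4. \<forall>j<4. f (z (i, j)) = L_matrix C \<alpha> \<beta> t (i, j))"
    and hom_unique: "\<And>C :: ('k, 'c) superalgebra. supercommutative_superalgebra C \<Longrightarrow>
      superalgebra_hom L C f \<Longrightarrow> superalgebra_hom L C g \<Longrightarrow>
      (\<And>i j. i < 4 \<Longrightarrow> j < 4 \<Longrightarrow> f (z (i, j)) = g (z (i, j))) \<Longrightarrow> x \<in> carrier L \<Longrightarrow> f x = g x"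
    and hom_mult: "\<And>C :: ('k, 'c) superalgebra. supercommutative_superalgebra C \<Longrightarrow>
      superalgebra_hom L C f \<Longrightarrow> superalgebra_hom L C g \<Longrightarrow> i < 4 \<Longrightarrow> j < 4 \<Longrightarrow>
      convolution L C f g (z (i, j)) = (\<Oplus>\<^bsub>C\<^esub>l\<in>{..<4}. f (z (i, l)) \<otimes>\<^bsub>C\<^esub> g (z (l, j)))"
begin

sublocale L: supergroup L by (rule supergroup)

text \<open>\<open>za\<close>, \<open>zb\<close>, \<open>zt\<close> are the matrix coordinates
  \<open>\<alpha>\<^sub>1\<close>, \<open>\<alpha>\<^sub>2\<close>, \<open>t\<close> themselves, not
  the normalized \<open>a\<close> and \<open>s\<close> of the overview.\<close>

definition za where "za = z (0, 0)"
definition zb where "zb = z (0, 1)"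
definition zt where "zt = z (0, 2)"

lemma coordinates_closed [simp]: "za \<in> carrier L" "zb \<in> carrier L" "zt \<in> carrier L"
  by (simp_all add: za_def zb_def zt_def z_closed)

lemma less_4: "i < 4 \<longleftrightarrow> i = 0 \<or> i = 1 \<or> i = 2 \<or> i = (3::nat)"
  by auto

context
  fixes C :: "('k, 'c) superalgebra"
  assumes C: "supercommutative_superalgebra C"
begin

interpretation C: supercommutative_superalgebra C by (rule C)

lemma hom_coordinates:
  assumes "superalgebra_hom L C f"
  shows "f za \<in> part C 0" "f za \<in> Units C" "f zb \<in> part C 0" "f zt \<in> part C 1"
    "i < 4 \<Longrightarrow> j < 4 \<Longrightarrow> f (z (i, j)) = L_matrix C (f za) (f zb) (f zt) (i, j)"
proof -
  obtain \<alpha> \<beta> t where f: "\<alpha> \<in> part C 0 \<inter> Units C" "\<beta> \<in> part C 0" "t \<in> part C 1"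
    "\<forall>i<4. \<forall>j<4. f (z (i, j)) = L_matrix C \<alpha> \<beta> t (i, j)"
    using hom_form[OF C assms] by blast
  then have "f za = \<alpha>" "f zb = \<beta>" "f zt = t"
    by (simp_all add: za_def zb_def zt_def L_matrix_def Let_def)
  with f show "f za \<in> part C 0" "f za \<in> Units C" "f zb \<in> part C 0" "f zt \<in> part C 1"
    "i < 4 \<Longrightarrow> j < 4 \<Longrightarrow> f (z (i, j)) = L_matrix C (f za) (f zb) (f zt) (i, j)"
    by simp_all
qed

lemma hom_eqI:
  assumes "superalgebra_hom L C f" "superalgebra_hom L C g"
    "f za = g za" "f zb = g zb" "f zt = g zt" "x \<in> carrier L"
  shows "f x = g x"
  using hom_unique[OF C assms(1,2) _ assms(6)] hom_coordinates(5)[OF assms(1)]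
    hom_coordinates(5)[OF assms(2)] assms(3-5) by simp

lemma hom_exists_coordinates:
  assumes "\<alpha> \<in> part C 0" "\<alpha> \<in> Units C" "\<beta> \<in> part C 0" "t \<in> part C 1"
  shows "\<exists>f. superalgebra_hom L C f \<and> f za = \<alpha> \<and> f zb = \<beta> \<and> f zt = t"
proof -
  obtain f where f: "superalgebra_hom L C f" "\<forall>i<4. \<forall>j<4. f (z (i, j)) = L_matrix C \<alpha> \<beta> t (i, j)"
    using hom_exists[OF C] assms by blast
  then have "f za = \<alpha> \<and> f zb = \<beta> \<and> f zt = t"
    by (simp add: za_def zb_def zt_def L_matrix_def Let_def)
  with f show ?thesis by blast
qed

lemma sum_4: "(\<And>l. l < 4 \<Longrightarrow> x l \<in> carrier C) \<Longrightarrow>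
    (\<Oplus>\<^bsub>C\<^esub>l\<in>{..<4::nat}. x l) = x 3 \<oplus>\<^bsub>C\<^esub> (x 2 \<oplus>\<^bsub>C\<^esub> (x 1 \<oplus>\<^bsub>C\<^esub> x 0))"
proof -
  assume x: "\<And>l. l < 4 \<Longrightarrow> x l \<in> carrier C"
  have "{..<4::nat} = {3, 2, 1, 0}" by (auto simp: less_4)
  then show ?thesis using x by (simp add: C.finsum_insert Pi_def)
qed

definition corner :: "('c \<Rightarrow> 'c) \<Rightarrow> 'c" where
  "corner f = (\<one>\<^bsub>C\<^esub> \<oplus>\<^bsub>C\<^esub> inv\<^bsub>C\<^esub> f za \<otimes>\<^bsub>C\<^esub> f zb) \<otimes>\<^bsub>C\<^esub> f zt"

text \<open>This is the first row of the matrix product. In the entry \<open>(0, 1)\<close> the odd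
  blocks contribute t times corner, from \<open>(0, 2)\<close> and \<open>(2, 1)\<close>, and corner
  times t, from \<open>(0, 3)\<close> and \<open>(3, 1)\<close>; when the corner is t these two
  terms give the factor 2.\<close>

lemma convolution_coordinates:
  assumes f: "superalgebra_hom L C f" and g: "superalgebra_hom L C g"
  shows "convolution L C f g za = f za \<otimes>\<^bsub>C\<^esub> g za \<oplus>\<^bsub>C\<^esub> f zt \<otimes>\<^bsub>C\<^esub> g zt"
    "convolution L C f g zb = f za \<otimes>\<^bsub>C\<^esub> g zb \<oplus>\<^bsub>C\<^esub> f zb \<otimes>\<^bsub>C\<^esub> g za \<oplus>\<^bsub>C\<^esub>
      (f zt \<otimes>\<^bsub>C\<^esub> corner g \<oplus>\<^bsub>C\<^esub> corner f \<otimes>\<^bsub>C\<^esub> g zt)"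
    "convolution L C f g zt = f za \<otimes>\<^bsub>C\<^esub> g zt \<oplus>\<^bsub>C\<^esub> f zt \<otimes>\<^bsub>C\<^esub> g za"
proof -
  have closed: "f za \<in> carrier C" "f zb \<in> carrier C" "f zt \<in> carrier C"
    "g za \<in> carrier C" "g zb \<in> carrier C" "g zt \<in> carrier C" "corner f \<in> carrier C" "corner g \<in> carrier C"
    using superalgebra_homD(5)[OF f] superalgebra_homD(5)[OF g] hom_coordinates(2)[OF f] hom_coordinates(2)[OF g]
    by (simp_all add: corner_def)
  have z: "f (z (i, j)) \<in> carrier C" "g (z (i, j)) \<in> carrier C" if "i < 4" "j < 4" for i j
    using superalgebra_homD(5)[OF f] superalgebra_homD(5)[OF g] z_closed that by simp_all
  have "convolution L C f g (z (0, j)) =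
      f (z (0, 3)) \<otimes>\<^bsub>C\<^esub> g (z (3, j)) \<oplus>\<^bsub>C\<^esub> (f (z (0, 2)) \<otimes>\<^bsub>C\<^esub> g (z (2, j)) \<oplus>\<^bsub>C\<^esub>
        (f (z (0, 1)) \<otimes>\<^bsub>C\<^esub> g (z (1, j)) \<oplus>\<^bsub>C\<^esub> f (z (0, 0)) \<otimes>\<^bsub>C\<^esub> g (z (0, j))))" if "j < 4" for j
    using hom_mult[OF C f g _ that, of 0] z that by (simp add: sum_4)
  from this[of 0] this[of 1] this[of 2]
  show "convolution L C f g za = f za \<otimes>\<^bsub>C\<^esub> g za \<oplus>\<^bsub>C\<^esub> f zt \<otimes>\<^bsub>C\<^esub> g zt"
    "convolution L C f g zb = f za \<otimes>\<^bsub>C\<^esub> g zb \<oplus>\<^bsub>C\<^esub> f zb \<otimes>\<^bsub>C\<^esub> g za \<oplus>\<^bsub>C\<^esub>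
      (f zt \<otimes>\<^bsub>C\<^esub> corner g \<oplus>\<^bsub>C\<^esub> corner f \<otimes>\<^bsub>C\<^esub> g zt)"
    "convolution L C f g zt = f za \<otimes>\<^bsub>C\<^esub> g zt \<oplus>\<^bsub>C\<^esub> f zt \<otimes>\<^bsub>C\<^esub> g za"
    using closed
    by (simp_all add: hom_coordinates(5)[OF f] hom_coordinates(5)[OF g] L_matrix_def Let_def
        corner_def[symmetric] za_def[symmetric] zb_def[symmetric, unfolded One_nat_def] zt_def[symmetric] C.a_ac)
qed

lemma corner_eq:
  assumes "superalgebra_hom L C f" "f zb \<otimes>\<^bsub>C\<^esub> f zt = \<zero>\<^bsub>C\<^esub>"
  shows "corner f = f zt"
  unfolding corner_def using assms hom_coordinates(2)[OF assms(1)] superalgebra_homD(5)[OF assms(1)]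
  by (intro C.unipotent_correction) auto

end

end

lemma bit_not_eq: "(k :: bit) \<noteq> i \<Longrightarrow> k = i + 1"
  by (cases k; cases i) simp_all

section \<open>The Lie superalgebra of L\<close>

context hopf_superalgebra
begin

lemma Lie_linear: "f \<in> Lie H \<Longrightarrow> linear_map H ground f"
  by (simp add: Lie_def dual_def)

lemma Lie_outside: "f \<in> Lie H \<Longrightarrow> x \<notin> carrier H \<Longrightarrow> f x = 0"
  by (simp add: Lie_def dual_def)

lemma Lie_one: "f \<in> Lie H \<Longrightarrow> f \<one> = 0"
  by (simp add: Lie_def)

text \<open>Subtracting their counits moves \<open>x\<close> and \<open>y\<close> into the
  augmentation ideal; expanding the product there, on which \<open>f\<close> vanishes, gives the
  Leibniz rule.\<close>

lemma Lie_mult: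
  assumes f: "f \<in> Lie H" and x: "x \<in> carrier H" and y: "y \<in> carrier H"
  shows "f (x \<otimes> y) = f x * counit H y + counit H x * f y"
proof -
  note lin = linear_mapD[OF Lie_linear[OF f]]
  let ?x = "x \<oplus> (- counit H x) \<odot> \<one>" and ?y = "y \<oplus> (- counit H y) \<odot> \<one>"
  have "?x \<in> aug_ideal H" "?y \<in> aug_ideal H"
    using x y by (simp_all add: aug_ideal_def counit_simps)
  then have "f (?x \<otimes> ?y) = 0" using f by (simp add: Lie_def)
  moreover have "?x \<otimes> ?y = (x \<otimes> y \<oplus> (- counit H y) \<odot> x) \<oplus>
      ((- counit H x) \<odot> y \<oplus> (counit H x * counit H y) \<odot> \<one>)"
    using x y by (simp add: l_distr r_distr smult_mult_left smult_mult_right smult_smult a_ac smult_add_right mult.commute)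
  ultimately show ?thesis
    using x y by (simp add: lin(2,3) Lie_one[OF f]) (simp add: algebra_simps)
qed

lemma LieI:
  assumes "linear_map H ground f" "\<And>x. x \<notin> carrier H \<Longrightarrow> f x = 0" "f \<one> = 0"
    "\<And>x y. x \<in> carrier H \<Longrightarrow> y \<in> carrier H \<Longrightarrow> f (x \<otimes> y) = f x * counit H y + counit H x * f y"
  shows "f \<in> Lie H"
  using assms by (auto simp: Lie_def dual_def aug_ideal_def)

lemma Lie_zero: "(\<lambda>x. 0) \<in> Lie H"
  by (rule LieI) (simp_all add: linear_map_def)

lemma Lie_add: "f \<in> Lie H \<Longrightarrow> g \<in> Lie H \<Longrightarrow> (\<lambda>x. f x + g x) \<in> Lie H"
  by (rule LieI) (auto simp: Lie_outside Lie_one Lie_mult linear_map_def linear_mapD(2,3)[OF Lie_linear]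
      algebra_simps)

lemma Lie_scale: "f \<in> Lie H \<Longrightarrow> (\<lambda>x. r * f x) \<in> Lie H"
  by (rule LieI) (auto simp: Lie_outside Lie_one Lie_mult linear_map_def linear_mapD(2,3)[OF Lie_linear]
      algebra_simps)

definition Lie_part :: "bit \<Rightarrow> ('a \<Rightarrow> 'k) set" where
  "Lie_part i = {f \<in> Lie H. \<forall>x\<in>part H (i + 1). f x = 0}"

lemma Lie_partD:
  assumes "f \<in> Lie_part i"
  shows "f \<in> Lie H" "x \<in> part H k \<Longrightarrow> f x \<noteq> 0 \<Longrightarrow> k = i"
  using assms bit_not_eq[of k i] by (auto simp: Lie_part_def)

lemma component_mult:
  assumes x: "x \<in> carrier H" and y: "y \<in> carrier H"
  shows "component H i (x \<otimes> y) =
    component H 0 x \<otimes> component H i y \<oplus> component H 1 x \<otimes> component H (i + 1) y"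
proof (rule component_eqI)
  have parts: "component H j x \<otimes> component H k y \<in> part H (j + k)" for j k
    using x y by (intro mult_part) auto
  show "component H 0 x \<otimes> component H i y \<oplus> component H 1 x \<otimes> component H (i + 1) y \<in> part H i"
    using parts[of 0 i] parts[of 1 "i + 1"] bit_add_one_one[of i] by (simp add: add.assoc add.left_commute)
  show "component H 0 x \<otimes> component H (i + 1) y \<oplus> component H 1 x \<otimes> component H i y \<in> part H (i + 1)"
    using parts[of 0 "i + 1"] parts[of 1 i] by (simp add: add.commute)
  have "x \<otimes> y = (component H 0 x \<oplus> component H 1 x) \<otimes> (component H i y \<oplus> component H (i + 1) y)"
    using component_sum[OF x, of 0] component_sum[OF y, of i] by simp
  then show "x \<otimes> y =
      (component H 0 x \<otimes> component H i y \<oplus> component H 1 x \<otimes> component H (i + 1) y) \<oplus>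
      (component H 0 x \<otimes> component H (i + 1) y \<oplus> component H 1 x \<otimes> component H i y)"
    using x y by (simp add: l_distr r_distr a_ac)
qed

text \<open>The counit kills odd elements, so the augmentation ideal is stable under taking
  components.\<close>

lemma Lie_dual_component:
  assumes f: "f \<in> Lie H"
  shows "dual_component H i f \<in> Lie_part i"
proof -
  note lin = linear_mapD[OF Lie_linear[OF f]]
  have f0: "f \<zero> = 0" using functional_zero[OF is_superalgebra Lie_linear[OF f]] .
  have aug: "component H j x \<in> aug_ideal H" if "x \<in> aug_ideal H" for j x
  proof -
    have x: "x \<in> carrier H" "counit H x = 0" using that by (auto simp: aug_ideal_def)
    have 1: "counit H (component H 1 x) = 0" using x by (intro counit_simps(5)) simp
    have "counit H (component H 0 x \<oplus> component H 1 x) = 0"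
      using component_sum[OF x(1), of 0] x(2) by simp
    then have "counit H (component H 0 x) = 0"
      using 1 x by (simp add: counit_simps)
    with 1 x bit_exhaust[of j] show ?thesis by (auto simp: aug_ideal_def)
  qed
  have "dual_component H i f \<in> Lie H"
    unfolding Lie_def
  proof (intro CollectI conjI ballI)
    show "dual_component H i f \<in> dual H"
      using f by (intro dual_component_dual) (simp add: Lie_def)
    show "dual_component H i f \<one> = 0"
      using Lie_one[OF f] component_other[OF one_part, of i] component_same[OF one_part] f0
      by (cases "i = 0") (simp_all add: dual_component_def)
    fix x y assume xy: "x \<in> aug_ideal H" "y \<in> aug_ideal H"
    then have c: "x \<in> carrier H" "y \<in> carrier H" by (auto simp: aug_ideal_def)
    have "f (component H j x \<otimes> component H k y) = 0" for j k
      using f aug[OF xy(1)] aug[OF xy(2)] by (simp add: Lie_def)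
    then show "dual_component H i f (x \<otimes> y) = 0"
      using c by (simp add: dual_component_def component_mult lin(2))
  qed
  moreover have "dual_component H i f x = 0" if x: "x \<in> part H (i + 1)" for x
  proof -
    have "i \<noteq> i + 1" by (cases i) simp_all
    with component_other[OF x this] part_carrier[OF x] f0 show ?thesis
      by (simp add: dual_component_def)
  qed
  ultimately show ?thesis by (simp add: Lie_part_def)
qed

lemma dual_component_Lie_part:
  assumes "f \<in> Lie_part i"
  shows "dual_component H j f = (if j = i then f else (\<lambda>x. 0))"
proof -
  have f: "f \<in> Lie H" using Lie_partD(1)[OF assms] .
  note lin = linear_mapD[OF Lie_linear[OF f]]
  have "dual_component H j f x = (if j = i then f x else 0)" for x
  proof (cases "x \<in> carrier H")
    case True
    have "f (component H k x) = 0" if "k \<noteq> i" for k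
      using Lie_partD(2)[OF assms component_part[OF True, of k]] that by blast
    moreover have "f x = f (component H i x) + f (component H (i + 1) x)"
      using component_sum[OF True, of i] lin(2)[of "component H i x" "component H (i + 1) x"] True by simp
    moreover have "i + 1 \<noteq> i" by (cases i) simp_all
    ultimately show ?thesis using True by (auto simp: dual_component_def)
  qed (simp add: dual_component_def Lie_outside[OF f])
  then show ?thesis by auto
qed

end

section \<open>Tangent vectors and brackets of L computed over the test algebras\<close>

context L_points
begin

lemmas Q_alg = Q_supercommutative_superalgebra

lemma L_hopf: "hopf_superalgebra L"
  by (rule L.hopf_superalgebra_axioms)

text \<open>These are the infinitesimal points at the identity in direction \<open>f\<close>, along
  \<epsilon>, \<eta> and \<epsilon>\<eta> respectively. They turn questions about
  \<open>Lie L\<close> into questions about points.\<close>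

definition pt1 where "pt1 f = (\<lambda>x. enc (fps_const (counit L x), fps_const (f x), 0, 0))"
definition pt2 where "pt2 f = (\<lambda>x. enc (fps_const (counit L x), 0, fps_const (f x), 0))"
definition pt3 where "pt3 f = (\<lambda>x. enc (fps_const (counit L x), 0, 0, fps_const (f x)))"

lemma counit_parity: "x \<in> part L k \<Longrightarrow> counit L x \<noteq> 0 \<Longrightarrow> k = 0"
  using L.counit_simps(5)[of x] bit_exhaust[of k] by auto

lemma pt_hom:
  "f \<in> L.Lie_part i \<Longrightarrow> superalgebra_hom L (Q i j) (pt1 f)"
  "f \<in> L.Lie_part j \<Longrightarrow> superalgebra_hom L (Q i j) (pt2 f)"
  "f \<in> L.Lie_part (i + j) \<Longrightarrow> superalgebra_hom L (Q i j) (pt3 f)"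
  unfolding pt1_def pt2_def pt3_def
  by (rule Q_homI;
      use linear_mapD[OF L.Lie_linear[OF L.Lie_partD(1)]] L.Lie_partD(2) counit_parity L.part_carrier
        L.Lie_one[OF L.Lie_partD(1)] L.Lie_mult[OF L.Lie_partD(1)] in
      \<open>auto simp: L.counit_simps fps_const_add[symmetric] fps_const_mult[symmetric] algebra_simps
        simp del: fps_const_add fps_const_mult\<close>)+

lemma convolution_Q:
  assumes f: "superalgebra_hom L (Q i j) f" "f zb \<otimes>\<^bsub>Q i j\<^esub> f zt = \<zero>\<^bsub>Q i j\<^esub>"
    and g: "superalgebra_hom L (Q i j) g" "g zb \<otimes>\<^bsub>Q i j\<^esub> g zt = \<zero>\<^bsub>Q i j\<^esub>"
  shows "convolution L (Q i j) f g za = f za \<otimes>\<^bsub>Q i j\<^esub> g za \<oplus>\<^bsub>Q i j\<^esub> f zt \<otimes>\<^bsub>Q i j\<^esub> g zt"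
    "convolution L (Q i j) f g zb = f za \<otimes>\<^bsub>Q i j\<^esub> g zb \<oplus>\<^bsub>Q i j\<^esub> f zb \<otimes>\<^bsub>Q i j\<^esub> g za \<oplus>\<^bsub>Q i j\<^esub>
      (f zt \<otimes>\<^bsub>Q i j\<^esub> g zt \<oplus>\<^bsub>Q i j\<^esub> f zt \<otimes>\<^bsub>Q i j\<^esub> g zt)"
    "convolution L (Q i j) f g zt = f za \<otimes>\<^bsub>Q i j\<^esub> g zt \<oplus>\<^bsub>Q i j\<^esub> f zt \<otimes>\<^bsub>Q i j\<^esub> g za"
  using convolution_coordinates[OF Q_alg f(1) g(1)] corner_eq[OF Q_alg f] corner_eq[OF Q_alg g]
  by simp_all

lemma convolution_Q_hom:
  assumes "superalgebra_hom L (Q i j) f" "superalgebra_hom L (Q i j) g"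
  shows "superalgebra_hom L (Q i j) (convolution L (Q i j) f g)"
  by (rule convolution_hom[OF L_hopf Q_alg assms])

lemma convolution_cf:
  assumes "superalgebra_hom L (Q i j) f" "superalgebra_hom L (Q i j) g" "x \<in> carrier L"
  shows "fps_nth (cf0 (convolution L (Q i j) f g x)) n =
      comult L x (\<lambda>a b. fps_nth (cf0 (f a \<otimes>\<^bsub>Q i j\<^esub> g b)) n)"
    "fps_nth (cf1 (convolution L (Q i j) f g x)) n =
      comult L x (\<lambda>a b. fps_nth (cf1 (f a \<otimes>\<^bsub>Q i j\<^esub> g b)) n)"
    "fps_nth (cf2 (convolution L (Q i j) f g x)) n =
      comult L x (\<lambda>a b. fps_nth (cf2 (f a \<otimes>\<^bsub>Q i j\<^esub> g b)) n)"
    "fps_nth (cf3 (convolution L (Q i j) f g x)) n =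
      comult L x (\<lambda>a b. fps_nth (cf3 (f a \<otimes>\<^bsub>Q i j\<^esub> g b)) n)"
  by (rule convolution_functional[OF L_hopf Q_alg superalgebra_homD(1)[OF assms(1)]
        superalgebra_homD(1)[OF assms(2)] assms(3) linear_cf(1)]
      convolution_functional[OF L_hopf Q_alg superalgebra_homD(1)[OF assms(1)]
        superalgebra_homD(1)[OF assms(2)] assms(3) linear_cf(2)]
      convolution_functional[OF L_hopf Q_alg superalgebra_homD(1)[OF assms(1)]
        superalgebra_homD(1)[OF assms(2)] assms(3) linear_cf(3)]
      convolution_functional[OF L_hopf Q_alg superalgebra_homD(1)[OF assms(1)]
        superalgebra_homD(1)[OF assms(2)] assms(3) linear_cf(4)])+

text \<open>The counit is an idempotent point. Its \<alpha> is a unit with square \<alpha>, so it is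
  1; its \<beta> equals 2\<beta>, so it is 0; and t is 0 by parity.\<close>

lemma counit_coordinates [simp]: "counit L za = 1" "counit L zb = 0" "counit L zt = 0"
proof -
  let ?Q = "Q 1 1" and ?e = "pt1 (\<lambda>x. 0)"
  have e: "superalgebra_hom L ?Q ?e"
    by (rule pt_hom(1)) (simp add: L.Lie_part_def L.Lie_zero)
  note form = hom_coordinates[OF Q_alg e]
  show t: "counit L zt = 0"
    using form(4) by (auto simp: pt1_def)
  have "?e zb \<otimes>\<^bsub>?Q\<^esub> ?e zt = \<zero>\<^bsub>?Q\<^esub>" by (simp add: pt1_def t)
  note conv = convolution_Q[OF e this e this]
  have idem: "fps_nth (cf0 (convolution L ?Q ?e ?e x)) 0 = counit L x" if x: "x \<in> carrier L" for x
    using convolution_cf(1)[OF e e x, of 0] L.counit_star[OF L.linear_counit x]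
    by (simp add: pt1_def L.star_def)
  obtain y where "y \<in> carrier ?Q" "y \<otimes>\<^bsub>?Q\<^esub> ?e za = \<one>\<^bsub>?Q\<^esub>"
    using form(2) by (auto simp: Units_def)
  then have "counit L za \<noteq> 0"
    by (elim Q_carrierE) (auto simp: pt1_def)
  then show a: "counit L za = 1"
    using idem[of za] conv(1) by (simp add: pt1_def t)
  show "counit L zb = 0"
    using idem[of zb] conv(2) by (simp add: pt1_def t a)
qed

text \<open>A point is determined by its three coordinates, and \<open>pt1\<close> makes a tangent
  vector part of a point.\<close>

lemma Lie_determined:
  assumes f: "f \<in> L.Lie_part i" and g: "g \<in> L.Lie_part i"
    and eq: "f za = g za" "f zb = g zb" "f zt = g zt"
  shows "f = g"
proof
  fix x
  show "f x = g x"
  proof (cases "x \<in> carrier L")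
    case True
    have "pt1 f x = pt1 g x"
      by (rule hom_eqI[OF Q_alg pt_hom(1)[OF f, of 0] pt_hom(1)[OF g, of 0] _ _ _ True])
        (simp_all add: pt1_def eq)
    then show ?thesis by (simp add: pt1_def)
  next
    case False
    then show ?thesis
      using L.Lie_outside[OF L.Lie_partD(1)[OF f]] L.Lie_outside[OF L.Lie_partD(1)[OF g]] by simp
  qed
qed

lemma Lie_part_coordinates:
  assumes "f \<in> L.Lie_part i"
  shows "f za \<noteq> 0 \<Longrightarrow> i = 0" "f zb \<noteq> 0 \<Longrightarrow> i = 0" "f zt \<noteq> 0 \<Longrightarrow> i = 1"
  using hom_coordinates(1,3,4)[OF Q_alg pt_hom(1)[OF assms, of 0]] by (auto simp: pt1_def)

text \<open>The supercommutator for the unsigned product \<open>star\<close>. By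
  \<open>Lie_bracket_star\<close> it gives the bracket of homogeneous vectors up to
  \<open>ksign i j\<close>.\<close>

definition lbr :: "bit \<Rightarrow> bit \<Rightarrow> ('c \<Rightarrow> 'k) \<Rightarrow> ('c \<Rightarrow> 'k) \<Rightarrow> 'c \<Rightarrow> 'k" where
  "lbr i j f g x = (if x \<in> carrier L then L.star f g x - ksign i j * L.star g f x else 0)"

text \<open>The two products of the points \<open>1 + f\<epsilon>\<close> and
  \<open>1 + g\<eta>\<close> differ only in the coefficient of \<epsilon>\<eta>, and the difference
  is the bracket. Matrix multiplication then yields its coordinates. Unless both vectors are odd the
  factor \<open>1 - ksign i j\<close> is 0.\<close>

lemma lbr:
  assumes f: "f \<in> L.Lie_part i" and g: "g \<in> L.Lie_part j"
  shows "lbr i j f g \<in> L.Lie_part (i + j)"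
    and "lbr i j f g za = (1 - ksign i j) * (f za * g za + f zt * g zt)"
    and "lbr i j f g zb = (1 - ksign i j) * (f za * g zb + f zb * g za + 2 * (f zt * g zt))"
    and "lbr i j f g zt = (1 - ksign i j) * (f za * g zt + f zt * g za)"
proof -
  define F where "F = convolution L (Q i j) (pt1 f) (pt2 g)"
  define G where "G = convolution L (Q i j) (pt2 g) (pt1 f)"
  note p = pt_hom(1)[OF f, of j] pt_hom(2)[OF g, of i]
  have F: "superalgebra_hom L (Q i j) F" and G: "superalgebra_hom L (Q i j) G"
    unfolding F_def G_def by (intro convolution_Q_hom p)+
  note linf = L.Lie_linear[OF L.Lie_partD(1)[OF f]] and ling = L.Lie_linear[OF L.Lie_partD(1)[OF g]]
  have Fc: "fps_nth (cf0 (F x)) 0 = counit L x" "fps_nth (cf1 (F x)) 0 = f x"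
    "fps_nth (cf2 (F x)) 0 = g x" "fps_nth (cf3 (F x)) 0 = L.star f g x" if x: "x \<in> carrier L" for x
    using convolution_cf[OF p x, of 0] L.counit_star[OF L.linear_counit x]
      L.counit_star[OF ling x] L.star_counit[OF linf x]
    by (simp_all add: F_def pt1_def pt2_def L.star_def)
  \<comment> \<open>In \<open>G\<close> the \<eta>-factor stands to the left of the
    \<epsilon>-factor, hence the sign in the coefficient of \<epsilon>\<eta>.\<close>
  have Gc: "fps_nth (cf0 (G x)) 0 = counit L x" "fps_nth (cf1 (G x)) 0 = f x"
    "fps_nth (cf2 (G x)) 0 = g x" "fps_nth (cf3 (G x)) 0 = ksign i j * L.star g f x"
    if x: "x \<in> carrier L" for x
    using convolution_cf[OF p(2,1) x, of 0] L.counit_star[OF L.linear_counit x]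
      L.counit_star[OF linf x] L.star_counit[OF ling x]
      tensor_scale[OF L.comult_closed[OF x] bilinear_form_product[OF ling linf], of "ksign i j"]
    by (simp_all add: G_def pt1_def pt2_def L.star_def mult.assoc)
  have br: "lbr i j f g x = fps_nth (cf3 (F x)) 0 - fps_nth (cf3 (G x)) 0" if "x \<in> carrier L" for x
    using that by (simp add: lbr_def Fc Gc)
  have "lbr i j f g \<in> Lie L"
  proof (rule L.LieI)
    show "linear_map L ground (lbr i j f g)"
      by (simp add: linear_map_def lbr_def linear_mapD(2,3)[OF L.linear_star] algebra_simps)
    show "lbr i j f g \<one>\<^bsub>L\<^esub> = 0"
      using Q_hom_cf(8)[OF F] Q_hom_cf(8)[OF G] by (simp add: br)
    \<comment> \<open>\<open>F\<close> and \<open>G\<close> have equal constant terms in the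
      coefficients of 1, \<epsilon> and \<eta>, so the cross terms of the product rule cancel in the
      difference.\<close>
    show "lbr i j f g (x \<otimes>\<^bsub>L\<^esub> y) = lbr i j f g x * counit L y + counit L x * lbr i j f g y"
      if "x \<in> carrier L" "y \<in> carrier L" for x y
      using that by (simp add: br Q_hom_cf(5)[OF F] Q_hom_cf(5)[OF G] Fc(1-3) Gc(1-3) algebra_simps)
  qed (simp add: lbr_def)
  moreover have "lbr i j f g x = 0" if x: "x \<in> part L (i + j + 1)" for x
  proof -
    have "i + j + 1 \<noteq> i + j" by (cases i; cases j) simp_all
    with Q_hom_cf(2)[OF F x] Q_hom_cf(2)[OF G x] show ?thesis
      using L.part_carrier[OF x] by (simp add: br)
  qed
  ultimately show "lbr i j f g \<in> L.Lie_part (i + j)" by (simp add: L.Lie_part_def)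
  have "pt1 f zb \<otimes>\<^bsub>Q i j\<^esub> pt1 f zt = \<zero>\<^bsub>Q i j\<^esub>" "pt2 g zb \<otimes>\<^bsub>Q i j\<^esub> pt2 g zt = \<zero>\<^bsub>Q i j\<^esub>"
    by (simp_all add: pt1_def pt2_def)
  note co = convolution_Q[OF p(1) this(1) p(2) this(2)] convolution_Q[OF p(2) this(2) p(1) this(1)]
  show "lbr i j f g za = (1 - ksign i j) * (f za * g za + f zt * g zt)"
    "lbr i j f g zb = (1 - ksign i j) * (f za * g zb + f zb * g za + 2 * (f zt * g zt))"
    "lbr i j f g zt = (1 - ksign i j) * (f za * g zt + f zt * g za)"
    by (simp_all add: br F_def G_def co) (simp_all add: pt1_def pt2_def algebra_simps)
qed

text \<open>Setting u, \<epsilon> and \<eta> to 0 in a point gives a scalar-valued point. Its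
  coordinate t is 0 by parity, so the two hypotheses give it the coordinates of the
  identity.\<close>

lemma hom_counit:
  assumes F: "superalgebra_hom L (Q i j) F" and a: "fps_nth (cf0 (F za)) 0 = 1"
    and b: "fps_nth (cf0 (F zb)) 0 = 0" and x: "x \<in> carrier L"
  shows "fps_nth (cf0 (F x)) 0 = counit L x"
proof -
  let ?G = "\<lambda>x. enc (fps_const (fps_nth (cf0 (F x)) 0), 0, 0, 0)"
  have parity: "k = 0" if "x \<in> part L k" "fps_nth (cf0 (F x)) 0 \<noteq> 0" for x k
    using Q_hom_cf(2)[OF F that(1)] that(2) by auto
  have G: "superalgebra_hom L (Q i j) ?G"
    by (rule Q_homI)
      (use Q_hom_cf(3,6,7,8)[OF F] parity L.part_carrier in \<open>auto simp: fps_const_add[symmetric] fps_const_mult[symmetric]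
        simp del: fps_const_add fps_const_mult\<close>)
  have e: "superalgebra_hom L (Q i j) (pt1 (\<lambda>x. 0))"
    by (rule pt_hom(1)) (simp add: L.Lie_part_def L.Lie_zero)
  have t: "cf0 (F zt) = 0"
    using hom_coordinates(4)[OF Q_alg F] by (elim Q_partE) auto
  have "?G x = pt1 (\<lambda>x. 0) x"
    by (rule hom_eqI[OF Q_alg G e _ _ _ x]) (simp_all add: pt1_def a b t)
  then show ?thesis by (simp add: pt1_def)
qed

text \<open>The vector is the \<epsilon>-coefficient of the point with coordinates
  \<open>(1, 0, \<epsilon>)\<close>, whose base point is the identity by
  \<open>hom_counit\<close>.\<close>

lemma odd_generator: "\<exists>f\<in>L.Lie_part 1. f za = 0 \<and> f zb = 0 \<and> f zt = 1"
proof -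
  have "enc (1, 0, 0, 0) \<in> Units (Q 1 1)" using Q.Units_one_closed[of 1 1] by simp
  then obtain F where F: "superalgebra_hom L (Q 1 1) F" "F za = enc (1, 0, 0, 0)" "F zb = enc (0, 0, 0, 0)"
    "F zt = enc (0, 1, 0, 0)"
    using hom_exists_coordinates[OF Q_alg, of "enc (1, 0, 0, 0)" 1 1 "enc (0, 0, 0, 0)" "enc (0, 1, 0, 0)"]
    by auto
  have e: "fps_nth (cf0 (F x)) 0 = counit L x" if "x \<in> carrier L" for x
    by (rule hom_counit[OF F(1) _ _ that]) (simp_all add: F)
  define f where "f = (\<lambda>x. if x \<in> carrier L then fps_nth (cf1 (F x)) 0 else 0)"
  have "f \<in> Lie L"
  proof (rule L.LieI)
    show "linear_map L ground f"
      using linear_map_comp[OF superalgebra_homD(1)[OF F(1)] linear_cf(2)[of _ _ 0]]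
      by (auto simp: linear_map_def f_def)
    show "f \<one>\<^bsub>L\<^esub> = 0" by (simp add: f_def Q_hom_cf(8)[OF F(1)])
    show "f (x \<otimes>\<^bsub>L\<^esub> y) = f x * counit L y + counit L x * f y"
      if "x \<in> carrier L" "y \<in> carrier L" for x y
      using that by (simp add: f_def Q_hom_cf(4)[OF F(1)] e algebra_simps)
  qed (simp add: f_def)
  moreover have "f x = 0" if "x \<in> part L (1 + 1)" for x
    using Q_hom_cf(2)[OF F(1) that] by (auto simp: f_def)
  ultimately have "f \<in> L.Lie_part 1" by (simp add: L.Lie_part_def)
  then show ?thesis using F by (intro bexI[of _ f]) (simp_all add: f_def)
qed

text \<open>\<open>D\<close> spans the derived superalgebra; it is the tangent vector \<open>2 (\<alpha>\<^sub>1 \<partial>\<^sub>\<alpha>\<^sub>1 + 2 \<partial>\<^sub>\<alpha>\<^sub>2)\<close> at \<open>1\<close>.\<close>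

lemma even_generator:
  "\<exists>D. D \<in> L.Lie_part 0 \<and> D za = 2 \<and> D zb = 4 \<and> D zt = 0 \<and> Lie_derived L = {\<lambda>x. r * D x | r. True}"
proof -
  obtain f where f: "f \<in> L.Lie_part 1" "f za = 0" "f zb = 0" "f zt = 1"
    using odd_generator by blast
  define D where "D = lbr 1 1 f f"
  have D: "D \<in> L.Lie_part 0" "D za = 2" "D zb = 4" "D zt = 0"
    unfolding D_def using lbr[OF f(1) f(1)] f by simp_all
  note D_Lie = L.Lie_partD(1)[OF D(1)]
  have lbr_D: "\<exists>r. \<forall>x. lbr i j g h x = r * D x" if g: "g \<in> L.Lie_part i" and h: "h \<in> L.Lie_part j" for i j g h
  proof -
    define c where "c = lbr i j g h za"
    \<comment> \<open>An odd vector vanishes at \<open>za\<close> and \<open>zb\<close>, so an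
      odd-odd bracket has coordinates proportional to \<open>(1, 2, 0)\<close>; the remaining
      brackets are 0.\<close>
    have co: "lbr i j g h zb = 2 * c" "lbr i j g h zt = 0" "c \<noteq> 0 \<Longrightarrow> i + j = 0"
    proof -
      note co = lbr(2-4)[OF g h]
      have "(ksign i j :: 'k) = 1 \<or> i = 1 \<and> j = 1" by (auto simp: ksign_def)
      then have "lbr i j g h zb = 2 * c \<and> lbr i j g h zt = 0 \<and> (c \<noteq> 0 \<longrightarrow> i + j = 0)"
      proof (elim disjE conjE)
        assume "i = 1" "j = 1"
        with Lie_part_coordinates[OF g] Lie_part_coordinates[OF h]
        have "g za = 0" "g zb = 0" "h za = 0" "h zb = 0" by auto
        with co \<open>i = 1\<close> \<open>j = 1\<close> show ?thesis by (simp add: c_def)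
      qed (simp add: c_def co)
      then show "lbr i j g h zb = 2 * c" "lbr i j g h zt = 0" "c \<noteq> 0 \<Longrightarrow> i + j = 0" by auto
    qed
    \<comment> \<open>The divisor 2 is \<open>D za\<close>.\<close>
    have "lbr i j g h = (\<lambda>x. c / 2 * D x)"
    proof (rule Lie_determined[OF lbr(1)[OF g h]])
      show "(\<lambda>x. c / 2 * D x) \<in> L.Lie_part (i + j)"
        using L.Lie_scale[OF D_Lie, of "c / 2"] D(1) co(3) by (auto simp: L.Lie_part_def)
    qed (use D co c_def in auto)
    then show ?thesis by metis
  qed
  have bracket_outside: "Lie_bracket L g h x = 0" if "x \<notin> carrier L" for g h x
    using that by (simp add: Lie_bracket_def dual_convolution_def)
  have bracket_lbr: "Lie_bracket L g h x = (\<Sum>i\<in>{0, 1}. \<Sum>j\<in>{0, 1}. ksign i j *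
      lbr i j (dual_component L i g) (dual_component L j h) x)"
    if g: "g \<in> Lie L" and h: "h \<in> Lie L" for g h x
  proof (cases "x \<in> carrier L")
    case True
    then show ?thesis
      unfolding lbr_def L.Lie_bracket_star[OF L.Lie_linear[OF g] L.Lie_linear[OF h] True] by simp
  qed (simp add: bracket_outside lbr_def)
  have bracket_D: "\<exists>r. \<forall>x. Lie_bracket L g h x = r * D x" if g: "g \<in> Lie L" and h: "h \<in> Lie L" for g h
  proof -
    have "\<forall>i j. \<exists>r. \<forall>x. lbr i j (dual_component L i g) (dual_component L j h) x = r * D x"
      using lbr_D L.Lie_dual_component[OF g] L.Lie_dual_component[OF h] by blast
    then obtain r where "\<And>i j x. lbr i j (dual_component L i g) (dual_component L j h) x = r i j * D x"
      by metis
    then have "Lie_bracket L g h x = (\<Sum>i\<in>{0, 1}. \<Sum>j\<in>{0, 1}. ksign i j * r i j) * D x" for x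
      by (simp add: bracket_lbr[OF g h] algebra_simps)
    then show ?thesis by blast
  qed
  \<comment> \<open>The minus sign is \<open>ksign 1 1\<close>, from the passage between
    \<open>Lie_bracket\<close> and \<open>lbr\<close>.\<close>
  have Dff: "Lie_bracket L f f x = - D x" for x
  proof -
    note f_Lie = L.Lie_partD(1)[OF f(1)]
    have "lbr i j f (\<lambda>x. 0) x = 0" "lbr i j (\<lambda>x. 0) f x = 0" "lbr i j (\<lambda>x. 0) (\<lambda>x. 0) x = 0" for i j x
      using tensor_scale[OF L.comult_closed bilinear_form_product[OF L.Lie_linear[OF f_Lie] L.Lie_linear[OF f_Lie]], of x 0]
      by (simp_all add: lbr_def L.star_def)
    then show ?thesis
      by (simp add: bracket_lbr[OF f_Lie f_Lie] L.dual_component_Lie_part[OF f(1)] D_def)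
  qed
  have "Lie_derived L = {\<lambda>x. r * D x | r. True}"
  proof (intro subset_antisym subsetI)
    fix h assume "h \<in> Lie_derived L"
    then obtain n r g g' where h: "\<And>i. i < (n::nat) \<Longrightarrow> g i \<in> Lie L \<and> g' i \<in> Lie L"
      "h = (\<lambda>x. \<Sum>i<n. r i * Lie_bracket L (g i) (g' i) x)"
      unfolding Lie_derived_def by blast
    have "\<forall>i. \<exists>s. i < n \<longrightarrow> (\<forall>x. Lie_bracket L (g i) (g' i) x = s * D x)"
      using bracket_D h(1) by blast
    then obtain s where "\<And>i x. i < n \<Longrightarrow> Lie_bracket L (g i) (g' i) x = s i * D x" by metis
    then have "h = (\<lambda>x. (\<Sum>i<n. r i * s i) * D x)"
      by (simp add: h(2) sum_distrib_right mult.assoc)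
    then show "h \<in> {\<lambda>x. r * D x | r. True}" by blast
  next
    fix h assume "h \<in> {\<lambda>x. r * D x | r. True}"
    then obtain r where "h = (\<lambda>x. r * D x)" by blast
    then have "h = (\<lambda>x. \<Sum>i<1::nat. - r * Lie_bracket L f f x)"
      by (simp add: Dff)
    then show "h \<in> Lie_derived L"
      unfolding Lie_derived_def using L.Lie_partD(1)[OF f(1)]
      by (intro CollectI exI[of _ "1::nat"] exI[of _ "\<lambda>_. - r"] exI[of _ "\<lambda>_. f"]) simp
  qed
  with D show ?thesis by blast
qed

end

section \<open>Commutators\<close>

context L_points
begin

abbreviation (input) P where "P \<equiv> points L (Q 1 1)"

lemma points_simps:
  "F \<in> carrier P \<longleftrightarrow> F \<in> extensional (carrier L) \<and> superalgebra_hom L (Q 1 1) F"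
  "F \<otimes>\<^bsub>P\<^esub> G = restrict (convolution L (Q 1 1) F G) (carrier L)"
  "\<one>\<^bsub>P\<^esub> = restrict (\<lambda>x. enc (fps_const (counit L x), 0, 0, 0)) (carrier L)"
  by (simp_all add: points_def)

lemma superalgebra_hom_restrict:
  assumes "superalgebra_hom L C F"
  shows "superalgebra_hom L C (restrict F (carrier L))"
  by (rule superalgebra_homI)
    (use superalgebra_homD[OF assms] linear_mapD[OF superalgebra_homD(1)[OF assms]] L.part_carrier in auto)

lemma point_restrict: "superalgebra_hom L (Q 1 1) F \<Longrightarrow> restrict F (carrier L) \<in> carrier P"
  by (simp add: points_simps(1) superalgebra_hom_restrict)

lemma point_eqI:
  assumes "F \<in> carrier P" "G \<in> carrier P" "F za = G za" "F zb = G zb" "F zt = G zt"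
  shows "F = G"
  by (rule extensionalityI[of _ "carrier L"]) (use assms hom_eqI[OF Q_alg] points_simps(1) in auto)

lemma point_mult:
  assumes F: "F \<in> carrier P" "F zb \<otimes>\<^bsub>Q 1 1\<^esub> F zt = \<zero>\<^bsub>Q 1 1\<^esub>"
    and G: "G \<in> carrier P" "G zb \<otimes>\<^bsub>Q 1 1\<^esub> G zt = \<zero>\<^bsub>Q 1 1\<^esub>"
  shows "F \<otimes>\<^bsub>P\<^esub> G \<in> carrier P"
    "(F \<otimes>\<^bsub>P\<^esub> G) za = F za \<otimes>\<^bsub>Q 1 1\<^esub> G za \<oplus>\<^bsub>Q 1 1\<^esub> F zt \<otimes>\<^bsub>Q 1 1\<^esub> G zt"
    "(F \<otimes>\<^bsub>P\<^esub> G) zb = F za \<otimes>\<^bsub>Q 1 1\<^esub> G zb \<oplus>\<^bsub>Q 1 1\<^esub> F zb \<otimes>\<^bsub>Q 1 1\<^esub> G za \<oplus>\<^bsub>Q 1 1\<^esub>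
      (F zt \<otimes>\<^bsub>Q 1 1\<^esub> G zt \<oplus>\<^bsub>Q 1 1\<^esub> F zt \<otimes>\<^bsub>Q 1 1\<^esub> G zt)"
    "(F \<otimes>\<^bsub>P\<^esub> G) zt = F za \<otimes>\<^bsub>Q 1 1\<^esub> G zt \<oplus>\<^bsub>Q 1 1\<^esub> F zt \<otimes>\<^bsub>Q 1 1\<^esub> G za"
proof -
  have hom: "superalgebra_hom L (Q 1 1) F" "superalgebra_hom L (Q 1 1) G"
    using F G by (simp_all add: points_simps(1))
  show "F \<otimes>\<^bsub>P\<^esub> G \<in> carrier P"
    unfolding points_simps(2) by (intro point_restrict convolution_Q_hom hom)
  show "(F \<otimes>\<^bsub>P\<^esub> G) za = F za \<otimes>\<^bsub>Q 1 1\<^esub> G za \<oplus>\<^bsub>Q 1 1\<^esub> F zt \<otimes>\<^bsub>Q 1 1\<^esub> G zt"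
    "(F \<otimes>\<^bsub>P\<^esub> G) zb = F za \<otimes>\<^bsub>Q 1 1\<^esub> G zb \<oplus>\<^bsub>Q 1 1\<^esub> F zb \<otimes>\<^bsub>Q 1 1\<^esub> G za \<oplus>\<^bsub>Q 1 1\<^esub>
      (F zt \<otimes>\<^bsub>Q 1 1\<^esub> G zt \<oplus>\<^bsub>Q 1 1\<^esub> F zt \<otimes>\<^bsub>Q 1 1\<^esub> G zt)"
    "(F \<otimes>\<^bsub>P\<^esub> G) zt = F za \<otimes>\<^bsub>Q 1 1\<^esub> G zt \<oplus>\<^bsub>Q 1 1\<^esub> F zt \<otimes>\<^bsub>Q 1 1\<^esub> G za"
    using convolution_Q[OF hom(1) F(2) hom(2) G(2)] by (simp_all add: points_simps(2))
qed

lemma one_point: "\<one>\<^bsub>P\<^esub> \<in> carrier P"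
proof -
  have "superalgebra_hom L (Q 1 1) (pt1 (\<lambda>x. 0))"
    by (rule pt_hom(1)) (simp add: L.Lie_part_def L.Lie_zero)
  from point_restrict[OF this] show ?thesis by (simp add: points_simps(3) pt1_def)
qed

lemma odd_point_exists:
  assumes "s1 \<in> exp_poly_ring" "s2 \<in> exp_poly_ring"
  shows "\<exists>F\<in>carrier P. F za = enc (1, 0, 0, 0) \<and> F zb = enc (0, 0, 0, 0) \<and> F zt = enc (0, s1, s2, 0)"
proof -
  have "enc (1, 0, 0, 0) \<in> Units (Q 1 1)" using Q.Units_one_closed[of 1 1] by simp
  then obtain F where "superalgebra_hom L (Q 1 1) F" "F za = enc (1, 0, 0, 0)" "F zb = enc (0, 0, 0, 0)"
    "F zt = enc (0, s1, s2, 0)"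
    using hom_exists_coordinates[OF Q_alg, of "enc (1, 0, 0, 0)" 1 1 "enc (0, 0, 0, 0)" "enc (0, s1, s2, 0)"] assms
    by auto
  then show ?thesis
    by (intro bexI[of _ "restrict F (carrier L)"]) (simp_all add: point_restrict)
qed

text \<open>\<open>inv\<close> is a definite description, so besides checking that \<open>G\<close>
  inverts \<open>F\<close> the coordinates of any inverse \<open>Y\<close> have to be solved for.
  Odd elements with coefficients only at \<epsilon> and \<eta> square to 0, which removes the
  correction terms.\<close>

lemma odd_point_inv:
  assumes F: "F \<in> carrier P" "F za = enc (1, 0, 0, 0)" "F zb = enc (0, 0, 0, 0)" "F zt = enc (0, s1, s2, 0)"
    and G: "G \<in> carrier P" "G za = enc (1, 0, 0, 0)" "G zb = enc (0, 0, 0, 0)" "G zt = enc (0, - s1, - s2, 0)"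
  shows "inv\<^bsub>P\<^esub> F = G"
  unfolding m_inv_def
proof (rule the_equality)
  have F0: "F zb \<otimes>\<^bsub>Q 1 1\<^esub> F zt = \<zero>\<^bsub>Q 1 1\<^esub>" and G0: "G zb \<otimes>\<^bsub>Q 1 1\<^esub> G zt = \<zero>\<^bsub>Q 1 1\<^esub>"
    by (simp_all add: F G)
  note FG = point_mult[OF F(1) F0 G(1) G0] and GF = point_mult[OF G(1) G0 F(1) F0]
  have "F \<otimes>\<^bsub>P\<^esub> G = \<one>\<^bsub>P\<^esub>"
    by (rule point_eqI[OF FG(1) one_point]; unfold FG)
      (simp_all add: F G points_simps(3) fps_const_neg[symmetric] del: fps_const_neg)
  moreover have "G \<otimes>\<^bsub>P\<^esub> F = \<one>\<^bsub>P\<^esub>"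
    by (rule point_eqI[OF GF(1) one_point]; unfold GF)
      (simp_all add: F G points_simps(3) fps_const_neg[symmetric] del: fps_const_neg)
  ultimately show "G \<in> carrier P \<and> F \<otimes>\<^bsub>P\<^esub> G = \<one>\<^bsub>P\<^esub> \<and> G \<otimes>\<^bsub>P\<^esub> F = \<one>\<^bsub>P\<^esub>"
    using G(1) by blast
  fix Y assume "Y \<in> carrier P \<and> F \<otimes>\<^bsub>P\<^esub> Y = \<one>\<^bsub>P\<^esub> \<and> Y \<otimes>\<^bsub>P\<^esub> F = \<one>\<^bsub>P\<^esub>"
  then have Y: "Y \<in> carrier P" "F \<otimes>\<^bsub>P\<^esub> Y = \<one>\<^bsub>P\<^esub>" by auto
  have hom: "superalgebra_hom L (Q 1 1) F" "superalgebra_hom L (Q 1 1) Y"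
    using F Y by (simp_all add: points_simps(1))
  obtain a0 a3 where a: "Y za = enc (a0, 0, 0, a3)"
    using hom_coordinates(1)[OF Q_alg hom(2)] by (elim Q_partE) auto
  obtain b0 b3 where b: "Y zb = enc (b0, 0, 0, b3)"
    using hom_coordinates(3)[OF Q_alg hom(2)] by (elim Q_partE) auto
  obtain t1 t2 where t: "Y zt = enc (0, t1, t2, 0)"
    using hom_coordinates(4)[OF Q_alg hom(2)] by (elim Q_partE) auto
  have FY: "convolution L (Q 1 1) F Y x = enc (fps_const (counit L x), 0, 0, 0)" if "x \<in> carrier L" for x
    using fun_cong[OF Y(2), of x] that by (simp add: points_simps(2,3))
  note co = convolution_coordinates[OF Q_alg hom]
  have za: "a0 = 1" "a3 + (s1 * t2 - s2 * t1) = 0"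
    using FY[of za] co(1) by (simp_all add: F a t fps_const_neg[symmetric] del: fps_const_neg)
  moreover have zt: "t1 = - s1" "t2 = - s2"
    using FY[of zt] co(3) za(1) by (simp_all add: F a t eq_neg_iff_add_eq_0)
  moreover have "a3 = 0"
    using za(2) by (simp add: zt)
  moreover have "b0 = 0 \<and> b3 = 0"
  proof -
    have cF: "corner (Q 1 1) F = enc (0, s1, s2, 0)"
      using corner_eq[OF Q_alg hom(1) F0] by (simp add: F)
    have cY: "corner (Q 1 1) Y = enc (0, - ((1 + b0) * s1), - ((1 + b0) * s2), 0)"
      using Q.inv_one[of 1 1] by (simp add: corner_def[OF Q_alg] a b t \<open>a0 = 1\<close> \<open>a3 = 0\<close> \<open>t1 = - s1\<close> \<open>t2 = - s2\<close>)
    show ?thesis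
      using FY[of zb] co(2)
      by (simp add: F a b t cF cY \<open>t1 = - s1\<close> \<open>t2 = - s2\<close> fps_const_neg[symmetric] algebra_simps del: fps_const_neg)
  qed
  ultimately show "Y = G"
    by (intro point_eqI[OF Y(1) G(1)]) (simp_all add: G a b t)
qed

text \<open>The commutator of the points \<open>(1, 0, \<epsilon>)\<close> and \<open>(1, 0, \<eta>)\<close> is \<open>(1 + 2 \<epsilon> \<eta>, 4 \<epsilon> \<eta>, 0)\<close>.\<close>

lemma commutator_point:
  assumes D: "D \<in> L.Lie_part 0" "D za = 2" "D zb = 4" "D zt = 0"
  shows "restrict (pt3 D) (carrier L) \<in> derived P (carrier P)"
proof -
  obtain F where F: "F \<in> carrier P" "F za = enc (1, 0, 0, 0)" "F zb = enc (0, 0, 0, 0)" "F zt = enc (0, 1, 0, 0)"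
    using odd_point_exists[of 1 0] by auto
  obtain F' where F': "F' \<in> carrier P" "F' za = enc (1, 0, 0, 0)" "F' zb = enc (0, 0, 0, 0)" "F' zt = enc (0, - 1, 0, 0)"
    using odd_point_exists[of "- 1" 0] by auto
  obtain G where G: "G \<in> carrier P" "G za = enc (1, 0, 0, 0)" "G zb = enc (0, 0, 0, 0)" "G zt = enc (0, 0, 1, 0)"
    using odd_point_exists[of 0 1] by auto
  obtain G' where G': "G' \<in> carrier P" "G' za = enc (1, 0, 0, 0)" "G' zb = enc (0, 0, 0, 0)" "G' zt = enc (0, 0, - 1, 0)"
    using odd_point_exists[of 0 "- 1"] by auto
  have inv: "inv\<^bsub>P\<^esub> F = F'" "inv\<^bsub>P\<^esub> G = G'"
    by (rule odd_point_inv[OF F] odd_point_inv[OF G]; simp add: F' G')+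
  note simps = F G F' G' fps_const_neg[symmetric]
  let ?X = "F \<otimes>\<^bsub>P\<^esub> G" let ?Y = "?X \<otimes>\<^bsub>P\<^esub> F'" let ?Z = "?Y \<otimes>\<^bsub>P\<^esub> G'"
  have zero: "F zb \<otimes>\<^bsub>Q 1 1\<^esub> F zt = \<zero>\<^bsub>Q 1 1\<^esub>" "G zb \<otimes>\<^bsub>Q 1 1\<^esub> G zt = \<zero>\<^bsub>Q 1 1\<^esub>"
    "F' zb \<otimes>\<^bsub>Q 1 1\<^esub> F' zt = \<zero>\<^bsub>Q 1 1\<^esub>" "G' zb \<otimes>\<^bsub>Q 1 1\<^esub> G' zt = \<zero>\<^bsub>Q 1 1\<^esub>"
    by (simp_all add: simps)
  note X = point_mult[OF F(1) zero(1) G(1) zero(2)]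
  have Xc: "?X za = enc (1, 0, 0, 1)" "?X zb = enc (0, 0, 0, 2)" "?X zt = enc (0, 1, 1, 0)"
    unfolding X by (simp_all add: simps)
  have "?X zb \<otimes>\<^bsub>Q 1 1\<^esub> ?X zt = \<zero>\<^bsub>Q 1 1\<^esub>" by (simp add: Xc)
  note Y = point_mult[OF X(1) this F'(1) zero(3)]
  have Yc: "?Y za = enc (1, 0, 0, 2)" "?Y zb = enc (0, 0, 0, 4)" "?Y zt = enc (0, 0, 1, 0)"
    unfolding Y Xc by (simp_all add: simps del: fps_const_neg)
  have "?Y zb \<otimes>\<^bsub>Q 1 1\<^esub> ?Y zt = \<zero>\<^bsub>Q 1 1\<^esub>" by (simp add: Yc)
  note Z = point_mult[OF Y(1) this G'(1) zero(4)]
  have Zc: "?Z za = enc (1, 0, 0, 2)" "?Z zb = enc (0, 0, 0, 4)" "?Z zt = enc (0, 0, 0, 0)"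
    unfolding Z Yc by (simp_all add: simps del: fps_const_neg)
  have "superalgebra_hom L (Q 1 1) (pt3 D)"
    using pt_hom(3)[of D 1 1] D(1) by simp
  then have "restrict (pt3 D) (carrier L) = ?Z"
    by (intro point_eqI point_restrict Z(1)) (simp_all add: Zc pt3_def D numeral_fps_const)
  moreover have "?Z \<in> derived_set P (carrier P)"
    using F(1) G(1) by (auto simp flip: inv)
  ultimately show ?thesis
    unfolding derived_def by (simp add: generate.incl)
qed

section \<open>Closed supersubgroups containing all commutators\<close>

context
  fixes L' :: "('k, 'c) hopf_superalgebra" and q :: "'c \<Rightarrow> 'c"
  assumes sub: "closed_supersubgroup L L' q" and comm: "contains_commutators L L' q"
begin

interpretation L': supergroup L'
  using sub by (simp add: closed_supersubgroup_def)

lemma q_hopf_hom: "hopf_superalgebra_hom L L' q"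
  using sub by (simp add: closed_supersubgroup_def)

lemma q_hom: "superalgebra_hom L L' q"
  using q_hopf_hom by (simp add: hopf_superalgebra_hom_def)

lemma q_surj: "q ` carrier L = carrier L'"
  using sub by (simp add: closed_supersubgroup_def)

text \<open>These are the forms that descend along \<open>q\<close>. Tangency to the supersubgroup
  thus becomes a condition on forms on \<open>L\<close>.\<close>

definition vanishes :: "('c \<Rightarrow> 'k) \<Rightarrow> bool" where
  "vanishes f \<longleftrightarrow> (\<forall>x\<in>carrier L. q x = \<zero>\<^bsub>L'\<^esub> \<longrightarrow> f x = 0)"

lemma vanishes_factor:
  assumes f: "linear_map L ground f" and v: "vanishes f"
  shows "\<exists>g. linear_map L' ground g \<and> (\<forall>x\<in>carrier L. g (q x) = f x) \<and> (\<forall>y. y \<notin> carrier L' \<longrightarrow> g y = 0)"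
proof -
  note qlin = linear_mapD[OF superalgebra_homD(1)[OF q_hom]]
  define g where "g = (\<lambda>y. if y \<in> carrier L' then f (SOME x. x \<in> carrier L \<and> q x = y) else 0)"
  have eq: "f x = f x'" if "x \<in> carrier L" "x' \<in> carrier L" "q x = q x'" for x x'
  proof -
    have "q (x \<oplus>\<^bsub>L\<^esub> (- 1) \<odot>\<^bsub>L\<^esub> x') = q x \<oplus>\<^bsub>L'\<^esub> \<ominus>\<^bsub>L'\<^esub> q x"
      using that qlin by (simp add: L'.smult_minus_one)
    also have "\<dots> = \<zero>\<^bsub>L'\<^esub>"
      using that qlin(1) by (simp add: L'.r_neg)
    finally have "f (x \<oplus>\<^bsub>L\<^esub> (- 1) \<odot>\<^bsub>L\<^esub> x') = 0"
      using v that by (simp add: vanishes_def)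
    then show ?thesis using that by (simp add: linear_mapD(2,3)[OF f])
  qed
  have g: "g (q x) = f x" if x: "x \<in> carrier L" for x
  proof -
    have "(SOME x'. x' \<in> carrier L \<and> q x' = q x) \<in> carrier L \<and> q (SOME x'. x' \<in> carrier L \<and> q x' = q x) = q x"
      using x by (intro someI[of "\<lambda>x'. x' \<in> carrier L \<and> q x' = q x"]) auto
    then have "f (SOME x'. x' \<in> carrier L \<and> q x' = q x) = f x"
      using eq x by blast
    then show ?thesis using qlin(1)[OF x] by (simp add: g_def)
  qed
  have "linear_map L' ground g"
    unfolding linear_map_def
  proof (intro conjI ballI allI)
    fix y y' assume "y \<in> carrier L'" "y' \<in> carrier L'"
    then obtain x x' where x: "x \<in> carrier L" "x' \<in> carrier L" "y = q x" "y' = q x'"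
      using q_surj by blast
    then have "y \<oplus>\<^bsub>L'\<^esub> y' = q (x \<oplus>\<^bsub>L\<^esub> x')" using qlin(2) by simp
    then show "g (y \<oplus>\<^bsub>L'\<^esub> y') = g y \<oplus>\<^bsub>ground\<^esub> g y'"
      using x by (simp add: g linear_mapD(2)[OF f])
  next
    fix r y assume "y \<in> carrier L'"
    then obtain x where x: "x \<in> carrier L" "y = q x" using q_surj by blast
    then have "r \<odot>\<^bsub>L'\<^esub> y = q (r \<odot>\<^bsub>L\<^esub> x)" using qlin(3) by simp
    then show "g (r \<odot>\<^bsub>L'\<^esub> y) = r \<odot>\<^bsub>ground\<^esub> g y"
      using x by (simp add: g linear_mapD(3)[OF f])
  qed simp
  with g show ?thesis by (intro exI[of _ g]) (simp add: g_def)
qed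

text \<open>This holds because the kernel of \<open>q\<close> is a coideal.\<close>

lemma vanishes_star:
  assumes f: "linear_map L ground f" "vanishes f" and g: "linear_map L ground g" "vanishes g"
  shows "vanishes (L.star f g)"
  unfolding vanishes_def
proof (intro ballI impI)
  fix x assume x: "x \<in> carrier L" "q x = \<zero>\<^bsub>L'\<^esub>"
  obtain f' where f': "linear_map L' ground f'" "\<And>x. x \<in> carrier L \<Longrightarrow> f' (q x) = f x"
    using vanishes_factor[OF f] by blast
  obtain g' where g': "linear_map L' ground g'" "\<And>x. x \<in> carrier L \<Longrightarrow> g' (q x) = g x"
    using vanishes_factor[OF g] by blast
  have "L.star f g x = comult L x (\<lambda>a b. f' (q a) * g' (q b))"
    unfolding L.star_def
    by (rule tensor_cong[OF L.is_superalgebra L.is_superalgebra L.comult_closed[OF x(1)]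
          bilinear_form_product[OF f(1) g(1)]]) (simp add: f'(2) g'(2))
  also have "\<dots> = L'.star f' g' (q x)"
    using comult_hopf_hom[OF q_hopf_hom x(1) bilinear_form_product[OF f'(1) g'(1)]]
    by (simp add: L'.star_def)
  also have "\<dots> = 0"
    using functional_zero[OF L'.is_superalgebra L'.linear_star] x(2) by simp
  finally show "L.star f g x = 0" .
qed

text \<open>Since \<open>q\<close> is onto and preserves counit and product, a form on
  \<open>L\<close> that descends is a derivation at the counit exactly when its descent is.\<close>

lemma Lie_sub_eq: "Lie_sub L L' q = {f \<in> Lie L. vanishes f}"
proof (intro subset_antisym subsetI)
  fix f assume "f \<in> Lie_sub L L' q"
  then obtain g where g: "g \<in> Lie L'" "f = (\<lambda>x. if x \<in> carrier L then g (q x) else 0)"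
    by (auto simp: Lie_sub_def)
  note qlin = linear_mapD[OF superalgebra_homD(1)[OF q_hom]]
  have "f \<in> Lie L"
  proof (rule L.LieI)
    show "linear_map L ground f"
      using linear_map_comp[OF superalgebra_homD(1)[OF q_hom] L'.Lie_linear[OF g(1)]]
      by (auto simp: linear_map_def g(2))
    show "f \<one>\<^bsub>L\<^esub> = 0" using L'.Lie_one[OF g(1)] superalgebra_homD(2)[OF q_hom] by (simp add: g(2))
    show "f (x \<otimes>\<^bsub>L\<^esub> y) = f x * counit L y + counit L x * f y" if "x \<in> carrier L" "y \<in> carrier L" for x y
      using that L'.Lie_mult[OF g(1) qlin(1) qlin(1)] superalgebra_homD(4)[OF q_hom] q_hopf_hom
      by (simp add: g(2) hopf_superalgebra_hom_def)
  qed (simp add: g(2))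
  moreover have "vanishes f"
    using functional_zero[OF L'.is_superalgebra L'.Lie_linear[OF g(1)]] by (simp add: vanishes_def g(2))
  ultimately show "f \<in> {f \<in> Lie L. vanishes f}" by simp
next
  fix f assume "f \<in> {f \<in> Lie L. vanishes f}"
  then have f: "f \<in> Lie L" "vanishes f" by auto
  obtain g where g: "linear_map L' ground g" "\<And>x. x \<in> carrier L \<Longrightarrow> g (q x) = f x"
    "\<And>y. y \<notin> carrier L' \<Longrightarrow> g y = 0"
    using vanishes_factor[OF L.Lie_linear[OF f(1)] f(2)] by blast
  have "g \<in> Lie L'"
  proof (rule L'.LieI[OF g(1) g(3)])
    show "g \<one>\<^bsub>L'\<^esub> = 0"
      using g(2)[of "\<one>\<^bsub>L\<^esub>"] superalgebra_homD(2)[OF q_hom] L.Lie_one[OF f(1)] by simp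
    fix y y' assume "y \<in> carrier L'" "y' \<in> carrier L'"
    then obtain x x' where x: "x \<in> carrier L" "x' \<in> carrier L" "y = q x" "y' = q x'"
      using q_surj by blast
    then have "y \<otimes>\<^bsub>L'\<^esub> y' = q (x \<otimes>\<^bsub>L\<^esub> x')" using superalgebra_homD(4)[OF q_hom] by simp
    with x show "g (y \<otimes>\<^bsub>L'\<^esub> y') = g y * counit L' y' + counit L' y * g y'"
      using q_hopf_hom by (simp add: g(2) L.Lie_mult[OF f(1)] hopf_superalgebra_hom_def)
  qed
  moreover have "f = (\<lambda>x. if x \<in> carrier L then g (q x) else 0)"
    using g(2) L.Lie_outside[OF f(1)] by auto
  ultimately show "f \<in> Lie_sub L L' q" unfolding Lie_sub_def by blast
qed

text \<open>\<open>q\<close> preserves parity, so its kernel is stable under taking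
  components.\<close>

lemma vanishes_dual_component:
  assumes "f \<in> Lie L" "vanishes f"
  shows "vanishes (dual_component L i f)"
  unfolding vanishes_def
proof (intro ballI impI)
  fix x assume x: "x \<in> carrier L" "q x = \<zero>\<^bsub>L'\<^esub>"
  have "q (component L i x) = component L' i (q x)"
    using superalgebra_hom_component[OF L.is_superalgebra L'.is_superalgebra q_hom x(1)] by simp
  then have "q (component L i x) = \<zero>\<^bsub>L'\<^esub>"
    using x(2) by simp
  then show "dual_component L i f x = 0"
    using assms(2) x(1) by (simp add: vanishes_def dual_component_def)
qed

text \<open>The commutator point \<open>1 + D\<epsilon>\<eta>\<close> factors through
  \<open>q\<close>, so its \<epsilon>\<eta>-coefficient kills the kernel of
  \<open>q\<close>.\<close>

lemma generator_vanishes: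
  assumes D: "D \<in> L.Lie_part 0" "D za = 2" "D zb = 4" "D zt = 0"
  shows "vanishes D"
  unfolding vanishes_def
proof (intro ballI impI)
  fix x assume x: "x \<in> carrier L" "q x = \<zero>\<^bsub>L'\<^esub>"
  have "restrict (pt3 D) (carrier L) \<in> subpoints L L' q (Q 1 1)"
    using comm commutator_point[OF D] Q_alg[of 1 1] by (auto simp: contains_commutators_def)
  then obtain k where k: "superalgebra_hom L' (Q 1 1) k"
    "restrict (pt3 D) (carrier L) = compose (carrier L) k q"
    by (auto simp: subpoints_def points_def)
  have "pt3 D x = k \<zero>\<^bsub>L'\<^esub>"
    using fun_cong[OF k(2), of x] x by (simp add: compose_def)
  also have "\<dots> = \<zero>\<^bsub>Q 1 1\<^esub>"
    by (rule linear_map_zero[OF L'.is_superalgebra Q.superalgebra_axioms superalgebra_homD(1)[OF k(1)]])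
  finally show "D x = 0" by (simp add: pt3_def)
qed

text \<open>\<open>w\<close> is tangent to \<open>L'\<close> because the one-parameter subgroup
  \<open>u \<mapsto> (e\<^sup>u\<^sup>/\<^sup>2, u e\<^sup>u\<^sup>/\<^sup>2, 0)\<close> is Zariski dense in the even part of \<open>L\<close>.\<close>

lemma transversal_vanishes: "\<exists>w\<in>Lie L. vanishes w \<and> w za = 0 \<and> w zb = 1"
proof -
  obtain D where D: "D \<in> L.Lie_part 0" "D za = 2" "D zb = 4" "D zt = 0"
    using even_generator by blast
  note D_Lie = L.Lie_partD(1)[OF D(1)]
  \<comment> \<open>The subgroup is generated by \<open>D / 4\<close>, with coordinates
    \<open>(1/2, 1, 0)\<close>: its first coordinate solves E' = E/2, and the second becomes u E
    with coefficient 1.\<close>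
  define E :: "'k fps" where "E = fps_exp (1 / 2)"
  have E: "E \<in> exp_poly_ring" by (simp add: E_def)
  have "enc (E, 0, 0, 0) \<in> Units (Q 1 1)"
  proof -
    have inv: "fps_exp (- 1 / 2) * E = 1"
      unfolding E_def by (subst fps_exp_add_mult[symmetric]) simp
    have "enc (E, 0, 0, 0) \<in> carrier (Q 1 1)" using E by simp
    moreover have "enc (fps_exp (- 1 / 2), 0, 0, 0) \<in> carrier (Q 1 1)" by simp
    ultimately show ?thesis
      unfolding Units_def using inv
      by (intro CollectI conjI bexI[of _ "enc (fps_exp (- 1 / 2), 0, 0, 0)"])
        (simp_all add: mult.commute)
  qed
  then obtain F where F: "superalgebra_hom L (Q 1 1) F" "F za = enc (E, 0, 0, 0)"
    "F zb = enc (fps_X * E, 0, 0, 0)" "F zt = enc (0, 0, 0, 0)"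
    using hom_exists_coordinates[OF Q_alg, of "enc (E, 0, 0, 0)" 1 1 "enc (fps_X * E, 0, 0, 0)" "enc (0, 0, 0, 0)"] E
    by auto
  define p where "p = (\<lambda>x. cf0 (F x))"
  have p: "p za = E" "p zb = fps_X * E" "p zt = 0" by (simp_all add: p_def F)
  have p_counit: "fps_nth (p x) 0 = counit L x" if "x \<in> carrier L" for x
    unfolding p_def by (rule hom_counit[OF F(1) _ _ that]) (simp_all add: F E_def)
  have p_parity: "k = 0" if "x \<in> part L k" "p x \<noteq> 0" for x k
    using Q_hom_cf(2)[OF F(1) that(1)] that(2) by (simp add: p_def)
  have deriv_parity: "k = 0" if "x \<in> part L k" "fps_deriv (p x) \<noteq> 0" for x k
    using p_parity[OF that(1)] that(2) by fastforce
  have p_simps: "\<And>x y. x \<in> carrier L \<Longrightarrow> y \<in> carrier L \<Longrightarrow> p (x \<otimes>\<^bsub>L\<^esub> y) = p x * p y"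
    "\<And>x y. x \<in> carrier L \<Longrightarrow> y \<in> carrier L \<Longrightarrow> p (x \<oplus>\<^bsub>L\<^esub> y) = p x + p y"
    "\<And>r x. x \<in> carrier L \<Longrightarrow> p (r \<odot>\<^bsub>L\<^esub> x) = fps_const r * p x"
    "\<And>x. x \<in> carrier L \<Longrightarrow> p x \<in> exp_poly_ring"
    unfolding p_def using Q_hom_cf(3,6,7,9)[OF F(1)] by blast+
  have p_one: "p \<one>\<^bsub>L\<^esub> = 1" using Q_hom_cf(8)[OF F(1)] by (simp add: p_def)
  let ?G = "\<lambda>x. enc (p x, 0, 0, 0)"
  \<comment> \<open>\<open>?H\<close> is the point p(u + 4\<epsilon>\<eta>), which is p +
    4p'\<epsilon>\<eta> because the square of \<epsilon>\<eta> is 0.\<close>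
  let ?H = "\<lambda>x. enc (p x, 0, 0, 4 * fps_deriv (p x))"
  have four: "(4 :: 'k fps) \<in> exp_poly_ring"
    using exp_poly_ring_closed(3)[of "4 :: 'k"] by (simp add: numeral_fps_const)
  have G: "superalgebra_hom L (Q 1 1) ?G"
    by (rule Q_homI) (use p_simps p_one p_parity L.part_carrier in auto)
  have H: "superalgebra_hom L (Q 1 1) ?H"
    by (rule Q_homI) (use p_simps p_one p_parity deriv_parity L.part_carrier four in
        \<open>auto simp: algebra_simps simp del: fps_deriv_eq_0_iff\<close>)
  have D_hom: "superalgebra_hom L (Q 1 1) (pt3 D)"
    using pt_hom(3)[of D 1 1] D(1) by simp
  have "?G zb \<otimes>\<^bsub>Q 1 1\<^esub> ?G zt = \<zero>\<^bsub>Q 1 1\<^esub>" "pt3 D zb \<otimes>\<^bsub>Q 1 1\<^esub> pt3 D zt = \<zero>\<^bsub>Q 1 1\<^esub>"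
    by (simp_all add: p pt3_def D)
  note co = convolution_Q[OF G this(1) D_hom this(2)]
  have E': "fps_deriv E = fps_const (1 / 2) * E" by (simp add: E_def)
  have four_half: "4 * (fps_const (1 / 2) * g) = fps_const 2 * (g :: 'k fps)" for g
    by (simp add: numeral_fps_const mult.assoc[symmetric])
  \<comment> \<open>The one-parameter subgroup equation: translation by
    \<open>1 + D\<epsilon>\<eta>\<close> advances u by 4\<epsilon>\<eta>. Both sides are points, so
    agreement of three coordinates suffices.\<close>
  have conv: "convolution L (Q 1 1) ?G (pt3 D) x = ?H x" if "x \<in> carrier L" for x
    by (rule hom_eqI[OF Q_alg convolution_Q_hom[OF G D_hom] H _ _ _ that]; unfold co)
      (simp_all add: p pt3_def D E' four_half distrib_left mult.left_commute[of fps_X]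
        numeral_fps_const[symmetric] mult.commute)
  \<comment> \<open>Comparing coefficients of \<epsilon>\<eta> and of the n-th power of u expresses
    the next Taylor coefficient through a convolution with \<open>D\<close>; in characteristic zero
    the factor can be divided out.\<close>
  have step: "L.star (\<lambda>a. fps_nth (p a) n) D x = 4 * of_nat (Suc n) * fps_nth (p x) (Suc n)"
    if x: "x \<in> carrier L" for x n
  proof -
    have "L.star (\<lambda>a. fps_nth (p a) n) D x = fps_nth (cf3 (convolution L (Q 1 1) ?G (pt3 D) x)) n"
      using convolution_cf(4)[OF G D_hom x, of n] by (simp add: pt3_def L.star_def)
    also have "\<dots> = fps_nth (fps_const 4 * fps_deriv (p x)) n"
      unfolding conv[OF x] by (simp add: numeral_fps_const)
    finally show ?thesis by (simp add: algebra_simps)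
  qed
  have lin: "linear_map L ground (\<lambda>x. fps_nth (p x) n)" for n
    by (simp add: linear_map_def p_simps)
  have van: "vanishes (\<lambda>x. fps_nth (p x) n)" for n
  proof (induction n)
    case 0
    have "counit L x = counit L' (q x)" if "x \<in> carrier L" for x
      using q_hopf_hom that by (simp add: hopf_superalgebra_hom_def)
    then show ?case
      using functional_zero[OF L'.is_superalgebra L'.linear_counit] by (simp add: vanishes_def p_counit)
  next
    case (Suc n)
    have "vanishes (L.star (\<lambda>x. fps_nth (p x) n) D)"
      by (rule vanishes_star[OF lin Suc L.Lie_linear[OF D_Lie] generator_vanishes[OF D]])
    then show ?case by (auto simp: vanishes_def step simp del: of_nat_Suc)
  qed
  \<comment> \<open>The derivative at u = 0 with \<open>E\<close> frozen. Since \<open>w x\<close>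
    depends on \<open>x\<close> only through \<open>p x\<close>, and \<open>p\<close> kills the
    kernel of \<open>q\<close>, so does \<open>w\<close>.\<close>
  define w where "w = (\<lambda>x. if x \<in> carrier L then fps_nth (exp_poly_deriv (p x)) 0 else 0)"
  note pd = exp_poly_ring_deriv[OF p_simps(4)]
  have "w \<in> Lie L"
  proof (rule L.LieI)
    show "linear_map L ground w"
      unfolding linear_map_def
    proof (intro conjI ballI allI)
      show "w (x \<oplus>\<^bsub>L\<^esub> y) = w x \<oplus>\<^bsub>ground\<^esub> w y" if "x \<in> carrier L" "y \<in> carrier L" for x y
        using that exp_poly_deriv_eq[OF exp_polys_add[OF pd[OF that(1)] pd[OF that(2)]]]
        by (simp add: w_def p_simps)
      show "w (r \<odot>\<^bsub>L\<^esub> x) = r \<odot>\<^bsub>ground\<^esub> w x" if "x \<in> carrier L" for r x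
        using that exp_poly_deriv_eq[OF exp_polys_mult[OF exp_polys_const[of r] pd[OF that]]]
        by (simp add: w_def p_simps)
    qed simp
    show "w \<one>\<^bsub>L\<^esub> = 0"
      using exp_poly_deriv_eq[OF exp_polys_const[of "1 :: 'k"]] by (simp add: w_def p_one)
    show "w (x \<otimes>\<^bsub>L\<^esub> y) = w x * counit L y + counit L x * w y" if "x \<in> carrier L" "y \<in> carrier L" for x y
      using that exp_poly_deriv_eq[OF exp_polys_mult[OF pd[OF that(1)] pd[OF that(2)]]]
      by (simp add: w_def p_simps p_counit[symmetric])
  qed (simp add: w_def)
  moreover have "vanishes w"
  proof -
    have "p x = 0" if "x \<in> carrier L" "q x = \<zero>\<^bsub>L'\<^esub>" for x
      using van that by (intro fps_ext) (simp add: vanishes_def)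
    moreover have "exp_poly_deriv (0 :: 'k fps) = 0"
      by (rule exp_poly_deriv_eq[OF exp_polys.zero])
    ultimately show ?thesis
      by (auto simp: vanishes_def w_def)
  qed
  \<comment> \<open>The polynomial factor of \<open>p za\<close> is 1 and that of
    \<open>p zb\<close> is u, so freezing the exponential gives the derivatives 0 and 1.\<close>
  moreover have "w za = 0"
    using exp_poly_deriv_eq[OF exp_polys_monomial[of "1 / 2 :: 'k" 1]] by (simp add: w_def p E_def)
  moreover have "w zb = 1"
    using exp_poly_deriv_eq[OF exp_polys_monomial[of "1 / 2 :: 'k" "[:0, 1:]"]]
    by (simp add: w_def p E_def mult.commute pderiv_pCons)
  ultimately show ?thesis by blast
qed

lemma Lie_derived_psubset_Lie_sub:
  "Lie_supersubalgebra L (Lie_derived L) \<and> Lie_supersubalgebra L (Lie_sub L L' q) \<and>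
    Lie_derived L \<subset> Lie_sub L L' q"
proof -
  obtain D where D: "D \<in> L.Lie_part 0" "D za = 2" "D zb = 4" "D zt = 0"
    "Lie_derived L = {\<lambda>x. r * D x | r. True}"
    using even_generator by blast
  note D_Lie = L.Lie_partD(1)[OF D(1)]
  have bracket: "Lie_bracket L f g \<in> Lie_derived L" if "f \<in> Lie L" "g \<in> Lie L" for f g
    unfolding Lie_derived_def using that
    by (intro CollectI exI[of _ "1::nat"] exI[of _ "\<lambda>_. 1"] exI[of _ "\<lambda>_. f"] exI[of _ "\<lambda>_. g"]) simp
  have derived_Lie: "Lie_derived L \<subseteq> Lie L"
    using L.Lie_scale[OF D_Lie] by (auto simp: D(5))
  have derived_sub: "Lie_derived L \<subseteq> Lie_sub L L' q"
    using derived_Lie generator_vanishes[OF D(1-4)] by (auto simp: Lie_sub_eq D(5) vanishes_def)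
  obtain w where w: "w \<in> Lie L" "vanishes w" "w za = 0" "w zb = 1"
    using transversal_vanishes by blast
  \<comment> \<open>A multiple of \<open>D\<close> that vanishes at \<open>za\<close> is 0, because
    \<open>D za = 2\<close>.\<close>
  have "w \<notin> Lie_derived L"
    using w(3,4) by (auto simp: D(5) D(2,3))
  with w have proper: "Lie_derived L \<subset> Lie_sub L L' q"
    using derived_sub by (auto simp: Lie_sub_eq)
  have "Lie_supersubalgebra L (Lie_derived L)"
    unfolding Lie_supersubalgebra_def
  proof (intro conjI ballI allI)
    show "(\<lambda>x. 0) \<in> Lie_derived L"
      unfolding D(5) by (intro CollectI exI[of _ 0]) simp
    show "(\<lambda>x. f x + g x) \<in> Lie_derived L" if fg: "f \<in> Lie_derived L" "g \<in> Lie_derived L" for f g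
    proof -
      obtain r where "f = (\<lambda>x. r * D x)" using fg(1) unfolding D(5) by auto
      moreover obtain s where "g = (\<lambda>x. s * D x)" using fg(2) unfolding D(5) by auto
      ultimately show ?thesis unfolding D(5) by (intro CollectI exI[of _ "r + s"]) (simp add: distrib_right)
    qed
    show "(\<lambda>x. r * f x) \<in> Lie_derived L" if f: "f \<in> Lie_derived L" for r f
    proof -
      obtain s where "f = (\<lambda>x. s * D x)" using f unfolding D(5) by auto
      then show ?thesis unfolding D(5) by (intro CollectI exI[of _ "r * s"]) (simp add: mult.assoc)
    qed
    show "dual_component L i f \<in> Lie_derived L" if f: "f \<in> Lie_derived L" for i f
    proof -
      obtain s where s: "f = (\<lambda>x. s * D x)" using f unfolding D(5) by auto
      then have "f \<in> L.Lie_part 0"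
        using D(1) L.Lie_scale[OF D_Lie] by (simp add: L.Lie_part_def)
      from L.dual_component_Lie_part[OF this, of i] have "dual_component L i f = (\<lambda>x. (if i = 0 then s else 0) * D x)"
        by (simp add: s)
      then show ?thesis unfolding D(5) by blast
    qed
    show "Lie_bracket L f g \<in> Lie_derived L" if "f \<in> Lie_derived L" "g \<in> Lie_derived L" for f g
      using that derived_Lie by (intro bracket) auto
  qed (use derived_Lie in simp)
  moreover have "Lie_supersubalgebra L (Lie_sub L L' q)"
    unfolding Lie_supersubalgebra_def
  proof (intro conjI ballI allI)
    show "dual_component L i f \<in> Lie_sub L L' q" if "f \<in> Lie_sub L L' q" for i f
      using that L.Lie_partD(1)[OF L.Lie_dual_component] vanishes_dual_component by (simp add: Lie_sub_eq)
    \<comment> \<open>Every bracket of \<open>Lie L\<close> lies in the derived superalgebra, hence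
      already in \<open>Lie_sub L L' q\<close>.\<close>
    show "Lie_bracket L f g \<in> Lie_sub L L' q" if "f \<in> Lie_sub L L' q" "g \<in> Lie_sub L L' q" for f g
      using that bracket derived_sub by (auto simp: Lie_sub_eq)
  qed (auto simp: Lie_sub_eq vanishes_def L.Lie_zero L.Lie_add L.Lie_scale)
  ultimately show ?thesis using proper by blast
qed

end

end

section \<open>Points of L inside GL(2|2)\<close>

text \<open>Four power series are interleaved into one sequence: position \<open>4 * n + i\<close>
  holds the n-th coefficient of the i-th series.\<close>

lemma quad_embedding:
  fixes e :: "(nat \<Rightarrow> 'k::field_char_0) \<Rightarrow> 'c"
  assumes "inj e"
  shows "\<exists>enc :: 'k quad \<Rightarrow> 'c. inj enc"
proof -
  define s :: "'k quad \<Rightarrow> nat \<Rightarrow> 'k" where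
    "s = (\<lambda>(a, b, c, d) n. fps_nth ([a, b, c, d] ! (n mod 4)) (n div 4))"
  have "inj s"
  proof (rule injI)
    fix x y assume eq: "s x = s y"
    obtain a b c d a' b' c' d' where xy: "x = (a, b, c, d)" "y = (a', b', c', d')"
      by (cases x; cases y) auto
    have *: "fps_nth ([a, b, c, d] ! i) n = fps_nth ([a', b', c', d'] ! i) n" if "i < 4" for i n
      using fun_cong[OF eq, of "4 * n + i"] that by (simp add: s_def xy)
    have "a = a'" "b = b'" "c = c'" "d = d'"
      using *[of 0] *[of 1] *[of 2] *[of 3] by (auto intro!: fps_ext)
    then show "x = y" by (simp add: xy)
  qed
  with assms have "inj (e \<circ> s)" by (rule inj_compose)
  then show ?thesis by blast
qed

text \<open>Points of \<open>L\<close> are pulled back along \<open>p\<close> to points of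
  \<open>A\<close>. There the isomorphism with \<open>GL 2 2\<close> supplies uniqueness and the
  matrix product, and the hypothesis on \<open>subpoints\<close> the shape of the matrices.\<close>

lemma L_points_intro:
  fixes A L :: "('k::field_char_0, 'c) hopf_superalgebra"
  assumes enc: "inj (enc :: 'k quad \<Rightarrow> 'c)"
    and GL22: "represents_GL 2 2 A \<xi>"
    and L: "closed_supersubgroup A L p"
    and L_points: "\<And>C :: ('k, 'c) superalgebra. supercommutative_superalgebra C \<Longrightarrow>
      coordinate_matrix 4 \<xi> ` subpoints A L p C = L_matrices C"
  shows "L_points enc L (\<lambda>ij. p (\<xi> ij))"
proof -
  have sg: "supergroup A" "supergroup L" and hh: "hopf_superalgebra_hom A L p"
    and surj: "p ` carrier A = carrier L"
    using L by (auto simp: closed_supersubgroup_def)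
  interpret A: supergroup A by fact
  interpret L: supergroup L by fact
  have p: "superalgebra_hom A L p" using hh by (simp add: hopf_superalgebra_hom_def)
  have xi: "\<xi> (i, j) \<in> carrier A" if "i < 4" "j < 4" for i j
    using GL22 that by (simp add: represents_GL_def)
  have iso: "coordinate_matrix 4 \<xi> \<in> iso (points A C) (GL 2 2 C)"
    if "supercommutative_superalgebra C" for C :: "('k, 'c) superalgebra"
    using GL22 that by (simp add: represents_GL_def)
  \<comment> \<open>A point must be \<open>extensional\<close>, so a bare homomorphism is restricted
    before and after composition with \<open>p\<close>.\<close>
  have comp_point: "compose (carrier A) (restrict f (carrier L)) p \<in> carrier (points A C)"
    and comp_sub: "compose (carrier A) (restrict f (carrier L)) p \<in> subpoints A L p C"
    if f: "superalgebra_hom L C f" for f and C :: "('k, 'c) superalgebra"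
  proof -
    have "superalgebra_hom A C (compose (carrier A) (restrict f (carrier L)) p)"
      by (rule superalgebra_homI)
        (use superalgebra_homD[OF f] superalgebra_homD[OF p] linear_mapD[OF superalgebra_homD(1)[OF f]]
          linear_mapD[OF superalgebra_homD(1)[OF p]] A.part_carrier in \<open>auto simp: compose_def\<close>)
    then show "compose (carrier A) (restrict f (carrier L)) p \<in> carrier (points A C)"
      by (simp add: points_def)
    have "superalgebra_hom L C (restrict f (carrier L))"
      by (rule superalgebra_homI)
        (use superalgebra_homD[OF f] linear_mapD[OF superalgebra_homD(1)[OF f]] L.part_carrier in auto)
    then show "compose (carrier A) (restrict f (carrier L)) p \<in> subpoints A L p C"
      by (simp add: subpoints_def points_def)
  qed
  have coord: "coordinate_matrix 4 \<xi> (compose (carrier A) (restrict f (carrier L)) p) (i, j) = f (p (\<xi> (i, j)))"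
    if "i < 4" "j < 4" for f i j and C :: "('k, 'c) superalgebra"
    using that xi superalgebra_homD(5)[OF p] by (simp add: coordinate_matrix_def compose_def)
  show ?thesis
  proof (unfold_locales)
    show "inj enc" by (rule enc)
    show "p (\<xi> (i, j)) \<in> carrier L" if "i < 4" "j < 4" for i j
      using xi[OF that] superalgebra_homD(5)[OF p] by simp
  next
    fix f and C :: "('k, 'c) superalgebra"
    assume C: "supercommutative_superalgebra C" and f: "superalgebra_hom L C f"
    have "coordinate_matrix 4 \<xi> (compose (carrier A) (restrict f (carrier L)) p) \<in> L_matrices C"
      using L_points[OF C] comp_sub[OF f] by blast
    then obtain \<alpha> \<beta> t where *: "\<alpha> \<in> part C 0 \<inter> Units C" "\<beta> \<in> part C 0" "t \<in> part C 1"
      "coordinate_matrix 4 \<xi> (compose (carrier A) (restrict f (carrier L)) p) = L_matrix C \<alpha> \<beta> t"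
      unfolding L_matrices_def by blast
    from *(4) coord[of _ _ f] have "\<forall>i<4. \<forall>j<4. f (p (\<xi> (i, j))) = L_matrix C \<alpha> \<beta> t (i, j)" by simp
    with * show "\<exists>\<alpha> \<beta> t. \<alpha> \<in> part C 0 \<inter> Units C \<and> \<beta> \<in> part C 0 \<and> t \<in> part C 1 \<and>
        (\<forall>i<4. \<forall>j<4. f (p (\<xi> (i, j))) = L_matrix C \<alpha> \<beta> t (i, j))" by blast
  next
    fix \<alpha> \<beta> t and C :: "('k, 'c) superalgebra"
    assume C: "supercommutative_superalgebra C" and *: "\<alpha> \<in> part C 0 \<inter> Units C" "\<beta> \<in> part C 0" "t \<in> part C 1"
    then have "L_matrix C \<alpha> \<beta> t \<in> coordinate_matrix 4 \<xi> ` subpoints A L p C"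
      unfolding L_points[OF C] L_matrices_def by blast
    then obtain f where f: "f \<in> extensional (carrier L)" "superalgebra_hom L C f"
      "L_matrix C \<alpha> \<beta> t = coordinate_matrix 4 \<xi> (compose (carrier A) f p)"
      by (auto simp: subpoints_def points_def)
    then have "\<forall>i<4. \<forall>j<4. f (p (\<xi> (i, j))) = L_matrix C \<alpha> \<beta> t (i, j)"
      using coord[of _ _ f] by (simp add: extensional_restrict)
    with f show "\<exists>f. superalgebra_hom L C f \<and> (\<forall>i<4. \<forall>j<4. f (p (\<xi> (i, j))) = L_matrix C \<alpha> \<beta> t (i, j))"
      by blast
  next
    fix f g x and C :: "('k, 'c) superalgebra"
    assume C: "supercommutative_superalgebra C" and f: "superalgebra_hom L C f" and g: "superalgebra_hom L C g"
      and eq: "\<And>i j. i < 4 \<Longrightarrow> j < 4 \<Longrightarrow> f (p (\<xi> (i, j))) = g (p (\<xi> (i, j)))" and x: "x \<in> carrier L"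
    have "coordinate_matrix 4 \<xi> (compose (carrier A) (restrict f (carrier L)) p) =
        coordinate_matrix 4 \<xi> (compose (carrier A) (restrict g (carrier L)) p)"
      using eq coord[of _ _ f] coord[of _ _ g]
      by (intro extensionalityI[of _ "{..<4} \<times> {..<4}"]) (auto simp: coordinate_matrix_def)
    then have "compose (carrier A) (restrict f (carrier L)) p = compose (carrier A) (restrict g (carrier L)) p"
      using iso[OF C] comp_point[OF f] comp_point[OF g] by (auto simp: iso_def bij_betw_def inj_on_def)
    then have *: "compose (carrier A) (restrict f (carrier L)) p y = compose (carrier A) (restrict g (carrier L)) p y"
      for y by simp
    \<comment> \<open>Surjectivity of \<open>p\<close> carries the equality of the pulled-back
      points over to all of \<open>L\<close>.\<close>
    obtain y where "y \<in> carrier A" "x = p y" using surj x by blast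
    with *[of y] x show "f x = g x" by (simp add: compose_def)
  next
    fix f g i j and C :: "('k, 'c) superalgebra"
    assume C: "supercommutative_superalgebra C" and f: "superalgebra_hom L C f" and g: "superalgebra_hom L C g"
      and ij: "i < (4::nat)" "j < (4::nat)"
    interpret C: supercommutative_superalgebra C by fact
    let ?f = "compose (carrier A) (restrict f (carrier L)) p"
    let ?g = "compose (carrier A) (restrict g (carrier L)) p"
    have "coordinate_matrix 4 \<xi> (?f \<otimes>\<^bsub>points A C\<^esub> ?g) =
        coordinate_matrix 4 \<xi> ?f \<otimes>\<^bsub>GL 2 2 C\<^esub> coordinate_matrix 4 \<xi> ?g"
      using iso[OF C] comp_point[OF f] comp_point[OF g] by (simp add: iso_def hom_def)
    from fun_cong[OF this, of "(i, j)"]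
    have "convolution A C ?f ?g (\<xi> (i, j)) =
        (\<Oplus>\<^bsub>C\<^esub>l\<in>{..<4}. coordinate_matrix 4 \<xi> ?f (i, l) \<otimes>\<^bsub>C\<^esub> coordinate_matrix 4 \<xi> ?g (l, j))"
      using ij xi[OF ij]
      by (simp add: GL_def units_of_def supermatrix_monoid_def points_def coordinate_matrix_def)
    also have "\<dots> = (\<Oplus>\<^bsub>C\<^esub>l\<in>{..<4}. f (p (\<xi> (i, l))) \<otimes>\<^bsub>C\<^esub> g (p (\<xi> (l, j))))"
      using ij superalgebra_homD(5)[OF f] superalgebra_homD(5)[OF g] superalgebra_homD(5)[OF p] xi
      by (intro C.finsum_cong') (auto simp: coord)
    also have "convolution A C ?f ?g (\<xi> (i, j)) = convolution L C f g (p (\<xi> (i, j)))"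
      by (rule convolution_hopf_hom[OF A.hopf_superalgebra_axioms L.hopf_superalgebra_axioms C hh
            superalgebra_homD(1)[OF f] superalgebra_homD(1)[OF g] xi[OF ij]])
        (use superalgebra_homD(5)[OF p] in \<open>simp_all add: compose_def\<close>)
    finally show "convolution L C f g (p (\<xi> (i, j))) =
        (\<Oplus>\<^bsub>C\<^esub>l\<in>{..<4}. f (p (\<xi> (i, l))) \<otimes>\<^bsub>C\<^esub> g (p (\<xi> (l, j))))" .
  qed
qed

theorem mainTheorem3:
  fixes A L L' :: "('k::field_char_0, 'c) hopf_superalgebra"
    and \<xi> :: "nat \<times> nat \<Rightarrow> 'c"
    and p q :: "'c \<Rightarrow> 'c"
  assumes universe: "\<exists>e :: (nat \<Rightarrow> 'k) \<Rightarrow> 'c. inj e"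
    and GL22: "represents_GL 2 2 A \<xi>"
    and L: "closed_supersubgroup A L p"
    and L_points: "\<And>C :: ('k, 'c) superalgebra. supercommutative_superalgebra C \<Longrightarrow>
      coordinate_matrix 4 \<xi> ` subpoints A L p C = L_matrices C"
    and L': "commutator_supersubgroup L L' q"
  shows "Lie_supersubalgebra L (Lie_derived L) \<and> Lie_supersubalgebra L (Lie_sub L L' q) \<and>
      Lie_derived L \<subset> Lie_sub L L' q \<and> Lie_sub L L' q \<noteq> Lie_derived L"
proof -
  from universe obtain enc :: "'k quad \<Rightarrow> 'c" where "inj enc"
    using quad_embedding by blast
  then have "L_points enc L (\<lambda>ij. p (\<xi> ij))"
    by (rule L_points_intro[OF _ GL22 L L_points])
  then interpret L_points enc L "\<lambda>ij. p (\<xi> ij)" .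
  have "closed_supersubgroup L L' q" "contains_commutators L L' q"
    using L' by (auto simp: commutator_supersubgroup_def)
  from Lie_derived_psubset_Lie_sub[OF this] show ?thesis by blast
qed

end
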